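(* Let $\mathbf K=\mathbf H$ or $\mathbf K=\mathbf O$, let $T$ be a selfadjoint quasilinear operator in a Hilbert space $X$ over $\mathbf K$, let $\hat E$ be the decomposition of the unity for $T$, and let $f$ be a $\mathbf K$-valued Borel function defined $\hat E$-almost everywhere on $\mathbf K$. Then $f(T)$ is a closed quasilinear operator with everywhere dense domain of definition; moreover: (a) $\mathcal D(f(T))=\{x:\ \int_{-\infty}^{\infty}|f(z)|^2\langle\hat E(dz)x;x\rangle<\infty\}$; (b) $\langle f(T)x;y\rangle=\int_{-\infty}^{\infty}\langle\hat E(dz).f(z)x;y\rangle$ for $x\in\mathcal D(f(T))$ and $y\in X$; (c) $|f(T)x|^2=\int_{-\infty}^{\infty}|f(z)|^2\langle\hat E(dz)x;x\rangle$ for $x\in\mathcal D(f(T))$; (d) $f(T)^*=\tilde f(T)$; (e) $R(q;T)=\int_{-\infty}^{\infty}\hat E(dz).(q-z)^{-1}$ for $q\in\rho(T)$.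
   Context: $\mathbf H$ denotes the quaternions and $\mathbf O$ the octonions, regarded as real algebras with conjugation $z\mapsto\tilde z$, norm $|z|=(z\tilde z)^{1/2}$ and standard generators $i_0=1,i_1,\dots,i_m$, where $m=3$ for $\mathbf H$ and $m=7$ for $\mathbf O$. $\mathbf K$-vector spaces: additive groups with left and right multiplication by scalars of $\mathbf K$, distributive on both sides, with $a(bv)=(ab)v$, $(vb)a=v(ba)$ if $\mathbf K=\mathbf H$, respectively $b(bv)=b^2v$, $(vb)b=vb^2$ if $\mathbf K=\mathbf O$; such a space decomposes as $X=X_0\oplus X_1i_1\oplus\dots\oplus X_mi_m$ with $X_0,\dots,X_m$ pairwise isomorphic real vector spaces whose elements commute with scalars. A Hilbert space over $\mathbf K$ is such an $X$ with a biadditive, $\mathbf R$-bilinear map $\langle\cdot;\cdot\rangle:X^2\to\mathbf K$ with $\langle x;x\rangle\ge0$ real, $=0$ only for $x=0$; $\langle x;y\rangle=\langle y;x\rangle^{\sim}$; $\langle xa;yb\rangle=\tilde a\langle x;y\rangle b$ if $\mathbf K=\mathbf H$, $\langle xa;x\rangle=\tilde a\langle x;x\rangle$ if $\mathbf K=\mathbf O$; $\langle x_p;y_q\rangle\in\mathbf R$ and $\langle x_pi_p;y_qi_q\rangle=\langle x_p;y_q\rangle\tilde i_pi_q$ for $x_p\in X_p,y_q\in X_q$; complete in the norm $|x|=\langle x;x\rangle^{1/2}$. A quasilinear operator $T$ in $X$, with dense $\mathbf K$-vector domain $\mathcal D(T)$, is an additive and $\mathbf R$-homogeneous (possibly unbounded)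 map $\mathcal D(T)\to X$. The adjoint is defined by $\langle Tx;y\rangle=\langle x;T^*y\rangle$, for $y$ such that $x\mapsto\langle Tx;y\rangle$ is continuous on $\mathcal D(T)$. $T$ is selfadjoint if $T^*=T$. The resolvent set $\rho(T)$ is the set of $z\in\mathbf K$ for which $R(z;T)=(zI-T)^{-1}$ exists as a bounded quasilinear operator $X\to\mathcal D(T)$; $\sigma(T)=\mathbf K\setminus\rho(T)$, and $\sigma(T)\subset\mathbf R$ for selfadjoint $T$. Spectral measures. A (noncommutative) regular $\mathbf K$-valued measure $\hat\mu(\cdot;x,y)$ on $\mathcal B(\mathbf K)$ is given by regular real-valued measures $\mu_{i_v,i_l}(\cdot;x,y)$, $v,l=0,\dots,m$, via $\hat\mu(x,y).f=\sum_{v,l}\int f_v(\lambda)\,i_l\,\mu_{i_v,i_l}(d\lambda;x,y)$ for $f=\sum_vf_vi_v$ with $f_v$ real-valued, and $\hat\mu(\delta;x,y)=\hat\mu(x,y).\chi_\delta$. An $X$-projection valued spectral measure $\hat E$ assigns to each Borel set $\delta$ and $S\in\mathbf K$ operators $\hat E_S(\delta)=\hat E(\delta).S$, with $\hat E(\delta)=\hat E(\delta).1$ and $\langle(\hat E(\delta).S)x;y\rangle=\hat\mu(x,y).(S\chi_\delta)$, such that: $\langle\hat E(\delta)x;y\rangle=\hat\mu(\delta;x,y)$ is such a regular measure for all $x,y$; $(\hat E_S(\delta))^*=(-1)^{\kappa(S)}\hat E_S(\delta)$ on $X_0$ for pure $S$; $\hat E_{bS}=b\hat E_S$ for $b\in\mathbf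 R$ and pure $S$; $\hat E_{S_1S_2}(\delta\cap\gamma)=\hat E_{S_1}(\delta)\hat E_{S_2}(\gamma)$ for pure $S_1,S_2$ and Borel $\delta,\gamma$. Here a pure vector is $S=ci_q$, $c\in\mathbf R$, with $\kappa(ci_0)=0$, $\kappa(ci_v)=1$ for $v\ge1$. The operator $\int\hat E(dz).f(z)$ is determined by $\langle(\int\hat E(dz).f(z))x;y\rangle=\int\langle\hat E(dz).f(z)x;y\rangle=\hat\mu(x,y).f$. The decomposition of the unity for a selfadjoint $T$ is the unique regular countably additive selfadjoint spectral measure $\hat E$ on $\mathcal B(\mathbf K)$ with $\hat E|_{\rho(T)}=0$, $\mathcal D(T)=\{x:\int_{\sigma(T)}\langle(\hat E(dz).z^2)x;x\rangle<\infty\}$ and $Tx=\lim_n\int_{-n}^n(\hat E(dz).z)x$ for $x\in\mathcal D(T)$. For $f$ as in the claim, put $f_n(z)=f(z)$ if $|f(z)|\le n$ and $f_n(z)=0$ if $|f(z)|>n$; then $\mathcal D(f(T))=\{x:\lim_nf_n(T)x\text{ exists}\}$ and $f(T)x=\lim_nf_n(T)x$, where for the bounded function $f_n$ one takes $f_n(T)=\int\hat E(dz).f_n(z)$. Further, $\tilde f(z)=(f(z))^{\sim}$.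
   Formalization: Over the octonions the adjoint identity and multiplicativity of the spectral measure are required only on X_0 (otherwise (d) fails, or the measure vanishes); E(δ).S is taken as E(δ) after left multiplication by S, and E(K)=I is required, since otherwise uniqueness and (e) fail. *)

theory Defs
  imports "HOL-Analysis.Analysis"
begin

section \<open>Quaternions and octonions\<close>

text \<open>The multiplication table of the Cayley--Dickson generators: for \<open>(p, q, r)\<close> in this set,
  \<open>i\<^sub>p i\<^sub>q = i\<^sub>r\<close> and cyclically, \<open>i\<^sub>q i\<^sub>p = - i\<^sub>r\<close>
  and cyclically. Only the first triple concerns the quaternions.\<close>

definition cd_triples :: "(nat \<times> nat \<times> nat) set" where
  "cd_triples = {(1,2,3), (1,4,5), (2,4,6), (3,4,7), (1,7,6), (2,5,7), (3,6,5)}"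

text \<open>The axioms determine the algebra: it is a copy of the quaternions if the dimension is 4 and a
  copy of the octonions if it is 8. The concrete algebras are the instances \<open>quat\<close> and \<open>oct\<close>
  below. The generators \<open>i\<^sub>0, \<dots>, i\<^sub>m\<close> are \<open>hgen 0, \<dots>, hgen m\<close> with
  \<open>m + 1 = DIM('a)\<close>. As they form the orthonormal basis \<open>Basis\<close>, the \<open>v\<close>-th
  coordinate of \<open>z\<close> is \<open>z \<bullet> hgen v\<close>. Multiplication is not assumed associative.\<close>

class hypercomplex = euclidean_space + times + one +
  fixes hconj :: "'a \<Rightarrow> 'a"
    and hgen :: "nat \<Rightarrow> 'a"
  assumes dim_hypercomplex: "card (Basis :: 'a set) = 4 \<or> card (Basis :: 'a set) = 8"
    and bij_hgen: "bij_betw hgen {..<card (Basis :: 'a set)} Basis"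
    and hgen_0: "hgen 0 = 1"
    and hmult_add_left: "(a + b) * c = a * c + b * c"
    and hmult_add_right: "a * (b + c) = a * b + a * c"
    and hmult_scaleR_left: "(t *\<^sub>R a) * b = t *\<^sub>R (a * b)"
    and hmult_scaleR_right: "a * (t *\<^sub>R b) = t *\<^sub>R (a * b)"
    and hmult_1_left: "1 * a = a"
    and hmult_1_right: "a * 1 = a"
    and hgen_square: "0 < p \<Longrightarrow> p < card (Basis :: 'a set) \<Longrightarrow> hgen p * hgen p = - 1"
    and hgen_table:
      "(p, q, r) \<in> cd_triples \<Longrightarrow> p < card (Basis :: 'a set) \<Longrightarrow> q < card (Basis :: 'a set) \<Longrightarrow>
        r < card (Basis :: 'a set) \<Longrightarrow>
        hgen p * hgen q = hgen r \<and> hgen q * hgen r = hgen p \<and> hgen r * hgen p = hgen q \<and>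
        hgen q * hgen p = - hgen r \<and> hgen r * hgen q = - hgen p \<and> hgen p * hgen r = - hgen q"
    and hconj_add: "hconj (a + b) = hconj a + hconj b"
    and hconj_scaleR: "hconj (t *\<^sub>R a) = t *\<^sub>R hconj a"
    and hconj_1: "hconj 1 = 1"
    and hconj_hgen: "0 < p \<Longrightarrow> p < card (Basis :: 'a set) \<Longrightarrow> hconj (hgen p) = - hgen p"
    and hmult_hconj: "a * hconj a = (norm a)\<^sup>2 *\<^sub>R 1"

definition hreal :: "real \<Rightarrow> 'k::hypercomplex" where
  "hreal r = r *\<^sub>R 1"

definition hinverse :: "'k::hypercomplex \<Rightarrow> 'k" where
  "hinverse z = hconj z /\<^sub>R (norm z)\<^sup>2"

lemma hmult_minus_left: "- a * b = - (a * b)" for a b :: "'k::hypercomplex"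
  using hmult_scaleR_left[of "-1" a b] by simp

lemma hmult_minus_right: "a * - b = - (a * b)" for a b :: "'k::hypercomplex"
  using hmult_scaleR_right[of a "-1" b] by simp

lemma hmult_zero: "0 * a = 0" "a * 0 = 0" for a :: "'k::hypercomplex"
  using hmult_scaleR_left[of 0 0 a] hmult_scaleR_right[of a 0 0] by simp_all

lemma hconj_minus: "hconj (- a) = - hconj a" for a :: "'k::hypercomplex"
  using hconj_scaleR[of "-1" a] by simp

lemma hconj_zero: "hconj 0 = (0 :: 'k::hypercomplex)"
  using hconj_scaleR[of 0 0] by simp

subsection \<open>The quaternions as doubled complex numbers\<close>

typedef quat = "UNIV :: (complex \<times> complex) set" morphisms quat_pair Quat ..

setup_lifting type_definition_quat

instantiation quat :: euclidean_space
begin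
lift_definition zero_quat :: quat is 0 .
lift_definition plus_quat :: "quat \<Rightarrow> quat \<Rightarrow> quat" is "(+)" .
lift_definition minus_quat :: "quat \<Rightarrow> quat \<Rightarrow> quat" is "(-)" .
lift_definition uminus_quat :: "quat \<Rightarrow> quat" is uminus .
lift_definition scaleR_quat :: "real \<Rightarrow> quat \<Rightarrow> quat" is scaleR .
lift_definition norm_quat :: "quat \<Rightarrow> real" is norm .
lift_definition inner_quat :: "quat \<Rightarrow> quat \<Rightarrow> real" is inner .
lift_definition dist_quat :: "quat \<Rightarrow> quat \<Rightarrow> real" is dist .
lift_definition sgn_quat :: "quat \<Rightarrow> quat" is sgn .
lift_definition Basis_quat :: "quat set" is Basis .
definition uniformity_quat :: "(quat \<times> quat) filter" where
  "uniformity_quat = (INF e\<in>{0<..}. principal {(x, y). dist x y < e})"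
definition open_quat :: "quat set \<Rightarrow> bool" where
  "open_quat U \<longleftrightarrow> (\<forall>x\<in>U. \<forall>\<^sub>F (x', y) in uniformity. x' = x \<longrightarrow> y \<in> U)"
instance
  by (intro_classes;
      (rule uniformity_quat_def open_quat_def
        | (transfer,
            (rule dist_norm sgn_div_norm norm_eq_sqrt_inner inner_commute norm_triangle_ineq
                inner_add_left finite_Basis nonempty_Basis inner_Basis euclidean_all_zero_iff
              | (simp add: algebra_simps inner_Basis; fail)))))
end

instantiation quat :: hypercomplex
begin
lift_definition one_quat :: quat is "(1, 0)" .
lift_definition times_quat :: "quat \<Rightarrow> quat \<Rightarrow> quat" is
  "\<lambda>(a, b) (c, d). (a * c - cnj d * b, d * a + b * cnj c)" .
lift_definition hconj_quat :: "quat \<Rightarrow> quat" is "\<lambda>(a, b). (cnj a, - b)" .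
lift_definition hgen_quat :: "nat \<Rightarrow> quat" is
  "\<lambda>p. if p = 0 then (1, 0) else if p = 1 then (\<i>, 0) else if p = 2 then (0, 1) else (0, \<i>)" .
instance
proof
  have eq: "(Basis :: quat set) = hgen ` {0, 1, 2, 3}"
    by transfer (auto simp: Basis_prod_def Basis_complex_def)
  have inj: "inj_on (hgen :: nat \<Rightarrow> quat) {0, 1, 2, 3}"
    unfolding inj_on_def by transfer (auto simp: complex_eq_iff)
  have dim: "card (Basis :: quat set) = 4"
    unfolding eq card_image[OF inj] by simp
  have lt: "{..<4} = {0, 1, 2, 3 :: nat}"
    by auto
  show "card (Basis :: quat set) = 4 \<or> card (Basis :: quat set) = 8"
    using dim by simp
  show "bij_betw hgen {..<card (Basis :: quat set)} (Basis :: quat set)"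
    unfolding dim lt using inj eq by (auto simp: bij_betw_def)
  show "hgen 0 = (1 :: quat)"
    by transfer simp
  fix a b c :: quat and r :: real
  show "(a + b) * c = a * c + b * c" "a * (b + c) = a * b + a * c"
    by (transfer; auto simp: algebra_simps)+
  show "(r *\<^sub>R a) * b = r *\<^sub>R (a * b)" "a * (r *\<^sub>R b) = r *\<^sub>R (a * b)"
    by (transfer; auto simp: scaleR_conv_of_real algebra_simps)+
  show "1 * a = a" "a * 1 = a"
    by (transfer; auto)+
  show "hconj (a + b) = hconj a + hconj b" "hconj (r *\<^sub>R a) = r *\<^sub>R hconj a"
    "hconj 1 = (1 :: quat)"
    by (transfer; auto simp: scaleR_conv_of_real)+
  show "a * hconj a = (norm a)\<^sup>2 *\<^sub>R 1"
    by transfer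
      (auto simp: norm_Pair scaleR_conv_of_real complex_norm_square mult.commute simp flip: of_real_power)
  show "hgen p * hgen p = (- 1 :: quat)" "hconj (hgen p) = (- hgen p :: quat)"
    if "0 < p" "p < card (Basis :: quat set)" for p
  proof -
    have "p = 1 \<or> p = 2 \<or> p = 3"
      using that unfolding dim by auto
    then show "hgen p * hgen p = (- 1 :: quat)" "hconj (hgen p) = (- hgen p :: quat)"
      by (elim disjE; simp; transfer; simp)+
  qed
  show "hgen p * hgen q = (hgen r :: quat) \<and> hgen q * hgen r = (hgen p :: quat) \<and>
      hgen r * hgen p = (hgen q :: quat) \<and> hgen q * hgen p = (- hgen r :: quat) \<and>
      hgen r * hgen q = (- hgen p :: quat) \<and> hgen p * hgen r = (- hgen q :: quat)"
    if "(p, q, r) \<in> cd_triples" "p < card (Basis :: quat set)" "q < card (Basis :: quat set)"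
      "r < card (Basis :: quat set)" for p q r
  proof -
    have "p = 1" "q = 2" "r = 3"
      using that unfolding dim by (auto simp: cd_triples_def)
    then show ?thesis
      by simp (transfer; simp)
  qed
qed
end

lemma DIM_quat: "DIM(quat) = 4"
proof -
  have eq: "(Basis :: quat set) = hgen ` {0, 1, 2, 3}"
    by transfer (auto simp: Basis_prod_def Basis_complex_def)
  have inj: "inj_on (hgen :: nat \<Rightarrow> quat) {0, 1, 2, 3}"
    unfolding inj_on_def by transfer (auto simp: complex_eq_iff)
  show ?thesis
    unfolding eq card_image[OF inj] by simp
qed

lemma hgen_mult_quat:
  "hgen 1 * hgen 1 = (- 1 :: quat)" "hgen 2 * hgen 2 = (- 1 :: quat)" "hgen 3 * hgen 3 = (- 1 :: quat)"
  "hgen 1 * hgen 2 = (hgen 3 :: quat)" "hgen 2 * hgen 3 = (hgen 1 :: quat)"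
  "hgen 3 * hgen 1 = (hgen 2 :: quat)" "hgen 2 * hgen 1 = (- hgen 3 :: quat)"
  "hgen 3 * hgen 2 = (- hgen 1 :: quat)" "hgen 1 * hgen 3 = (- hgen 2 :: quat)"
  "hconj (hgen 1) = (- hgen 1 :: quat)" "hconj (hgen 2) = (- hgen 2 :: quat)"
  "hconj (hgen 3) = (- hgen 3 :: quat)"
  by (transfer; simp)+

lemma hconj_quat: "hconj (hconj a) = a" "hconj a * a = (norm a)\<^sup>2 *\<^sub>R 1" for a :: quat
  by (transfer; auto simp: norm_Pair scaleR_conv_of_real complex_norm_square mult.commute
      simp flip: of_real_power)+

subsection \<open>The octonions as doubled quaternions\<close>

typedef oct = "UNIV :: (quat \<times> quat) set" morphisms oct_pair Oct ..

setup_lifting type_definition_oct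

instantiation oct :: euclidean_space
begin
lift_definition zero_oct :: oct is 0 .
lift_definition plus_oct :: "oct \<Rightarrow> oct \<Rightarrow> oct" is "(+)" .
lift_definition minus_oct :: "oct \<Rightarrow> oct \<Rightarrow> oct" is "(-)" .
lift_definition uminus_oct :: "oct \<Rightarrow> oct" is uminus .
lift_definition scaleR_oct :: "real \<Rightarrow> oct \<Rightarrow> oct" is scaleR .
lift_definition norm_oct :: "oct \<Rightarrow> real" is norm .
lift_definition inner_oct :: "oct \<Rightarrow> oct \<Rightarrow> real" is inner .
lift_definition dist_oct :: "oct \<Rightarrow> oct \<Rightarrow> real" is dist .
lift_definition sgn_oct :: "oct \<Rightarrow> oct" is sgn .
lift_definition Basis_oct :: "oct set" is Basis .
definition uniformity_oct :: "(oct \<times> oct) filter" where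
  "uniformity_oct = (INF e\<in>{0<..}. principal {(x, y). dist x y < e})"
definition open_oct :: "oct set \<Rightarrow> bool" where
  "open_oct U \<longleftrightarrow> (\<forall>x\<in>U. \<forall>\<^sub>F (x', y) in uniformity. x' = x \<longrightarrow> y \<in> U)"
instance
  by (intro_classes;
      (rule uniformity_oct_def open_oct_def
        | (transfer,
            (rule dist_norm sgn_div_norm norm_eq_sqrt_inner inner_commute norm_triangle_ineq
                inner_add_left finite_Basis nonempty_Basis inner_Basis euclidean_all_zero_iff
              | (simp add: algebra_simps inner_Basis; fail)))))
end

instantiation oct :: hypercomplex
begin
lift_definition one_oct :: oct is "(1, 0)" .
lift_definition times_oct :: "oct \<Rightarrow> oct \<Rightarrow> oct" is
  "\<lambda>(a, b) (c, d). (a * c - hconj d * b, d * a + b * hconj c)" .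
lift_definition hconj_oct :: "oct \<Rightarrow> oct" is "\<lambda>(a, b). (hconj a, - b)" .
lift_definition hgen_oct :: "nat \<Rightarrow> oct" is
  "\<lambda>p. if p < 4 then (hgen p, 0) else (0, hgen (p - 4))" .
instance
proof
  note hsimps = hmult_minus_left hmult_minus_right hmult_zero hmult_1_left hmult_1_right hconj_minus
    hconj_zero hconj_1 hgen_0 hmult_add_left hmult_add_right hmult_scaleR_left hmult_scaleR_right
    hconj_add hconj_scaleR
  have bij: "bij_betw hgen {..<4} (Basis :: quat set)"
    using bij_hgen[where 'a = quat] by (simp add: DIM_quat)
  have img: "(\<lambda>p. hgen (p - 4) :: quat) ` {4..<8} = Basis"
  proof -
    have "(\<lambda>p. p - 4) ` {4..<8} = {..<4::nat}"
      by (auto simp: image_iff intro!: bexI[of _ "_ + 4"])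
    then have "hgen ` (\<lambda>p. p - 4) ` {4..<8::nat} = (Basis :: quat set)"
      using bij by (simp add: bij_betw_def)
    then show ?thesis
      by (simp add: image_image)
  qed
  have split: "{..<8} = {..<4} \<union> {4..<8::nat}"
    by auto
  have eq: "(Basis :: oct set) = hgen ` {..<8}"
  proof transfer
    have "(\<lambda>p. if p < 4 then (hgen p :: quat, 0 :: quat) else (0, hgen (p - 4))) ` {..<8} =
        (\<lambda>u. (u, 0)) ` hgen ` {..<4} \<union> (\<lambda>u. (0, u)) ` (\<lambda>p. hgen (p - 4)) ` {4..<8}"
      unfolding split image_Un image_image by (intro arg_cong2[of _ _ _ _ "(\<union>)"] image_cong) auto
    also have "\<dots> = Basis"
      unfolding img using bij by (simp add: bij_betw_def Basis_prod_def)
    finally show "Basis = (\<lambda>p. if p < 4 then (hgen p :: quat, 0 :: quat) else (0, hgen (p - 4))) ` {..<8}"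
      by simp
  qed
  have dim: "card (Basis :: oct set) = 8"
  proof -
    have "(Basis :: oct set) = Oct ` Basis"
      by (simp add: Basis_oct_def)
    moreover have "inj_on Oct Basis"
      by (simp add: inj_on_def Oct_inject)
    ultimately have "card (Basis :: oct set) = DIM(quat \<times> quat)"
      by (metis card_image)
    then show ?thesis
      by (simp add: DIM_quat)
  qed
  show "card (Basis :: oct set) = 4 \<or> card (Basis :: oct set) = 8"
    using dim by simp
  show "bij_betw hgen {..<card (Basis :: oct set)} (Basis :: oct set)"
    unfolding dim bij_betw_def using eq dim by (auto intro!: eq_card_imp_inj_on)
  show "hgen 0 = (1 :: oct)"
    by transfer (simp add: hgen_0)
  fix a b c :: oct and r :: real
  show "(a + b) * c = a * c + b * c" "a * (b + c) = a * b + a * c"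
    by (transfer; auto simp: hsimps)+
  show "(r *\<^sub>R a) * b = r *\<^sub>R (a * b)" "a * (r *\<^sub>R b) = r *\<^sub>R (a * b)"
    by (transfer; auto simp: hsimps algebra_simps)+
  show "1 * a = a" "a * 1 = a"
    by (transfer; auto simp: hsimps)+
  show "hconj (a + b) = hconj a + hconj b" "hconj (r *\<^sub>R a) = r *\<^sub>R hconj a"
    "hconj 1 = (1 :: oct)"
    by (transfer; auto simp: hsimps)+
  show "a * hconj a = (norm a)\<^sup>2 *\<^sub>R 1"
    by transfer (auto simp: norm_Pair hsimps hconj_quat hmult_hconj algebra_simps)
  note gens = hgen_mult_quat hgen_mult_quat[unfolded One_nat_def]
  show "hgen p * hgen p = (- 1 :: oct)" "hconj (hgen p) = (- hgen p :: oct)"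
    if "0 < p" "p < card (Basis :: oct set)" for p
  proof -
    have "p = 1 \<or> p = 2 \<or> p = 3 \<or> p = 4 \<or> p = 5 \<or> p = 6 \<or> p = 7"
      using that unfolding dim by auto
    then show "hgen p * hgen p = (- 1 :: oct)" "hconj (hgen p) = (- hgen p :: oct)"
      by (elim disjE; simp only:; transfer; simp add: hsimps gens)+
  qed
  show "hgen p * hgen q = (hgen r :: oct) \<and> hgen q * hgen r = (hgen p :: oct) \<and>
      hgen r * hgen p = (hgen q :: oct) \<and> hgen q * hgen p = (- hgen r :: oct) \<and>
      hgen r * hgen q = (- hgen p :: oct) \<and> hgen p * hgen r = (- hgen q :: oct)"
    if "(p, q, r) \<in> cd_triples" for p q r
    using that unfolding cd_triples_def insert_iff empty_iff prod.inject
    by (elim disjE conjE; simp only:; transfer; simp add: hsimps gens)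
qed
end

section \<open>Hilbert spaces over the quaternions and octonions\<close>

text \<open>\<open>part V p\<close> is the real space \<open>X\<^sub>p\<close> of the decomposition
  \<open>X = X\<^sub>0 \<oplus> X\<^sub>1 i\<^sub>1 \<oplus> \<dots> \<oplus> X\<^sub>m i\<^sub>m\<close>.\<close>

record ('k, 'x) kspace =
  lmul :: "'k \<Rightarrow> 'x \<Rightarrow> 'x"
  rmul :: "'x \<Rightarrow> 'k \<Rightarrow> 'x"
  ip :: "'x \<Rightarrow> 'x \<Rightarrow> 'k"
  part :: "nat \<Rightarrow> 'x set"

locale K_vector_space =
  fixes V :: "('k::hypercomplex, 'x::real_vector) kspace"
  assumes lmul_add: "lmul V a (x + y) = lmul V a x + lmul V a y"
    and add_lmul: "lmul V (a + b) x = lmul V a x + lmul V b x"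
    and rmul_add: "rmul V (x + y) a = rmul V x a + rmul V y a"
    and add_rmul: "rmul V x (a + b) = rmul V x a + rmul V x b"
    and lmul_hreal: "lmul V (hreal r) x = r *\<^sub>R x"
    and rmul_hreal: "rmul V x (hreal r) = r *\<^sub>R x"
    and lmul_H: "DIM('k) = 4 \<Longrightarrow> lmul V a (lmul V b x) = lmul V (a * b) x"
    and rmul_H: "DIM('k) = 4 \<Longrightarrow> rmul V (rmul V x b) a = rmul V x (b * a)"
    and lmul_O: "DIM('k) = 8 \<Longrightarrow> lmul V b (lmul V b x) = lmul V (b * b) x"
    and rmul_O: "DIM('k) = 8 \<Longrightarrow> rmul V (rmul V x b) b = rmul V x (b * b)"
    and subspace_part: "p < DIM('k) \<Longrightarrow> subspace (part V p)"
    and part_commute: "p < DIM('k) \<Longrightarrow> x \<in> part V p \<Longrightarrow> lmul V a x = rmul V x a"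
    and part_isomorphic: "p < DIM('k) \<Longrightarrow> q < DIM('k) \<Longrightarrow>
      \<exists>\<phi>. linear \<phi> \<and> bij_betw \<phi> (part V p) (part V q)"
    and decomposition: "\<exists>!u. (\<forall>p<DIM('k). u p \<in> part V p) \<and> (\<forall>p\<ge>DIM('k). u p = 0) \<and>
      x = (\<Sum>p<DIM('k). rmul V (u p) (hgen p))"

text \<open>The real inner product of the type \<open>'x\<close> is the real part of \<open>ip V\<close>, by polarization of
  \<open>ip_self\<close>. Hence \<open>norm\<close> is the norm of the Hilbert space over \<open>'k\<close>, and
  completeness is the class \<^class>\<open>complete_space\<close>.\<close>

locale K_hilbert_space = K_vector_space V
  for V :: "('k::hypercomplex, 'x::{real_inner, complete_space}) kspace" +
  assumes ip_add_left: "ip V (x + y) z = ip V x z + ip V y z"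
    and ip_add_right: "ip V x (y + z) = ip V x y + ip V x z"
    and ip_scaleR_left: "ip V (r *\<^sub>R x) y = r *\<^sub>R ip V x y"
    and ip_scaleR_right: "ip V x (r *\<^sub>R y) = r *\<^sub>R ip V x y"
    and ip_self: "ip V x x = hreal ((norm x)\<^sup>2)"
    and ip_hconj: "ip V x y = hconj (ip V y x)"
    and ip_H: "DIM('k) = 4 \<Longrightarrow> ip V (rmul V x a) (rmul V y b) = (hconj a * ip V x y) * b"
    and ip_O: "DIM('k) = 8 \<Longrightarrow> ip V (rmul V x a) x = hconj a * ip V x x"
    and ip_part_real: "p < DIM('k) \<Longrightarrow> q < DIM('k) \<Longrightarrow> x \<in> part V p \<Longrightarrow> y \<in> part V q \<Longrightarrow>
      ip V x y \<in> range hreal"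
    and ip_part: "p < DIM('k) \<Longrightarrow> q < DIM('k) \<Longrightarrow> x \<in> part V p \<Longrightarrow> y \<in> part V q \<Longrightarrow>
      ip V (rmul V x (hgen p)) (rmul V y (hgen q)) = ip V x y * (hconj (hgen p) * hgen q)"

text \<open>Identities that rest on associativity of the scalars are read on the following set: over the
  quaternions it is all of \<open>X\<close>, over the octonions it is \<open>X\<^sub>0\<close>. If \<open>X\<close> is the space
  of octonions and \<open>T\<close> is left multiplication by \<open>i\<^sub>1\<close>, then for \<open>y = i\<^sub>4\<close> no
  \<open>w\<close> satisfies \<open>\<langle>T x; y\<rangle> = \<langle>x; w\<rangle>\<close> for all \<open>x\<close>. Likewise, a spectral measure over the
  octonions that is multiplicative in pure scalars on all of \<open>X\<close> vanishes.\<close>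

definition assoc_part :: "('k::hypercomplex, 'x) kspace \<Rightarrow> 'x set" where
  "assoc_part V = (if DIM('k) = 4 then UNIV else part V 0)"

section \<open>Quasilinear operators\<close>

text \<open>Unbounded operators are partial functions \<open>'x \<rightharpoonup> 'x\<close>.\<close>

definition K_subspace :: "('k::hypercomplex, 'x::real_vector) kspace \<Rightarrow> 'x set \<Rightarrow> bool" where
  "K_subspace V D \<longleftrightarrow> 0 \<in> D \<and> (\<forall>x\<in>D. \<forall>y\<in>D. x + y \<in> D) \<and>
    (\<forall>a. \<forall>x\<in>D. lmul V a x \<in> D \<and> rmul V x a \<in> D)"

definition quasilinear_operator ::
    "('k::hypercomplex, 'x::real_normed_vector) kspace \<Rightarrow> ('x \<rightharpoonup> 'x) \<Rightarrow> bool" where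
  "quasilinear_operator V T \<longleftrightarrow> K_subspace V (dom T) \<and>
    (\<forall>x\<in>dom T. \<forall>y\<in>dom T. the (T (x + y)) = the (T x) + the (T y)) \<and>
    (\<forall>r. \<forall>x\<in>dom T. the (T (r *\<^sub>R x)) = r *\<^sub>R the (T x))"

definition densely_defined :: "('x::topological_space \<rightharpoonup> 'x) \<Rightarrow> bool" where
  "densely_defined T \<longleftrightarrow> closure (dom T) = UNIV"

definition closed_operator :: "('x::topological_space \<rightharpoonup> 'x) \<Rightarrow> bool" where
  "closed_operator T \<longleftrightarrow> closed {(x, y). T x = Some y}"

definition adjoint_value ::
    "('k::hypercomplex, 'x) kspace \<Rightarrow> ('x \<rightharpoonup> 'x) \<Rightarrow> 'x \<Rightarrow> 'x \<Rightarrow> bool" where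
  "adjoint_value V T y w \<longleftrightarrow> (\<forall>x \<in> dom T \<inter> assoc_part V. ip V (the (T x)) y = ip V x w)"

definition adjoint_op ::
    "('k::hypercomplex, 'x::real_normed_vector) kspace \<Rightarrow> ('x \<rightharpoonup> 'x) \<Rightarrow> ('x \<rightharpoonup> 'x)" where
  "adjoint_op V T = (\<lambda>y.
    if continuous_on (dom T) (\<lambda>x. ip V (the (T x)) y) \<and> (\<exists>w. adjoint_value V T y w)
    then Some (THE w. adjoint_value V T y w) else None)"

definition selfadjoint ::
    "('k::hypercomplex, 'x::real_normed_vector) kspace \<Rightarrow> ('x \<rightharpoonup> 'x) \<Rightarrow> bool" where
  "selfadjoint V T \<longleftrightarrow> adjoint_op V T = T"

definition is_resolvent ::
    "('k::hypercomplex, 'x::real_normed_vector) kspace \<Rightarrow> ('x \<rightharpoonup> 'x) \<Rightarrow> 'k \<Rightarrow> ('x \<Rightarrow> 'x) \<Rightarrow> bool" where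
  "is_resolvent V T z R \<longleftrightarrow> bounded_linear R \<and>
    (\<forall>x. R x \<in> dom T \<and> lmul V z (R x) - the (T (R x)) = x) \<and>
    (\<forall>x\<in>dom T. R (lmul V z x - the (T x)) = x)"

definition resolvent_set ::
    "('k::hypercomplex, 'x::real_normed_vector) kspace \<Rightarrow> ('x \<rightharpoonup> 'x) \<Rightarrow> 'k set" where
  "resolvent_set V T = {z. \<exists>R. is_resolvent V T z R}"

definition resolvent ::
    "('k::hypercomplex, 'x::real_normed_vector) kspace \<Rightarrow> 'k \<Rightarrow> ('x \<rightharpoonup> 'x) \<Rightarrow> 'x \<Rightarrow> 'x" where
  "resolvent V z T = (THE R. is_resolvent V T z R)"

definition spectrum ::
    "('k::hypercomplex, 'x::real_normed_vector) kspace \<Rightarrow> ('x \<rightharpoonup> 'x) \<Rightarrow> 'k set" where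
  "spectrum V T = - resolvent_set V T"

section \<open>Real-valued and noncommutative measures\<close>

definition regular_real_measure :: "('a::topological_space set \<Rightarrow> real) \<Rightarrow> bool" where
  "regular_real_measure \<mu> \<longleftrightarrow>
    (\<forall>A :: nat \<Rightarrow> 'a set. range A \<subseteq> sets borel \<longrightarrow> disjoint_family A \<longrightarrow>
      (\<lambda>n. \<mu> (A n)) sums \<mu> (\<Union>n. A n)) \<and>
    (\<forall>\<delta>\<in>sets borel. \<forall>\<epsilon>>0. \<exists>F G. closed F \<and> open G \<and> F \<subseteq> \<delta> \<and> \<delta> \<subseteq> G \<and>
      (\<forall>C\<in>sets borel. C \<subseteq> G - F \<longrightarrow> \<bar>\<mu> C\<bar> < \<epsilon>))"

text \<open>Integration against a real-valued measure by means of its Jordan decomposition into upper and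
  lower variation.\<close>

definition upper_variation :: "('a::topological_space set \<Rightarrow> real) \<Rightarrow> 'a measure" where
  "upper_variation \<mu> = measure_of UNIV (sets borel)
    (\<lambda>A. SUP B \<in> {B \<in> sets borel. B \<subseteq> A}. ennreal (\<mu> B))"

definition lower_variation :: "('a::topological_space set \<Rightarrow> real) \<Rightarrow> 'a measure" where
  "lower_variation \<mu> = upper_variation (\<lambda>A. - \<mu> A)"

definition real_integrable :: "('a::topological_space set \<Rightarrow> real) \<Rightarrow> ('a \<Rightarrow> real) \<Rightarrow> bool" where
  "real_integrable \<mu> g \<longleftrightarrow> integrable (upper_variation \<mu>) g \<and> integrable (lower_variation \<mu>) g"

definition real_integral :: "('a::topological_space set \<Rightarrow> real) \<Rightarrow> ('a \<Rightarrow> real) \<Rightarrow> real" where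
  "real_integral \<mu> g =
    integral\<^sup>L (upper_variation \<mu>) g - integral\<^sup>L (lower_variation \<mu>) g"

text \<open>A noncommutative measure is given by its components; \<open>\<mu> v l\<close> has the index
  \<open>(i\<^sub>v, i\<^sub>l)\<close>.\<close>

definition regular_nc_measure :: "(nat \<Rightarrow> nat \<Rightarrow> 'k::hypercomplex set \<Rightarrow> real) \<Rightarrow> bool" where
  "regular_nc_measure \<mu> \<longleftrightarrow> (\<forall>v<DIM('k). \<forall>l<DIM('k). regular_real_measure (\<mu> v l))"

definition nc_integrable ::
    "(nat \<Rightarrow> nat \<Rightarrow> 'k::hypercomplex set \<Rightarrow> real) \<Rightarrow> ('k \<Rightarrow> 'k) \<Rightarrow> bool" where
  "nc_integrable \<mu> f \<longleftrightarrow>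
    (\<forall>v<DIM('k). \<forall>l<DIM('k). real_integrable (\<mu> v l) (\<lambda>z. f z \<bullet> hgen v))"

definition nc_integral ::
    "(nat \<Rightarrow> nat \<Rightarrow> 'k::hypercomplex set \<Rightarrow> real) \<Rightarrow> ('k \<Rightarrow> 'k) \<Rightarrow> 'k" where
  "nc_integral \<mu> f =
    (\<Sum>v<DIM('k). \<Sum>l<DIM('k). real_integral (\<mu> v l) (\<lambda>z. f z \<bullet> hgen v) *\<^sub>R hgen l)"

section \<open>Spectral measures\<close>

text \<open>A spectral measure is a family \<open>E\<close> of operators indexed by a Borel set and a scalar:
  \<open>E \<delta> S\<close> stands for \<open>E(\<delta>).S\<close> and \<open>E \<delta> 1\<close> for \<open>E(\<delta>)\<close>. The components of the
  measure \<open>\<mu>(\<cdot>; x, y)\<close> are necessarily those of \<open>\<langle>(E(\<delta>).i\<^sub>v) x; y\<rangle>\<close>.\<close>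

definition spectral_nc_measure ::
    "('k::hypercomplex, 'x) kspace \<Rightarrow> ('k set \<Rightarrow> 'k \<Rightarrow> 'x \<Rightarrow> 'x) \<Rightarrow> 'x \<Rightarrow> 'x \<Rightarrow>
      nat \<Rightarrow> nat \<Rightarrow> 'k set \<Rightarrow> real" where
  "spectral_nc_measure V E x y = (\<lambda>v l \<delta>. ip V (E \<delta> (hgen v) x) y \<bullet> hgen l)"

definition pure_vector :: "'k::hypercomplex \<Rightarrow> bool" where
  "pure_vector S \<longleftrightarrow> (\<exists>c. \<exists>q<DIM('k). S = c *\<^sub>R hgen q)"

definition kappa :: "nat \<Rightarrow> nat" where
  "kappa q = (if q = 0 then 0 else 1)"

text \<open>\<open>E(\<delta>).S\<close> is the product of \<open>E(\<delta>)\<close> with multiplication by \<open>S\<close>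
  (\<open>scalar_action\<close>). The remaining conditions only say that \<open>S \<mapsto> E(\<delta>).S\<close> is some
  representation of the scalars; by themselves they do not determine the spectral measure of an
  operator uniquely.\<close>

locale spectral_measure =
  fixes V :: "('k::hypercomplex, 'x::real_normed_vector) kspace"
    and E :: "'k set \<Rightarrow> 'k \<Rightarrow> 'x \<Rightarrow> 'x"
  assumes bounded: "\<delta> \<in> sets borel \<Longrightarrow> bounded_linear (E \<delta> S)"
    and scalar_action: "\<delta> \<in> sets borel \<Longrightarrow> E \<delta> S x = E \<delta> 1 (lmul V S x)"
    and regular: "regular_nc_measure (spectral_nc_measure V E x y)"
    and ip_measure: "\<delta> \<in> sets borel \<Longrightarrow>
      ip V (E \<delta> S x) y = nc_integral (spectral_nc_measure V E x y) (\<lambda>z. indicator \<delta> z *\<^sub>R S)"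
    and adjoint_pure: "\<delta> \<in> sets borel \<Longrightarrow> q < DIM('k) \<Longrightarrow> S = c *\<^sub>R hgen q \<Longrightarrow> y \<in> part V 0 \<Longrightarrow>
      adjoint_op V (\<lambda>x. Some (E \<delta> S x)) y = Some ((- 1) ^ kappa q *\<^sub>R E \<delta> S y)"
    and scale_pure: "\<delta> \<in> sets borel \<Longrightarrow> pure_vector S \<Longrightarrow> E \<delta> (b *\<^sub>R S) x = b *\<^sub>R E \<delta> S x"
    and mult_pure: "\<delta> \<in> sets borel \<Longrightarrow> \<gamma> \<in> sets borel \<Longrightarrow> pure_vector S\<^sub>1 \<Longrightarrow> pure_vector S\<^sub>2 \<Longrightarrow>
      x \<in> assoc_part V \<Longrightarrow> E (\<delta> \<inter> \<gamma>) (S\<^sub>1 * S\<^sub>2) x = E \<delta> S\<^sub>1 (E \<gamma> S\<^sub>2 x)"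

text \<open>The integral of \<open>f\<close> over \<open>A\<close> against \<open>E\<close>, evaluated at \<open>x\<close>.\<close>

definition has_spectral_integral ::
    "('k::hypercomplex, 'x) kspace \<Rightarrow> ('k set \<Rightarrow> 'k \<Rightarrow> 'x \<Rightarrow> 'x) \<Rightarrow>
      'k set \<Rightarrow> ('k \<Rightarrow> 'k) \<Rightarrow> 'x \<Rightarrow> 'x \<Rightarrow> bool" where
  "has_spectral_integral V E A f x w \<longleftrightarrow>
    (\<forall>y. nc_integrable (spectral_nc_measure V E x y) (\<lambda>z. indicator A z *\<^sub>R f z) \<and>
      ip V w y = nc_integral (spectral_nc_measure V E x y) (\<lambda>z. indicator A z *\<^sub>R f z))"

definition spectral_integral ::
    "('k::hypercomplex, 'x) kspace \<Rightarrow> ('k set \<Rightarrow> 'k \<Rightarrow> 'x \<Rightarrow> 'x) \<Rightarrow>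
      'k set \<Rightarrow> ('k \<Rightarrow> 'k) \<Rightarrow> 'x \<Rightarrow> 'x" where
  "spectral_integral V E A f x = (THE w. has_spectral_integral V E A f x w)"

text \<open>The nonnegative measure \<open>\<langle>E(dz) x; x\<rangle>\<close>.\<close>

definition quadratic_measure ::
    "('k::hypercomplex, 'x) kspace \<Rightarrow> ('k set \<Rightarrow> 'k \<Rightarrow> 'x \<Rightarrow> 'x) \<Rightarrow> 'x \<Rightarrow> 'k measure" where
  "quadratic_measure V E x =
    measure_of UNIV (sets borel) (\<lambda>\<delta>. ennreal (ip V (E \<delta> 1 x) x \<bullet> 1))"

locale decomposition_of_unity = spectral_measure V E
  for V :: "('k::hypercomplex, 'x::real_normed_vector) kspace"
    and T :: "'x \<rightharpoonup> 'x"
    and E :: "'k set \<Rightarrow> 'k \<Rightarrow> 'x \<Rightarrow> 'x" +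
  assumes unity: "E UNIV 1 x = x"
    and selfadjoint_E: "\<delta> \<in> sets borel \<Longrightarrow> selfadjoint V (\<lambda>x. Some (E \<delta> 1 x))"
    and countably_additive: "range A \<subseteq> sets borel \<Longrightarrow> disjoint_family A \<Longrightarrow>
      (\<lambda>n::nat. E (A n) 1 x) sums E (\<Union>n. A n) 1 x"
    and resolvent_null: "\<delta> \<in> sets borel \<Longrightarrow> \<delta> \<subseteq> resolvent_set V T \<Longrightarrow> E \<delta> 1 x = 0"
    and domain_T: "dom T = {x. nc_integrable (spectral_nc_measure V E x x)
      (\<lambda>z. indicator (spectrum V T) z *\<^sub>R (z * z))}"
    and limit_T: "x \<in> dom T \<Longrightarrow>
      (\<lambda>n. spectral_integral V E (hreal ` {- real n..real n}) (\<lambda>z. z) x) \<longlonglongrightarrow> the (T x)"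

text \<open>The operator \<open>f(T)\<close> for a function \<open>f\<close> with domain of definition \<open>D\<close>; the values of
  \<open>f\<close> outside \<open>D\<close> are not used.\<close>

definition truncation :: "'k set \<Rightarrow> ('k \<Rightarrow> 'k::hypercomplex) \<Rightarrow> nat \<Rightarrow> 'k \<Rightarrow> 'k" where
  "truncation D f n z = (if z \<in> D \<and> norm (f z) \<le> real n then f z else 0)"

definition functional_calculus ::
    "('k::hypercomplex, 'x::real_normed_vector) kspace \<Rightarrow> ('k set \<Rightarrow> 'k \<Rightarrow> 'x \<Rightarrow> 'x) \<Rightarrow>
      'k set \<Rightarrow> ('k \<Rightarrow> 'k) \<Rightarrow> ('x \<rightharpoonup> 'x)" where
  "functional_calculus V E D f = (\<lambda>x.
    if convergent (\<lambda>n. spectral_integral V E UNIV (truncation D f n) x)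
    then Some (lim (\<lambda>n. spectral_integral V E UNIV (truncation D f n) x)) else None)"

end

theory Submission
  imports Defs
begin

text \<open>Write \<open>P(\<delta>) = E(\<delta>).1\<close>. The operators \<open>P(\<delta>)\<close> form a projection-valued measure on the
  real Hilbert space underlying \<open>X\<close>, and they commute with all multiplications by scalars. As
  \<open>E(\<delta>).S\<close> is \<open>P(\<delta>)\<close> after left multiplication by \<open>S\<close>, the integral of \<open>f = \<Sum> f\<^sub>v i\<^sub>v\<close> is
  \<open>\<Sum> (\<integral> f\<^sub>v dP) i\<^sub>v\<close>, so that everything rests on the real spectral calculus and on one algebraic
  fact: the left multiplications by the generators are anticommuting skew isometries. It removes the mixed
  terms from \<open>|f(T) x|\<^sup>2\<close> and leaves \<open>\<integral> |f|\<^sup>2 d\<langle>P x; x\<rangle>\<close> (\<open>norm_kint\<close>). With this isometry the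
  domain and the norm of \<open>f(T)\<close> for unbounded \<open>f\<close> are matters of monotone convergence
  (\<open>dom_calculus\<close>, \<open>norm_calculus\<close>).

  Non-associativity is confined to the structure of the space. All \<open>X\<^sub>p\<close> coincide with \<open>X\<^sub>0\<close>, and
  \<open>X\<close> is \<open>X\<^sub>0\<close> with scalars extended (\<open>part_subset_part_0\<close>, \<open>rmul_rmul_part_0\<close>,
  \<open>lmul_rmul_part_0\<close>); \<open>P(\<delta>)\<close> maps \<open>X\<^sub>0\<close> into itself because the scalar \<open>\<langle>P(\<delta>) u; v\<rangle>\<close>
  is central for \<open>u, v\<close> in \<open>X\<^sub>0\<close> (\<open>E_part_0\<close>). The scalar-valued inner product is recovered from the
  real one by testing against right multiples (\<open>ip_inner\<close>), which turns statements on adjoints into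
  statements in the real Hilbert space (\<open>adjoint_value_calculus_iff\<close>).

  The integrability asserted in (b) concerns the total variation of \<open>\<langle>P(\<delta>) a; b\<rangle>\<close>. It is reduced to a
  bound for the bounded calculus by means of a Hahn set (\<open>integrable_upper_variation\<close>).

  Finally, \<open>T\<close> is the integral of the function that is the identity on the real line and \<open>0\<close> off it,
  since it is contained in that integral and both are selfadjoint (\<open>T_eq_calculus\<close>). For real
  \<open>\<lambda>\<close> the inverse of \<open>q - \<lambda>\<close> is \<open>|q - \<lambda>|\<^sup>-\<^sup>2 (q\<^sup>\<sim> - \<lambda>)\<close>, a combination of the scalars
  \<open>q\<^sup>\<sim>\<close> and \<open>1\<close> with real coefficients, so inverting \<open>q - T\<close> only involves products of
  \<open>q\<close> and \<open>q\<^sup>\<sim>\<close>, which associate. This shows first that non-real \<open>q\<close> belong to the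
  resolvent set, hence that \<open>P\<close> lives on the real line, and then the formula (e) for every \<open>q\<close> in the
  resolvent set (\<open>calculus_resolvent\<close>).\<close>

section \<open>Algebra of the scalars\<close>

lemma hgen_in_Basis: "p < DIM('k) \<Longrightarrow> hgen p \<in> (Basis :: 'k::hypercomplex set)"
  using bij_hgen[where 'a='k] by (auto simp: bij_betw_def)

lemma inner_hgen:
  assumes "p < DIM('k)" "q < DIM('k)"
  shows "(hgen p :: 'k::hypercomplex) \<bullet> hgen q = (if p = q then 1 else 0)"
proof -
  have "(hgen p = (hgen q :: 'k)) = (p = q)"
    using bij_hgen[where 'a='k] assms by (auto simp: bij_betw_def inj_on_def)
  with assms show ?thesis
    by (simp add: inner_Basis hgen_in_Basis)
qed

lemma hgen_expansion: "(\<Sum>p<DIM('k). (z \<bullet> hgen p) *\<^sub>R hgen p) = (z :: 'k::hypercomplex)"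
proof -
  have "(\<Sum>p<DIM('k). (z \<bullet> hgen p) *\<^sub>R hgen p) = (\<Sum>b\<in>(Basis :: 'k set). (z \<bullet> b) *\<^sub>R b)"
    by (rule sum.reindex_bij_betw[OF bij_hgen])
  then show ?thesis
    by (simp add: euclidean_representation)
qed

lemma norm_hgen_expansion: "(\<Sum>p<DIM('k). (z \<bullet> hgen p)\<^sup>2) = (norm (z :: 'k::hypercomplex))\<^sup>2"
proof -
  have "(\<Sum>p<DIM('k). (z \<bullet> hgen p)\<^sup>2) = (\<Sum>b\<in>(Basis :: 'k set). (z \<bullet> b)\<^sup>2)"
    by (rule sum.reindex_bij_betw[OF bij_hgen])
  then show ?thesis
    by (simp add: norm_eq_sqrt_inner euclidean_inner[of z z] power2_eq_square sum_nonneg)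
qed

lemma hgen_eqI:
  assumes "\<And>p. p < DIM('k) \<Longrightarrow> z \<bullet> hgen p = w \<bullet> hgen p"
  shows "z = (w :: 'k::hypercomplex)"
  using hgen_expansion[of z] hgen_expansion[of w] assms by (metis (no_types, lifting) lessThan_iff sum.cong)

lemma DIM_hypercomplex_gt: "3 < DIM('k::hypercomplex)"
  using dim_hypercomplex[where 'a='k] by auto

lemma bounded_bilinear_hmult: "bounded_bilinear ((*) :: 'k::hypercomplex \<Rightarrow> 'k \<Rightarrow> 'k)"
proof (rule bilinear_conv_bounded_bilinear[THEN iffD1])
  show "bilinear ((*) :: 'k \<Rightarrow> 'k \<Rightarrow> 'k)"
    unfolding bilinear_def
    by (auto intro!: linearI simp: hmult_add_left hmult_add_right hmult_scaleR_left hmult_scaleR_right)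
qed

lemmas hmult_sum_left = bounded_bilinear.sum_left[OF bounded_bilinear_hmult]
  and hmult_sum_right = bounded_bilinear.sum_right[OF bounded_bilinear_hmult]
  and hmult_diff_right = bounded_bilinear.diff_right[OF bounded_bilinear_hmult]

lemma linear_hconj: "linear (hconj :: 'k::hypercomplex \<Rightarrow> 'k)"
  by (rule linearI) (simp_all add: hconj_add hconj_scaleR)

lemma inner_1_1: "(1::'k::hypercomplex) \<bullet> 1 = 1"
  using inner_hgen[of 0 0, where 'k='k] DIM_hypercomplex_gt[where 'k='k] by (simp add: hgen_0)

lemma hconj_inner_hgen:
  assumes "p < DIM('k)"
  shows "hconj (z :: 'k::hypercomplex) \<bullet> hgen p = (if p = 0 then 1 else - 1) * (z \<bullet> hgen p)"
proof -
  have "hconj z \<bullet> hgen p = (\<Sum>q<DIM('k). (z \<bullet> hgen q) * (hconj (hgen q) \<bullet> (hgen p :: 'k)))"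
    by (subst hgen_expansion[of z, symmetric])
      (simp add: linear_sum[OF linear_hconj] hconj_scaleR inner_sum_left)
  also have "\<dots> = (\<Sum>q<DIM('k). if q = p then (if p = 0 then 1 else - 1) * (z \<bullet> hgen p) else 0)"
  proof (rule sum.cong, rule refl)
    fix q assume "q \<in> {..<DIM('k)}"
    then show "(z \<bullet> hgen q) * (hconj (hgen q) \<bullet> (hgen p :: 'k)) =
      (if q = p then (if p = 0 then 1 else - 1) * (z \<bullet> hgen p) else 0)"
      using assms inner_hgen[of q p, where 'k='k]
      by (cases "q = 0") (auto simp: hconj_hgen hgen_0 hconj_1)
  qed
  finally show ?thesis
    using assms by simp
qed

lemma hconj_eq: "hconj (z :: 'k::hypercomplex) = (2 * (z \<bullet> 1)) *\<^sub>R 1 - z"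
proof (rule hgen_eqI)
  fix p assume p: "p < DIM('k)"
  then have "(1::'k) \<bullet> hgen p = (if p = 0 then 1 else 0)"
    using inner_hgen[of 0 p, where 'k='k] by (auto simp: hgen_0)
  then show "hconj z \<bullet> hgen p = ((2 * (z \<bullet> 1)) *\<^sub>R 1 - z) \<bullet> hgen p"
    using p by (simp add: hconj_inner_hgen inner_diff_left hgen_0)
qed

lemma hconj_hconj [simp]: "hconj (hconj z) = (z :: 'k::hypercomplex)"
  by (simp add: hconj_eq[of "hconj z"]) (simp add: hconj_eq inner_diff_left inner_1_1 algebra_simps)

lemma inner_hconj: "hconj a \<bullet> b = a \<bullet> hconj (b :: 'k::hypercomplex)"
  by (simp add: hconj_eq inner_diff_left inner_diff_right inner_commute)

lemma norm_hconj [simp]: "norm (hconj z) = norm (z :: 'k::hypercomplex)"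
  by (simp add: norm_eq_sqrt_inner inner_hconj)

lemma hmult_hconj_polar: "a * hconj b + b * hconj a = (2 * (a \<bullet> b)) *\<^sub>R (1 :: 'k::hypercomplex)"
proof -
  have "(a + b) * hconj (a + b) = (norm (a + b))\<^sup>2 *\<^sub>R (1::'k)"
    by (rule hmult_hconj)
  moreover have "(a + b) * hconj (a + b) = a * hconj a + b * hconj b + (a * hconj b + b * hconj a)"
    by (simp add: hconj_add hmult_add_left hmult_add_right)
  moreover have "(norm (a + b))\<^sup>2 = (norm a)\<^sup>2 + (norm b)\<^sup>2 + 2 * (a \<bullet> b)"
    by (simp add: power2_norm_eq_inner inner_add_left inner_add_right inner_commute)
  ultimately show ?thesis
    by (simp add: hmult_hconj scaleR_add_left)
qed

text \<open>Left multiplication by \<open>i\<^sub>p\<close> permutes the generators up to sign in pairs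
  \<open>i\<^sub>q \<mapsto> \<plusminus> i\<^sub>r \<mapsto> - i\<^sub>q\<close>, and the two terms of a pair cancel.\<close>

lemma inner_hgen_hmult_self:
  assumes "0 < p" "p < DIM('k)"
  shows "(hgen p * a) \<bullet> (a :: 'k::hypercomplex) = 0"
proof -
  note table = hgen_table[where 'a='k, unfolded cd_triples_def]
  have "hgen p * a = (\<Sum>q<DIM('k). (a \<bullet> hgen q) *\<^sub>R (hgen p * hgen q))"
    by (subst hgen_expansion[of a, symmetric]) (simp only: hmult_sum_right hmult_scaleR_right)
  then have ex: "(hgen p * a) \<bullet> a = (\<Sum>q<DIM('k). (a \<bullet> hgen q) * ((hgen p * hgen q) \<bullet> a))"
    by (simp only: inner_sum_left inner_scaleR_left)
  show ?thesis
  proof (cases "DIM('k) = 4")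
    case True
    have t: "hgen 1 * hgen 2 = (hgen 3 :: 'k)" "hgen 2 * hgen 3 = (hgen 1 :: 'k)"
      "hgen 3 * hgen 1 = (hgen 2 :: 'k)" "hgen 2 * hgen 1 = (- hgen 3 :: 'k)"
      "hgen 3 * hgen 2 = (- hgen 1 :: 'k)" "hgen 1 * hgen 3 = (- hgen 2 :: 'k)"
      using table[of 1 2 3] True by auto
    have p: "p = 1 \<or> p = 2 \<or> p = 3"
      using assms unfolding True by auto
    have s: "hgen 1 * hgen 1 = (-1::'k)" "hgen 2 * hgen 2 = (-1::'k)" "hgen 3 * hgen 3 = (-1::'k)"
      using hgen_square[where 'a='k] True by auto
    have lt: "{..<DIM('k)} = {0, 1, 2, 3}"
      unfolding True by auto
    show ?thesis
      using p unfolding ex lt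
      by (elim disjE) (simp_all add: s t hgen_0 hmult_1_left hmult_1_right inner_commute[of _ a] del: One_nat_def)
  next
    case False
    then have D: "DIM('k) = 8"
      using dim_hypercomplex[where 'a='k] by auto
    have t: "hgen p * hgen q = (hgen r::'k)" "hgen q * hgen r = (hgen p::'k)"
        "hgen r * hgen p = (hgen q::'k)" "hgen q * hgen p = (- hgen r::'k)"
        "hgen r * hgen q = (- hgen p::'k)" "hgen p * hgen r = (- hgen q::'k)"
      if "(p, q, r) \<in> {(1,2,3), (1,4,5), (2,4,6), (3,4,7), (1,7,6), (2,5,7), (3,6,5)}" for p q r
      using table[OF that] that D by auto
    note t' = t[of 1 2 3, simplified] t[of 1 4 5, simplified] t[of 2 4 6, simplified]
      t[of 3 4 7, simplified] t[of 1 7 6, simplified] t[of 2 5 7, simplified] t[of 3 6 5, simplified]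
    have p: "p = 1 \<or> p = 2 \<or> p = 3 \<or> p = 4 \<or> p = 5 \<or> p = 6 \<or> p = 7"
      using assms unfolding D by auto
    have s: "hgen q * hgen q = (-1::'k)" if "q \<in> {1..7}" for q
      using hgen_square[where 'a='k, of q] D that by auto
    note s' = s[of 1, simplified] s[of 2, simplified] s[of 3, simplified] s[of 4, simplified]
      s[of 5, simplified] s[of 6, simplified] s[of 7, simplified]
    have lt: "{..<DIM('k)} = {0, 1, 2, 3, 4, 5, 6, 7}"
      unfolding D by auto
    show ?thesis
      using p unfolding ex lt
      by (elim disjE) (simp_all add: s' t' hgen_0 hmult_1_left hmult_1_right inner_commute[of _ a])
  qed
qed

text \<open>All further algebra of the scalars is a consequence of this identity, a form of associativity under
  the trace that survives for the octonions.\<close>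

lemma hmult_adjoint_left: "(c * a) \<bullet> b = a \<bullet> (hconj c * (b :: 'k::hypercomplex))"
proof -
  have skew: "(hgen p * a) \<bullet> b = a \<bullet> (hconj (hgen p) * b)" if p: "p < DIM('k)" for p
  proof (cases "p = 0")
    case True
    then show ?thesis by (simp add: hgen_0 hconj_1 hmult_1_left)
  next
    case False
    then have "(hgen p * (a + b)) \<bullet> (a + b) = 0" "(hgen p * a) \<bullet> a = 0" "(hgen p * b) \<bullet> b = 0"
      using inner_hgen_hmult_self p by blast+
    then have "(hgen p * a) \<bullet> b + (hgen p * b) \<bullet> a = 0"
      by (simp add: hmult_add_right inner_add_left inner_add_right)
    then show ?thesis
      using False p by (simp add: hconj_hgen hmult_minus_left inner_commute)
  qed
  have "(c * a) \<bullet> b = (\<Sum>p<DIM('k). (c \<bullet> hgen p) * ((hgen p * a) \<bullet> b))"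
    by (subst hgen_expansion[of c, symmetric])
      (simp only: hmult_sum_left hmult_scaleR_left inner_sum_left inner_scaleR_left)
  also have "\<dots> = (\<Sum>p<DIM('k). (c \<bullet> hgen p) * (a \<bullet> (hconj (hgen p) * b)))"
    by (intro sum.cong refl) (simp add: skew)
  also have "\<dots> = a \<bullet> (hconj (\<Sum>p<DIM('k). (c \<bullet> hgen p) *\<^sub>R hgen p) * b)"
    by (simp only: linear_sum[OF linear_hconj] hconj_scaleR hmult_sum_left hmult_scaleR_left
        inner_sum_right inner_scaleR_right)
  finally show ?thesis
    by (simp only: hgen_expansion)
qed

lemma Re_hgen_hmult:
  assumes "p < DIM('k)" "q < DIM('k)" "0 < p"
  shows "(hgen p * hgen q) \<bullet> (1 :: 'k::hypercomplex) = (if p = q then - 1 else 0)"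
  using assms hmult_adjoint_left[of "hgen p" "hgen q" "1::'k"]
  by (auto simp: hconj_hgen hmult_1_right hmult_minus_left inner_hgen)

lemma hconj_hmult: "hconj (a * b) = hconj b * hconj (a :: 'k::hypercomplex)"
proof -
  have gen: "hconj (hgen p * hgen q) = hconj (hgen q) * hconj (hgen p :: 'k)"
    if "p < DIM('k)" "q < DIM('k)" for p q
  proof (cases "p = 0 \<or> q = 0")
    case True
    then show ?thesis by (auto simp: hgen_0 hconj_1 hmult_1_left hmult_1_right)
  next
    case False
    have "hgen p * hconj (hgen q) + hgen q * hconj (hgen p :: 'k) = (2 * (hgen p \<bullet> (hgen q :: 'k))) *\<^sub>R 1"
      by (rule hmult_hconj_polar)
    note polar = this[symmetric]
    have "hgen q * hgen p = (- (2 * (hgen p \<bullet> (hgen q :: 'k)))) *\<^sub>R 1 - hgen p * (hgen q :: 'k)"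
      using that False unfolding scaleR_minus_left polar by (simp add: hconj_hgen hmult_minus_right)
    then show ?thesis
      using that False by (simp add: hconj_eq[of "hgen p * hgen q"] hconj_hgen hmult_minus_left
        hmult_minus_right Re_hgen_hmult inner_hgen)
  qed
  have "hconj (a * b) = (\<Sum>q<DIM('k). \<Sum>p<DIM('k). (b \<bullet> hgen q) *\<^sub>R (a \<bullet> hgen p) *\<^sub>R hconj (hgen p * hgen q))"
    by (subst hgen_expansion[of a, symmetric], subst hgen_expansion[of b, symmetric])
      (simp only: linear_sum[OF linear_hconj] hconj_scaleR hmult_sum_left hmult_sum_right
        hmult_scaleR_left hmult_scaleR_right scaleR_sum_right)
  also have "\<dots> = (\<Sum>q<DIM('k). \<Sum>p<DIM('k). (b \<bullet> hgen q) *\<^sub>R (a \<bullet> hgen p) *\<^sub>R (hconj (hgen q) * hconj (hgen p)))"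
    by (intro sum.cong refl) (simp add: gen)
  also have "\<dots> = hconj (\<Sum>q<DIM('k). (b \<bullet> hgen q) *\<^sub>R hgen q) * hconj (\<Sum>p<DIM('k). (a \<bullet> hgen p) *\<^sub>R hgen p)"
    by (subst sum.swap) (simp only: linear_sum[OF linear_hconj] hconj_scaleR hmult_sum_left hmult_sum_right
        hmult_scaleR_left hmult_scaleR_right scaleR_sum_right scaleR_left_commute)
  finally show ?thesis
    by (simp only: hgen_expansion)
qed

lemma hmult_adjoint_right: "(a * c) \<bullet> b = a \<bullet> (b * hconj (c :: 'k::hypercomplex))"
proof -
  have "(a * c) \<bullet> b = (hconj c * hconj a) \<bullet> hconj b"
    by (simp add: inner_hconj flip: hconj_hmult)
  also have "\<dots> = a \<bullet> (b * hconj c)"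
    by (simp add: hmult_adjoint_left inner_hconj hconj_hmult)
  finally show ?thesis .
qed

lemma imaginary_hgen_product:
  assumes "0 < p" "p < DIM('k)"
  obtains q r where "0 < q" "q < DIM('k)" "0 < r" "r < DIM('k)"
    "hgen q * hgen r = (hgen p :: 'k::hypercomplex)" "hgen r * hgen q = - (hgen p :: 'k)"
proof -
  note table = hgen_table[where 'a='k, unfolded cd_triples_def]
  note outer = that
  have *: thesis if H: "(q, r, p) \<in> {(1,2,3), (1,4,5), (2,4,6), (3,4,7), (1,7,6), (2,5,7), (3,6,5)}
    \<or> (p, q, r) \<in> {(1,2,3), (1,4,5), (2,4,6), (3,4,7), (1,7,6), (2,5,7), (3,6,5)}
    \<or> (r, p, q) \<in> {(1,2,3), (1,4,5), (2,4,6), (3,4,7), (1,7,6), (2,5,7), (3,6,5)}"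
    "q < DIM('k)" "r < DIM('k)" for q r
    using H(1)
  proof (elim disjE)
    assume a: "(q, r, p) \<in> {(1,2,3), (1,4,5), (2,4,6), (3,4,7), (1,7,6), (2,5,7), (3,6,5)}"
    show ?thesis using table[OF a] a H(2,3) assms by - (rule outer[of q r], auto)
  next
    assume a: "(p, q, r) \<in> {(1,2,3), (1,4,5), (2,4,6), (3,4,7), (1,7,6), (2,5,7), (3,6,5)}"
    show ?thesis using table[OF a] a H(2,3) assms by - (rule outer[of q r], auto)
  next
    assume a: "(r, p, q) \<in> {(1,2,3), (1,4,5), (2,4,6), (3,4,7), (1,7,6), (2,5,7), (3,6,5)}"
    show ?thesis using table[OF a] a H(2,3) assms by - (rule outer[of q r], auto)
  qed
  have "p = 1 \<or> p = 2 \<or> p = 3 \<or> (DIM('k) = 8 \<and> (p = 4 \<or> p = 5 \<or> p = 6 \<or> p = 7))"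
    using assms dim_hypercomplex[where 'a='k] by auto
  then consider "p = 1" | "p = 2" | "p = 3" | "DIM('k) = 8" "p = 4" | "DIM('k) = 8" "p = 5" |
      "DIM('k) = 8" "p = 6" | "DIM('k) = 8" "p = 7"
    by blast
  then show thesis
  proof cases
    case 1 show thesis by (rule *[of 2 3]) (use 1 DIM_hypercomplex_gt[where 'k='k] in auto)
  next
    case 2 show thesis by (rule *[of 3 1]) (use 2 DIM_hypercomplex_gt[where 'k='k] in auto)
  next
    case 3 show thesis by (rule *[of 1 2]) (use 3 DIM_hypercomplex_gt[where 'k='k] in auto)
  next
    case 4 show thesis by (rule *[of 5 1]) (use 4 in auto)
  next
    case 5 show thesis by (rule *[of 1 4]) (use 5 in auto)
  next
    case 6 show thesis by (rule *[of 2 4]) (use 6 in auto)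
  next
    case 7 show thesis by (rule *[of 3 4]) (use 7 in auto)
  qed
qed

text \<open>The centre of both algebras is the real line: \<open>i\<^sub>p\<close> is itself a product of two
  anticommuting generators, and moving one of them to the other side of \<open>z\<close> reverses
  the sign of the \<open>p\<close>-th coordinate of \<open>z\<close>.\<close>

lemma central_imp_real:
  assumes comm: "\<And>q. q < DIM('k) \<Longrightarrow> z * hgen q = hgen q * (z :: 'k::hypercomplex)"
    and p: "0 < p" "p < DIM('k)"
  shows "z \<bullet> hgen p = 0"
proof -
  obtain q r where qr: "0 < q" "q < DIM('k)" "0 < r" "r < DIM('k)"
    "hgen q * hgen r = (hgen p :: 'k)" "hgen r * hgen q = - (hgen p :: 'k)"
    using imaginary_hgen_product[OF p] .
  have "(hgen q * z) \<bullet> hgen r = - (z \<bullet> hgen p)"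
    using qr by (simp add: hmult_adjoint_left hconj_hgen hmult_minus_left)
  moreover have "(z * hgen q) \<bullet> hgen r = z \<bullet> hgen p"
    using qr by (simp add: hmult_adjoint_right hconj_hgen hmult_minus_right)
  ultimately show ?thesis
    using comm[OF qr(2)] by simp
qed

section \<open>Differences of finite measures\<close>

lemma sets_upper_variation [simp, measurable_cong]: "sets (upper_variation \<mu>) = sets borel"
  unfolding upper_variation_def using sets.sigma_sets_eq[of borel] by (subst sets_measure_of) auto

lemma space_upper_variation [simp]: "space (upper_variation \<mu>) = UNIV"
  unfolding upper_variation_def by (subst space_measure_of) auto

lemma sets_lower_variation [simp, measurable_cong]: "sets (lower_variation \<mu>) = sets borel"
  by (simp add: lower_variation_def)

lemma space_lower_variation [simp]: "space (lower_variation \<mu>) = UNIV"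
  by (simp add: lower_variation_def)

text \<open>The supremum over the Borel subsets of \<open>A\<close> is attained at \<open>A \<inter> Y\<close>: dropping the part of a
  subset outside \<open>Y\<close> and adding what is missing from \<open>A \<inter> Y\<close> can only increase \<open>\<mu>\<close>.\<close>

lemma emeasure_upper_variation:
  fixes M N :: "'a::topological_space measure"
  assumes fin: "finite_measure M" "finite_measure N" and sets: "sets M = sets borel" "sets N = sets borel"
    and \<mu>: "\<And>A. A \<in> sets borel \<Longrightarrow> \<mu> A = measure M A - measure N A"
    and Y: "Y \<in> sets borel"
    and pos: "\<And>B. B \<in> sets borel \<Longrightarrow> B \<subseteq> Y \<Longrightarrow> 0 \<le> \<mu> B"
    and neg: "\<And>B. B \<in> sets borel \<Longrightarrow> B \<inter> Y = {} \<Longrightarrow> \<mu> B \<le> 0"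
    and A: "A \<in> sets borel"
  shows "emeasure (upper_variation \<mu>) A = ennreal (\<mu> (A \<inter> Y))"
proof -
  interpret M: finite_measure M by fact
  interpret N: finite_measure N by fact
  define M' where "M' = density M (indicator Y)"
  define N' where "N' = density N (indicator Y)"
  define U where "U = diff_measure M' N'"
  have fin': "finite_measure M'" "finite_measure N'"
    unfolding M'_def N'_def using M.finite_measure_restricted[of Y] N.finite_measure_restricted[of Y] Y
    by (simp_all add: sets)
  have sets': "sets M' = sets borel" "sets N' = sets borel"
    by (simp_all add: M'_def N'_def sets)
  have em: "emeasure M' A = ennreal (measure M (A \<inter> Y))" "emeasure N' A = ennreal (measure N (A \<inter> Y))"
    if "A \<in> sets borel" for A
    using that Y by (simp_all add: M'_def N'_def sets emeasure_restricted M.emeasure_eq_measure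
        N.emeasure_eq_measure Int_commute)
  have U: "emeasure U A = ennreal (\<mu> (A \<inter> Y))" if A: "A \<in> sets borel" for A
  proof -
    have "emeasure N' B \<le> emeasure M' B" if "B \<in> sets M'" for B
      using that pos[of "B \<inter> Y"] Y by (simp add: sets' em \<mu> ennreal_leI)
    then have "emeasure U A = emeasure M' A - emeasure N' A"
      unfolding U_def using fin' sets' A by (intro emeasure_diff_measure) auto
    then show ?thesis
      using A Y by (simp add: em \<mu> ennreal_minus)
  qed
  have le: "\<mu> B \<le> \<mu> (A \<inter> Y)" if AB: "A \<in> sets borel" "B \<in> sets borel" "B \<subseteq> A" for A B
  proof -
    have diff: "\<mu> C = \<mu> (C \<inter> D) + \<mu> (C - D)" if "C \<in> sets borel" "D \<in> sets borel" for C D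
      using that M.finite_measure_Diff'[of C D] N.finite_measure_Diff'[of C D] by (simp add: \<mu> sets)
    have "\<mu> B = \<mu> (B \<inter> Y) + \<mu> (B - Y)" "\<mu> (A \<inter> Y) = \<mu> (A \<inter> Y \<inter> B) + \<mu> (A \<inter> Y - B)"
      using AB Y by (auto intro!: diff)
    moreover have "\<mu> (B - Y) \<le> 0" "0 \<le> \<mu> (A \<inter> Y - B)"
      using AB Y by (auto intro!: neg pos)
    moreover have "\<mu> (A \<inter> Y \<inter> B) = \<mu> (B \<inter> Y)"
      using AB by (intro arg_cong[where f = \<mu>]) auto
    ultimately show ?thesis
      by linarith
  qed
  have sup: "(SUP B \<in> {B \<in> sets borel. B \<subseteq> A}. ennreal (\<mu> B)) = emeasure U A" if A: "A \<in> sets borel" for A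
  proof (rule antisym)
    show "(SUP B \<in> {B \<in> sets borel. B \<subseteq> A}. ennreal (\<mu> B)) \<le> emeasure U A"
      using A by (auto intro!: SUP_least ennreal_leI le simp: U)
    show "emeasure U A \<le> (SUP B \<in> {B \<in> sets borel. B \<subseteq> A}. ennreal (\<mu> B))"
      unfolding U[OF A] using A Y by (auto intro!: SUP_upper)
  qed
  have "upper_variation \<mu> = measure_of (space U) (sets U) (emeasure U)"
  proof -
    have "sets U = sets borel" "space U = UNIV"
      using sets_eq_imp_space_eq[OF sets'(1)] by (simp_all add: U_def sets')
    then show ?thesis
      unfolding upper_variation_def using sup sets.sigma_sets_eq[of borel] by (simp only:) (intro measure_of_eq, auto)
  qed
  then show ?thesis
    by (simp add: measure_of_of_measure U A)
qed

lemma variation_of_difference: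
  fixes M N :: "'a::topological_space measure"
  assumes fin: "finite_measure M" "finite_measure N" and sets: "sets M = sets borel" "sets N = sets borel"
    and \<mu>: "\<And>A. A \<in> sets borel \<Longrightarrow> \<mu> A = measure M A - measure N A"
  obtains Y where "Y \<in> sets borel" "finite_measure (upper_variation \<mu>)" "finite_measure (lower_variation \<mu>)"
    "\<And>A. A \<in> sets borel \<Longrightarrow> measure (upper_variation \<mu>) A = \<mu> (A \<inter> Y)"
    "\<And>A. A \<in> sets borel \<Longrightarrow> measure (lower_variation \<mu>) A = - \<mu> (A - Y)"
    "\<And>A. A \<in> sets borel \<Longrightarrow> \<mu> A = measure (upper_variation \<mu>) A - measure (lower_variation \<mu>) A"
proof -
  interpret M: finite_measure M by fact
  interpret N: finite_measure N by fact
  obtain Y where Y: "Y \<in> sets borel"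
    "\<And>B. B \<in> sets borel \<Longrightarrow> B \<subseteq> Y \<Longrightarrow> emeasure N B \<le> emeasure M B"
    "\<And>B. B \<in> sets borel \<Longrightarrow> B \<inter> Y = {} \<Longrightarrow> emeasure M B \<le> emeasure N B"
    using finite_unsigned_Hahn_decomposition[OF fin] sets by auto
  have pos: "0 \<le> \<mu> B" if "B \<in> sets borel" "B \<subseteq> Y" for B
    using Y(2)[OF that] that by (simp add: \<mu> M.emeasure_eq_measure N.emeasure_eq_measure)
  have neg: "\<mu> B \<le> 0" if "B \<in> sets borel" "B \<inter> Y = {}" for B
    using Y(3)[OF that] that by (simp add: \<mu> M.emeasure_eq_measure N.emeasure_eq_measure)
  have up: "emeasure (upper_variation \<mu>) A = ennreal (\<mu> (A \<inter> Y))" if "A \<in> sets borel" for A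
    by (rule emeasure_upper_variation[OF fin sets \<mu> Y(1) pos neg that])
  have low: "emeasure (lower_variation \<mu>) A = ennreal (- \<mu> (A - Y))" if "A \<in> sets borel" for A
  proof -
    have "emeasure (upper_variation (\<lambda>A. - \<mu> A)) A = ennreal (- \<mu> (A \<inter> - Y))"
      by (rule emeasure_upper_variation[OF fin(2,1) sets(2,1)])
        (use Y(1) that in \<open>auto simp: \<mu> intro: pos neg\<close>, use pos neg \<mu> in \<open>fastforce+\<close>)
    then show ?thesis
      by (simp add: lower_variation_def Diff_eq)
  qed
  have m: "measure (upper_variation \<mu>) A = \<mu> (A \<inter> Y)" "measure (lower_variation \<mu>) A = - \<mu> (A - Y)"
    if "A \<in> sets borel" for A
  proof -
    have "(A - Y) \<inter> Y = {}" by auto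
    then show "measure (upper_variation \<mu>) A = \<mu> (A \<inter> Y)" "measure (lower_variation \<mu>) A = - \<mu> (A - Y)"
      using up[OF that] low[OF that] pos[of "A \<inter> Y"] neg[of "A - Y"] that Y(1) by (auto simp: measure_def)
  qed
  show thesis
  proof (rule that[OF Y(1)])
    show "finite_measure (upper_variation \<mu>)" "finite_measure (lower_variation \<mu>)"
      using up[of UNIV] low[of UNIV] by (auto intro!: finite_measureI)
    show "\<mu> A = measure (upper_variation \<mu>) A - measure (lower_variation \<mu>) A" if "A \<in> sets borel" for A
      using that Y(1) M.finite_measure_Diff'[of A Y] N.finite_measure_Diff'[of A Y]
      by (simp add: m \<mu> sets)
  qed (use m in auto)
qed

section \<open>Projection-valued measures on a real Hilbert space\<close>

locale projection_valued_measure =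
  fixes P :: "'a::topological_space set \<Rightarrow> 'x::{real_inner, complete_space} \<Rightarrow> 'x"
  assumes linear_P: "\<delta> \<in> sets borel \<Longrightarrow> linear (P \<delta>)"
    and symmetric_P: "\<delta> \<in> sets borel \<Longrightarrow> P \<delta> x \<bullet> y = x \<bullet> P \<delta> y"
    and P_P: "\<delta> \<in> sets borel \<Longrightarrow> \<gamma> \<in> sets borel \<Longrightarrow> P \<delta> (P \<gamma> x) = P (\<delta> \<inter> \<gamma>) x"
    and P_UNIV: "P UNIV x = x"
    and P_sums: "range A \<subseteq> sets borel \<Longrightarrow> disjoint_family A \<Longrightarrow> (\<lambda>n::nat. P (A n) x) sums P (\<Union>n. A n) x"
begin

lemma P_empty [simp]: "P {} x = 0"
proof -
  have "(\<lambda>n::nat. P {} x) sums P (\<Union>n::nat. {}) x"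
    by (rule P_sums) (auto simp: disjoint_family_on_def)
  then have "(\<lambda>n::nat. P {} x) \<longlonglongrightarrow> 0"
    by (intro summable_LIMSEQ_zero) (auto simp: sums_iff)
  then show ?thesis
    by (simp add: LIMSEQ_const_iff)
qed

lemma P_Un:
  assumes "\<delta> \<in> sets borel" "\<gamma> \<in> sets borel" "\<delta> \<inter> \<gamma> = {}"
  shows "P (\<delta> \<union> \<gamma>) x = P \<delta> x + P \<gamma> x"
proof -
  define A where "A = (\<lambda>n::nat. if n = 0 then \<delta> else if n = 1 then \<gamma> else {})"
  have "(\<lambda>n. P (A n) x) sums P (\<Union>n. A n) x"
    using assms by (intro P_sums) (auto simp: A_def disjoint_family_on_def)
  moreover have "(\<Union>n. A n) = \<delta> \<union> \<gamma>"
    by (auto simp: A_def split: if_splits)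
  moreover have "(\<lambda>n. P (A n) x) sums (\<Sum>n\<in>{0, 1}. P (A n) x)"
    by (rule sums_finite) (auto simp: A_def)
  ultimately show ?thesis
    by (auto simp: A_def dest: sums_unique2)
qed

lemma P_UN:
  assumes "finite I" "\<And>i. i \<in> I \<Longrightarrow> B i \<in> sets borel" "disjoint_family_on B I"
  shows "P (\<Union>i\<in>I. B i) x = (\<Sum>i\<in>I. P (B i) x)"
  using assms
proof (induction I rule: finite_induct)
  case (insert i I)
  have "P (B i \<union> (\<Union>j\<in>I. B j)) x = P (B i) x + P (\<Union>j\<in>I. B j) x"
    using insert by (intro P_Un) (auto simp: disjoint_family_on_def intro!: sets.finite_UN)
  then show ?case
    using insert by (auto simp: disjoint_family_on_def)
qed simp

lemma inner_P_P:
  assumes "\<delta> \<in> sets borel" "\<gamma> \<in> sets borel"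
  shows "P \<delta> x \<bullet> P \<gamma> y = P (\<delta> \<inter> \<gamma>) x \<bullet> y"
  using assms by (simp add: P_P Int_commute flip: symmetric_P)

lemma inner_P_self: "\<delta> \<in> sets borel \<Longrightarrow> P \<delta> x \<bullet> x = (norm (P \<delta> x))\<^sup>2"
  using inner_P_P[of \<delta> \<delta> x x] by (simp add: power2_norm_eq_inner)

text \<open>The real form of \<open>quadratic_measure\<close>.\<close>

definition qmeasure :: "'x \<Rightarrow> 'a measure" where
  "qmeasure x = measure_of UNIV (sets borel) (\<lambda>\<delta>. ennreal (P \<delta> x \<bullet> x))"

lemma sets_qmeasure [simp, measurable_cong]: "sets (qmeasure x) = sets borel"
  unfolding qmeasure_def using sets.sigma_sets_eq[of borel] by (subst sets_measure_of) auto

lemma space_qmeasure [simp]: "space (qmeasure x) = UNIV"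
  unfolding qmeasure_def by (subst space_measure_of) auto

lemma emeasure_qmeasure:
  assumes "\<delta> \<in> sets borel"
  shows "emeasure (qmeasure x) \<delta> = ennreal (P \<delta> x \<bullet> x)"
  unfolding qmeasure_def
proof (rule emeasure_measure_of_sigma)
  show "sigma_algebra UNIV (sets (borel :: 'a measure))"
    using sets.sigma_algebra_axioms[of "borel :: 'a measure"] by simp
  show "positive (sets borel) (\<lambda>\<delta>. ennreal (P \<delta> x \<bullet> x))"
    by (simp add: positive_def)
  show "countably_additive (sets borel) (\<lambda>\<delta>. ennreal (P \<delta> x \<bullet> x))"
  proof (rule countably_additiveI)
    fix A :: "nat \<Rightarrow> 'a set"
    assume A: "range A \<subseteq> sets borel" "disjoint_family A"
    have "(\<lambda>n. P (A n) x \<bullet> x) sums (P (\<Union>n. A n) x \<bullet> x)"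
      using bounded_linear.sums[OF bounded_linear_inner_left P_sums[OF A]] .
    moreover have "0 \<le> P (A n) x \<bullet> x" for n
      using A inner_P_self[of "A n" x] by auto
    ultimately show "(\<Sum>n. ennreal (P (A n) x \<bullet> x)) = ennreal (P (\<Union>n. A n) x \<bullet> x)"
      by (simp add: suminf_ennreal2 sums_iff)
  qed
qed fact

lemma finite_measure_qmeasure [simp]: "finite_measure (qmeasure x)"
  by (rule finite_measureI) (simp add: emeasure_qmeasure)

lemma measure_qmeasure: "\<delta> \<in> sets borel \<Longrightarrow> measure (qmeasure x) \<delta> = P \<delta> x \<bullet> x"
  by (simp add: measure_def emeasure_qmeasure inner_P_self)

subsection \<open>Functions with finitely many values\<close>

definition simple :: "('a \<Rightarrow> real) \<Rightarrow> bool" where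
  "simple s \<longleftrightarrow> s \<in> borel_measurable borel \<and> finite (range s)"

definition simple_sum :: "('a \<Rightarrow> real) \<Rightarrow> 'x \<Rightarrow> 'x" where
  "simple_sum s x = (\<Sum>c\<in>range s. c *\<^sub>R P (s -` {c}) x)"

lemma borel_vimage_singleton: "s \<in> borel_measurable borel \<Longrightarrow> s -` {c} \<in> sets borel" for c :: real
  using measurable_sets[of s borel borel "{c}"] by simp

lemma simple_sum_refine:
  assumes "finite (range \<phi>)" "\<And>i. \<phi> -` {i} \<in> sets borel" "s = (\<lambda>z. c (\<phi> z))"
  shows "simple_sum s x = (\<Sum>i\<in>range \<phi>. c i *\<^sub>R P (\<phi> -` {i}) x)"
proof -
  have "P (s -` {v}) x = (\<Sum>i\<in>{i\<in>range \<phi>. c i = v}. P (\<phi> -` {i}) x)" for v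
  proof -
    have "s -` {v} = (\<Union>i\<in>{i\<in>range \<phi>. c i = v}. \<phi> -` {i})"
      using assms(3) by auto
    then show ?thesis
      using assms(1,2) by (simp add: disjoint_family_on_def) (subst P_UN, auto simp: disjoint_family_on_def)
  qed
  then have "simple_sum s x = (\<Sum>v\<in>range s. \<Sum>i\<in>{i\<in>range \<phi>. c i = v}. c i *\<^sub>R P (\<phi> -` {i}) x)"
    by (simp add: simple_sum_def scaleR_sum_right)
  also have "\<dots> = (\<Sum>v\<in>c ` range \<phi>. \<Sum>i\<in>{i\<in>range \<phi>. c i = v}. c i *\<^sub>R P (\<phi> -` {i}) x)"
    using assms(3) by (simp add: image_image)
  also have "\<dots> = (\<Sum>i\<in>range \<phi>. c i *\<^sub>R P (\<phi> -` {i}) x)"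
    by (rule sum.image_gen[OF assms(1), symmetric])
  finally show ?thesis .
qed

text \<open>Two simple functions are functions of their joint values; hence all identities between simple
  sums can be read off one common partition.\<close>

lemma joint_partition:
  assumes "simple s" "simple t"
  shows "finite (range (\<lambda>z. (s z, t z)))" "(\<lambda>z. (s z, t z)) -` {i} \<in> sets borel"
proof -
  show "finite (range (\<lambda>z. (s z, t z)))"
    by (rule finite_subset[of _ "range s \<times> range t"]) (use assms in \<open>auto simp: simple_def\<close>)
  have "(\<lambda>z. (s z, t z)) -` {i} = s -` {fst i} \<inter> t -` {snd i}"
    by (cases i) auto
  then show "(\<lambda>z. (s z, t z)) -` {i} \<in> sets borel"
    using assms by (simp only: simple_def sets.Int borel_vimage_singleton)
qed

lemma simple_arith:
  assumes "simple s" "simple t"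
  shows "simple (\<lambda>z. s z + t z)" "simple (\<lambda>z. s z - t z)" "simple (\<lambda>z. s z * t z)"
proof -
  have *: "finite (range (\<lambda>z. f (s z) (t z)))" for f :: "real \<Rightarrow> real \<Rightarrow> real"
    by (rule finite_subset[of _ "(\<lambda>(a, b). f a b) ` range (\<lambda>z. (s z, t z))"])
      (use joint_partition(1)[OF assms] in auto)
  show "simple (\<lambda>z. s z + t z)" "simple (\<lambda>z. s z - t z)" "simple (\<lambda>z. s z * t z)"
    using assms *[of "(+)"] *[of "(-)"] *[of "(*)"] by (auto simp: simple_def)
qed

lemma simple_const: "simple (\<lambda>z. c)"
  by (simp add: simple_def image_constant_conv)

lemma simple_sum_add:
  assumes "simple s" "simple t"
  shows "simple_sum (\<lambda>z. s z + t z) x = simple_sum s x + simple_sum t x"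
proof -
  note r = simple_sum_refine[OF joint_partition[OF assms]]
  show ?thesis
    unfolding r[of "\<lambda>z. s z + t z" "\<lambda>(a, b). a + b", simplified] r[of s fst, simplified]
      r[of t snd, simplified]
    by (simp add: sum.distrib[symmetric] scaleR_add_left case_prod_beta)
qed

lemma simple_sum_cmult:
  assumes "simple s"
  shows "simple_sum (\<lambda>z. k * s z) x = k *\<^sub>R simple_sum s x"
proof -
  note r = simple_sum_refine[of s, OF _ borel_vimage_singleton]
  show ?thesis
    using assms unfolding simple_def
    by (subst r[of "\<lambda>z. k * s z" "\<lambda>a. k * a"]) (auto simp: simple_sum_def scaleR_sum_right)
qed

lemma simple_sum_diff:
  assumes "simple s" "simple t"
  shows "simple_sum (\<lambda>z. s z - t z) x = simple_sum s x - simple_sum t x"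
  using simple_sum_add[OF assms(1) simple_arith(3)[OF simple_const assms(2)], of "-1"]
    simple_sum_cmult[OF assms(2), of "-1"] by simp

lemma inner_simple_sum_simple_sum:
  assumes "simple s" "simple t"
  shows "simple_sum s x \<bullet> simple_sum t y = simple_sum (\<lambda>z. s z * t z) x \<bullet> y"
proof -
  note r = simple_sum_refine[OF joint_partition[OF assms]]
  let ?\<phi> = "\<lambda>z. (s z, t z)"
  have "simple_sum s x \<bullet> simple_sum t y =
    (\<Sum>i\<in>range ?\<phi>. \<Sum>j\<in>range ?\<phi>. fst i * (snd j * (P (?\<phi> -` {i}) x \<bullet> P (?\<phi> -` {j}) y)))"
    unfolding r[of s fst, simplified] r[of t snd, simplified]
    by (subst sum.swap) (simp add: inner_sum_left inner_sum_right sum_distrib_left mult_ac)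
  also have "\<dots> = (\<Sum>i\<in>range ?\<phi>. \<Sum>j\<in>range ?\<phi>. if j = i then fst i * snd i * (P (?\<phi> -` {i}) x \<bullet> y) else 0)"
  proof (intro sum.cong refl)
    fix i j
    have "?\<phi> -` {i} \<inter> ?\<phi> -` {j} = (if j = i then ?\<phi> -` {i} else {})"
      by auto
    then have "P (?\<phi> -` {i}) x \<bullet> P (?\<phi> -` {j}) y = (if j = i then P (?\<phi> -` {i}) x \<bullet> y else 0)"
      using joint_partition(2)[OF assms] by (simp add: inner_P_P)
    then show "fst i * (snd j * (P (?\<phi> -` {i}) x \<bullet> P (?\<phi> -` {j}) y)) =
      (if j = i then fst i * snd i * (P (?\<phi> -` {i}) x \<bullet> y) else 0)"
      by simp
  qed
  also have "\<dots> = simple_sum (\<lambda>z. s z * t z) x \<bullet> y"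
    unfolding r[of "\<lambda>z. s z * t z" "\<lambda>(a, b). a * b", simplified] using joint_partition(1)[OF assms]
    by (simp add: inner_sum_left case_prod_beta)
  finally show ?thesis .
qed

lemma linear_simple_sum: "simple s \<Longrightarrow> linear (simple_sum s)"
  unfolding simple_sum_def simple_def
  by (intro linear_compose_sum ballI linear_compose_scale_right linear_P borel_vimage_singleton) auto

lemma simple_indicator: "simple (indicator \<delta>)" if "\<delta> \<in> sets borel"
proof -
  have "range (indicator \<delta> :: 'a \<Rightarrow> real) \<subseteq> {0, 1}"
    by (auto simp: indicator_def)
  then show ?thesis
    using that by (auto simp: simple_def intro: finite_subset)
qed

lemma simple_sum_indicator:
  assumes "\<delta> \<in> sets borel"
  shows "simple_sum (indicator \<delta>) x = P \<delta> x"
proof -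
  have "simple_sum (indicator \<delta>) x = (\<Sum>c\<in>{0, 1}. c *\<^sub>R P (indicator \<delta> -` {c}) x)"
    unfolding simple_sum_def
  proof (rule sum.mono_neutral_left)
    show "\<forall>i\<in>{0, 1} - range (indicator \<delta>). i *\<^sub>R P (indicator \<delta> -` {i}) x = 0"
    proof
      fix i :: real assume "i \<in> {0, 1} - range (indicator \<delta>)"
      then have "indicator \<delta> -` {i} = {}" by auto
      then show "i *\<^sub>R P (indicator \<delta> -` {i}) x = 0" by simp
    qed
  qed (auto simp: indicator_def)
  moreover have "indicator \<delta> -` {1::real} = \<delta>"
    by (auto simp: indicator_def)
  ultimately show ?thesis by simp
qed

lemma simple_integral_eq:
  assumes M: "finite_measure M" "sets M = sets borel" and s: "simple s"
  shows "integral\<^sup>L M s = (\<Sum>c\<in>range s. c * measure M (s -` {c}))" "integrable M s"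
proof -
  interpret finite_measure M by fact
  have s_eq: "s = (\<lambda>z. \<Sum>c\<in>range s. c * indicator (s -` {c}) z)"
  proof
    fix z
    have "(\<Sum>c\<in>range s. c * indicator (s -` {c}) z) = (\<Sum>c\<in>range s. if c = s z then s z else 0)"
      by (intro sum.cong) (auto simp: indicator_def)
    then show "s z = (\<Sum>c\<in>range s. c * indicator (s -` {c}) z)"
      using s by (simp add: simple_def)
  qed
  have b: "s -` {c} \<in> sets M" for c
    using s M(2) by (simp add: simple_def borel_vimage_singleton)
  have i: "integrable M (\<lambda>z. c * indicator (s -` {c}) z)" for c
    using b by (intro integrable_mult_right integrable_real_indicator) (auto simp: less_top[symmetric])
  show "integrable M s"
    by (subst s_eq) (intro Bochner_Integration.integrable_sum i)
  show "integral\<^sup>L M s = (\<Sum>c\<in>range s. c * measure M (s -` {c}))"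
    by (subst s_eq, subst Bochner_Integration.integral_sum) (use i b in simp_all)
qed

lemma inner_simple_sum:
  assumes M: "finite_measure M" "sets M = sets borel" and N: "finite_measure N" "sets N = sets borel"
    and eq: "\<And>\<delta>. \<delta> \<in> sets borel \<Longrightarrow> P \<delta> x \<bullet> y = measure M \<delta> - measure N \<delta>"
    and s: "simple s"
  shows "simple_sum s x \<bullet> y = integral\<^sup>L M s - integral\<^sup>L N s"
proof -
  have "s -` {c} \<in> sets borel" for c
    using s by (simp add: simple_def borel_vimage_singleton)
  then show ?thesis
    by (simp add: simple_integral_eq[OF M s] simple_integral_eq[OF N s] simple_sum_def inner_sum_left eq
        sum_subtractf right_diff_distrib)
qed

lemma norm_simple_sum_le:
  assumes s: "simple s" and le: "\<And>z. \<bar>s z\<bar> \<le> e"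
  shows "norm (simple_sum s x) \<le> e * norm x"
proof -
  have e: "0 \<le> e" using le[of undefined] by linarith
  interpret finite_measure "qmeasure x" by simp
  have null: "finite_measure (null_measure borel)"
    by (rule finite_measureI) simp
  have ss: "simple (\<lambda>z. s z * s z)"
    using simple_arith s by blast
  have "(norm (simple_sum s x))\<^sup>2 = (\<integral>z. s z * s z \<partial>qmeasure x)"
    unfolding power2_norm_eq_inner inner_simple_sum_simple_sum[OF s s]
    by (subst inner_simple_sum[OF finite_measure_qmeasure[of x] _ null _ _ ss]) (auto simp: measure_qmeasure)
  also have "\<dots> \<le> (\<integral>z. e\<^sup>2 \<partial>qmeasure x)"
  proof (rule integral_mono)
    show "integrable (qmeasure x) (\<lambda>z. s z * s z)"
      using simple_integral_eq(2)[OF _ _ ss] by simp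
    show "s z * s z \<le> e\<^sup>2" for z
      using le[of z] by (metis abs_ge_zero abs_mult_self_eq mult_mono' power2_eq_square)
  qed simp
  also have "\<dots> = (e * norm x)\<^sup>2"
    by (simp add: measure_qmeasure P_UNIV power_mult_distrib power2_norm_eq_inner)
  finally show ?thesis
    using e by (simp add: power2_le_iff_abs_le)
qed

end

definition bounded_borel :: "('a::topological_space \<Rightarrow> 'b::real_normed_vector) \<Rightarrow> bool" where
  "bounded_borel g \<longleftrightarrow> g \<in> borel_measurable borel \<and> (\<exists>C. \<forall>z. norm (g z) \<le> C)"

lemma bounded_borelI: "g \<in> borel_measurable borel \<Longrightarrow> (\<And>z. norm (g z) \<le> C) \<Longrightarrow> bounded_borel g"
  by (auto simp: bounded_borel_def)

lemma bounded_borelD: "bounded_borel g \<Longrightarrow> g \<in> borel_measurable borel"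
  by (simp add: bounded_borel_def)

lemma bounded_borelE:
  assumes "bounded_borel g"
  obtains C where "0 < C" "\<And>z. norm (g z) \<le> C"
proof -
  obtain C where "\<And>z. norm (g z) \<le> C"
    using assms by (auto simp: bounded_borel_def)
  then show thesis
    by (intro that[of "max C 1"]) (auto intro: max.coboundedI1)
qed

lemma bounded_borel_const: "bounded_borel (\<lambda>z. c)"
  by (auto simp: bounded_borel_def)

lemma bounded_borel_scaleR:
  fixes f :: "'a::topological_space \<Rightarrow> real" and g :: "'a \<Rightarrow> 'b::{real_normed_vector, second_countable_topology}"
  assumes "bounded_borel f" "bounded_borel g"
  shows "bounded_borel (\<lambda>z. f z *\<^sub>R g z)"
proof -
  obtain C where C: "0 < C" "\<And>z. norm (f z) \<le> C" using assms(1) by (rule bounded_borelE) blast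
  obtain C' where C': "0 < C'" "\<And>z. norm (g z) \<le> C'" using assms(2) by (rule bounded_borelE) blast
  have "norm (f z *\<^sub>R g z) \<le> C * C'" for z
    using C C' by (auto intro!: mult_mono intro: less_imp_le)
  then show ?thesis
    using assms by (intro bounded_borelI[of _ "C * C'"]) (auto dest!: bounded_borelD)
qed

lemma bounded_borel_arith:
  fixes f g :: "'a::topological_space \<Rightarrow> 'b::{real_normed_vector, second_countable_topology}"
  assumes f: "bounded_borel f" and g: "bounded_borel g"
  shows "bounded_borel (\<lambda>z. f z + g z)" "bounded_borel (\<lambda>z. f z - g z)"
proof -
  obtain C where C: "\<And>z. norm (f z) \<le> C" using f by (rule bounded_borelE) blast
  obtain C' where C': "\<And>z. norm (g z) \<le> C'" using g by (rule bounded_borelE) blast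
  have "norm (f z + g z) \<le> C + C'" "norm (f z - g z) \<le> C + C'" for z
    using C C' by (auto intro!: norm_triangle_le norm_triangle_le_diff add_mono)
  then show "bounded_borel (\<lambda>z. f z + g z)" "bounded_borel (\<lambda>z. f z - g z)"
    using assms by (auto intro!: bounded_borelI[of _ "C + C'"] dest!: bounded_borelD)
qed

lemma bounded_borel_mult:
  fixes f g :: "'a::topological_space \<Rightarrow> real"
  shows "bounded_borel f \<Longrightarrow> bounded_borel g \<Longrightarrow> bounded_borel (\<lambda>z. f z * g z)"
  using bounded_borel_scaleR[of f g] by simp

lemma bounded_borel_indicator: "\<delta> \<in> sets borel \<Longrightarrow> bounded_borel (indicator \<delta> :: 'a::topological_space \<Rightarrow> real)"
  by (rule bounded_borelI[of _ 1]) (auto simp: indicator_def)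

lemma bounded_borel_inner:
  fixes f :: "'a::topological_space \<Rightarrow> 'b::{real_inner, second_countable_topology}"
  assumes "bounded_borel f"
  shows "bounded_borel (\<lambda>z. f z \<bullet> c)"
proof -
  obtain C where "0 < C" "\<And>z. norm (f z) \<le> C" using assms by (rule bounded_borelE) blast
  then have "norm (f z \<bullet> c) \<le> C * norm c" for z
    using Cauchy_Schwarz_ineq2[of "f z" c] by (smt (verit) mult_right_mono norm_ge_zero real_norm_def)
  then show ?thesis
    using assms by (intro bounded_borelI[of _ "C * norm c"]) (auto dest!: bounded_borelD)
qed

lemma bounded_borel_uminus:
  fixes f :: "'a::topological_space \<Rightarrow> 'b::{real_normed_vector, second_countable_topology}"
  shows "bounded_borel f \<Longrightarrow> bounded_borel (\<lambda>z. - f z)"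
  using bounded_borel_arith(2)[OF bounded_borel_const[of 0], of f] by simp

lemma integrable_bounded_borel:
  fixes g :: "'a::topological_space \<Rightarrow> 'b::{banach, second_countable_topology}"
  assumes "bounded_borel g" "finite_measure M" "sets M = sets borel"
  shows "integrable M g"
proof -
  interpret finite_measure M by fact
  obtain C where "\<And>z. norm (g z) \<le> C" using assms(1) by (rule bounded_borelE) blast
  then show ?thesis
    using assms(1,3) by (intro integrable_const_bound[where B = C]) (auto dest!: bounded_borelD simp: measurable_cong_sets[OF assms(3) refl])
qed

lemma small_factor:
  fixes e c :: real
  assumes "0 < e" "0 \<le> c"
  obtains d where "0 < d" "d * c < e"
proof
  have "0 < c + 1" using assms by simp
  then show "0 < e / (c + 1)" "e / (c + 1) * c < e"
    using assms by (auto simp: pos_divide_less_eq)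
qed

lemma LIMSEQ_integral_uniform:
  fixes t :: "nat \<Rightarrow> 'a::topological_space \<Rightarrow> real"
  assumes M: "finite_measure M" "sets M = sets borel"
    and t: "\<And>n. bounded_borel (t n)" and g: "bounded_borel g" and lim: "uniform_limit UNIV t g sequentially"
  shows "(\<lambda>n. integral\<^sup>L M (t n)) \<longlonglongrightarrow> integral\<^sup>L M g"
proof (rule tendstoI)
  interpret finite_measure M by fact
  fix e :: real assume "0 < e"
  obtain d where d: "0 < d" "d * measure M (space M) < e"
    using \<open>0 < e\<close> measure_nonneg by (rule small_factor)
  have "\<forall>\<^sub>F n in sequentially. \<forall>z\<in>UNIV. dist (t n z) (g z) < d"
    using lim d(1) by (auto simp: uniform_limit_iff)
  then show "\<forall>\<^sub>F n in sequentially. dist (integral\<^sup>L M (t n)) (integral\<^sup>L M g) < e"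
  proof eventually_elim
    case (elim n)
    note i = integrable_bounded_borel[OF t M, of n] integrable_bounded_borel[OF g M]
    have "\<bar>integral\<^sup>L M (t n) - integral\<^sup>L M g\<bar> = \<bar>integral\<^sup>L M (\<lambda>z. t n z - g z)\<bar>"
      using i by simp
    also have "\<dots> \<le> (\<integral>z. \<bar>t n z - g z\<bar> \<partial>M)"
      by (rule integral_abs_bound)
    also have "\<dots> \<le> (\<integral>z. d \<partial>M)"
      using i elim by (intro integral_mono) (auto simp: dist_real_def intro: less_imp_le)
    finally show ?case
      using d(2) by (simp add: dist_real_def mult.commute)
  qed
qed

context projection_valued_measure
begin

subsection \<open>The bounded calculus\<close>

text \<open>Uniform approximation suffices, because simple sums are bounded by the supremum norm.\<close>

definition floor_approx :: "('a \<Rightarrow> real) \<Rightarrow> nat \<Rightarrow> 'a \<Rightarrow> real" where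
  "floor_approx g n z = of_int \<lfloor>real (Suc n) * g z\<rfloor> / real (Suc n)"

definition sint :: "('a \<Rightarrow> real) \<Rightarrow> 'x \<Rightarrow> 'x" where
  "sint g x = lim (\<lambda>n. simple_sum (floor_approx g n) x)"

lemma floor_approx_dist: "\<bar>floor_approx g n z - g z\<bar> \<le> 1 / real (Suc n)"
proof -
  have "floor_approx g n z - g z = (of_int \<lfloor>real (Suc n) * g z\<rfloor> - real (Suc n) * g z) / real (Suc n)"
    by (simp add: floor_approx_def field_simps del: of_nat_Suc)
  also have "\<bar>\<dots>\<bar> \<le> 1 / real (Suc n)"
    unfolding abs_divide by (rule frac_le) (auto, linarith+)
  finally show ?thesis .
qed

lemma simple_floor_approx:
  assumes "bounded_borel g"
  shows "simple (floor_approx g n)"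
  unfolding simple_def
proof
  show "floor_approx g n \<in> borel_measurable borel"
    unfolding floor_approx_def using bounded_borelD[OF assms] by measurable
  obtain C where C: "\<And>z. norm (g z) \<le> C" using assms by (rule bounded_borelE) blast
  define N where "N = \<lceil>real (Suc n) * C\<rceil>"
  have "\<lfloor>real (Suc n) * g z\<rfloor> \<in> {-N - 1..N}" for z
  proof -
    have "\<bar>real (Suc n) * g z\<bar> \<le> real (Suc n) * C"
      unfolding abs_mult using C[of z] by (auto intro: mult_left_mono)
    then show ?thesis
      unfolding N_def by simp linarith
  qed
  then have "range (floor_approx g n) \<subseteq> (\<lambda>k. of_int k / real (Suc n)) ` {-N - 1..N}"
    unfolding floor_approx_def by blast
  then show "finite (range (floor_approx g n))"
    by (rule finite_subset) simp
qed

lemma uniform_limit_floor_approx: "uniform_limit UNIV (floor_approx g) g sequentially"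
  unfolding uniform_limit_iff
proof (intro allI impI)
  fix e :: real assume "0 < e"
  then have "\<forall>\<^sub>F n in sequentially. 1 / real (Suc n) < e"
    using LIMSEQ_inverse_real_of_nat by (auto simp: order_tendsto_iff inverse_eq_divide)
  then show "\<forall>\<^sub>F n in sequentially. \<forall>z\<in>UNIV. dist (floor_approx g n z) (g z) < e"
    by eventually_elim (auto simp: dist_real_def intro: le_less_trans[OF floor_approx_dist])
qed

lemma bounded_borel_simple: "simple s \<Longrightarrow> bounded_borel s"
  unfolding simple_def bounded_borel_def by (metis finite_imp_bounded bounded_iff rangeI)

lemma LIMSEQ_sint:
  assumes g: "bounded_borel g" and t: "\<And>n. simple (t n)" and lim: "uniform_limit UNIV t g sequentially"
  shows "(\<lambda>n. simple_sum (t n) x) \<longlonglongrightarrow> sint g x"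
proof -
  have close: "norm (simple_sum s x - simple_sum s' x) \<le> (d + d') * norm x"
    if "simple s" "simple s'" "\<And>z. \<bar>s z - g z\<bar> \<le> d" "\<And>z. \<bar>s' z - g z\<bar> \<le> d'" for s s' d d'
  proof -
    have "\<bar>s z - s' z\<bar> \<le> d + d'" for z
      using that(3)[of z] that(4)[of z] by linarith
    then show ?thesis
      using norm_simple_sum_le[OF simple_arith(2)[OF that(1,2)]] simple_sum_diff[OF that(1,2)] by simp
  qed
  have "Cauchy (\<lambda>n. simple_sum (floor_approx g n) x)"
  proof (rule metric_CauchyI)
    fix e :: real assume e: "0 < e"
    obtain d where "0 < d" "d * (2 * norm x) < e"
      using small_factor[OF e, of "2 * norm x"] by auto
    then have d: "0 < d" "(d + d) * norm x < e"
      by (auto simp: algebra_simps)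
    obtain N where N: "1 / real (Suc N) < d"
      using nat_approx_posE[OF d(1)] by auto
    have "\<bar>floor_approx g n z - g z\<bar> \<le> d" if "N \<le> n" for n z
    proof -
      have "1 / real (Suc n) \<le> 1 / real (Suc N)"
        using that by (auto intro!: divide_left_mono)
      then show ?thesis using floor_approx_dist[of g n z] N by linarith
    qed
    then have "norm (simple_sum (floor_approx g m) x - simple_sum (floor_approx g n) x) \<le> (d + d) * norm x"
      if "N \<le> m" "N \<le> n" for m n
      using that by (intro close simple_floor_approx g) auto
    then show "\<exists>M. \<forall>m\<ge>M. \<forall>n\<ge>M. dist (simple_sum (floor_approx g m) x) (simple_sum (floor_approx g n) x) < e"
      using d(2) by (intro exI[of _ N]) (auto simp: dist_norm simp del: mult_2 intro: le_less_trans)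
  qed
  then have lim1: "(\<lambda>n. simple_sum (floor_approx g n) x) \<longlonglongrightarrow> sint g x"
    unfolding sint_def by (simp add: Cauchy_convergent_iff convergent_LIMSEQ_iff)
  have "(\<lambda>n. simple_sum (t n) x - simple_sum (floor_approx g n) x) \<longlonglongrightarrow> 0"
  proof (rule tendstoI)
    fix e :: real assume e: "0 < e"
    obtain d where "0 < d" "d * (2 * norm x) < e"
      using small_factor[OF e, of "2 * norm x"] by auto
    then have d: "0 < d" "(d + d) * norm x < e"
      by (auto simp: algebra_simps)
    have "\<forall>\<^sub>F n in sequentially. \<forall>z\<in>UNIV. dist (t n z) (g z) < d"
      "\<forall>\<^sub>F n in sequentially. \<forall>z\<in>UNIV. dist (floor_approx g n z) (g z) < d"
      using lim uniform_limit_floor_approx[of g] d(1) by (auto simp: uniform_limit_iff)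
    then show "\<forall>\<^sub>F n in sequentially. dist (simple_sum (t n) x - simple_sum (floor_approx g n) x) 0 < e"
    proof eventually_elim
      case (elim n)
      have "norm (simple_sum (t n) x - simple_sum (floor_approx g n) x) \<le> (d + d) * norm x"
        using elim by (intro close t simple_floor_approx g) (auto simp: dist_real_def intro: less_imp_le)
      then show ?case using d(2) by simp
    qed
  qed
  from tendsto_add[OF this lim1] show ?thesis by simp
qed

lemmas LIMSEQ_sint_floor = LIMSEQ_sint[OF _ simple_floor_approx uniform_limit_floor_approx]

lemma sint_add:
  assumes "bounded_borel g" "bounded_borel h"
  shows "sint (\<lambda>z. g z + h z) x = sint g x + sint h x"
proof -
  have "(\<lambda>n. simple_sum (\<lambda>z. floor_approx g n z + floor_approx h n z) x) \<longlonglongrightarrow> sint (\<lambda>z. g z + h z) x"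
    by (intro LIMSEQ_sint bounded_borel_arith simple_arith simple_floor_approx uniform_limit_add
        uniform_limit_floor_approx assms)
  then have "(\<lambda>n. simple_sum (floor_approx g n) x + simple_sum (floor_approx h n) x) \<longlonglongrightarrow> sint (\<lambda>z. g z + h z) x"
    by (simp add: simple_sum_add simple_floor_approx assms)
  moreover have "(\<lambda>n. simple_sum (floor_approx g n) x + simple_sum (floor_approx h n) x) \<longlonglongrightarrow> sint g x + sint h x"
    by (intro tendsto_add LIMSEQ_sint_floor assms)
  ultimately show ?thesis
    by (rule LIMSEQ_unique)
qed

lemma sint_cmult:
  assumes "bounded_borel g"
  shows "sint (\<lambda>z. c * g z) x = c *\<^sub>R sint g x"
proof -
  have "(\<lambda>n. simple_sum (\<lambda>z. c * floor_approx g n z) x) \<longlonglongrightarrow> sint (\<lambda>z. c * g z) x"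
    by (intro LIMSEQ_sint bounded_borel_mult bounded_borel_const simple_arith simple_const simple_floor_approx
        bounded_linear_uniform_limit_intros uniform_limit_floor_approx assms)
  then have "(\<lambda>n. c *\<^sub>R simple_sum (floor_approx g n) x) \<longlonglongrightarrow> sint (\<lambda>z. c * g z) x"
    by (simp add: simple_sum_cmult simple_floor_approx assms)
  moreover have "(\<lambda>n. c *\<^sub>R simple_sum (floor_approx g n) x) \<longlonglongrightarrow> c *\<^sub>R sint g x"
    by (intro tendsto_intros LIMSEQ_sint_floor assms)
  ultimately show ?thesis
    by (rule LIMSEQ_unique)
qed

lemma sint_uminus: "bounded_borel g \<Longrightarrow> sint (\<lambda>z. - g z) x = - sint g x"
  using sint_cmult[of g "-1"] by simp

lemma sint_diff:
  assumes "bounded_borel g" "bounded_borel h"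
  shows "sint (\<lambda>z. g z - h z) x = sint g x - sint h x"
  using sint_add[OF assms(1) bounded_borel_uminus[OF assms(2)]] sint_uminus[OF assms(2)] by simp

lemma sint_simple: "simple s \<Longrightarrow> sint s x = simple_sum s x"
  using LIMSEQ_sint[of s "\<lambda>n. s" x] bounded_borel_simple[of s] uniform_limit_const
  by (auto intro: LIMSEQ_unique[of "\<lambda>n::nat. simple_sum s x"])

lemma sint_indicator: "\<delta> \<in> sets borel \<Longrightarrow> sint (indicator \<delta>) x = P \<delta> x"
  by (simp add: sint_simple simple_indicator simple_sum_indicator)

lemma sint_1: "sint (\<lambda>z. 1) x = x"
  using sint_indicator[of UNIV x] by (simp add: P_UNIV)

lemma linear_sint:
  assumes "bounded_borel g"
  shows "linear (sint g)"
proof (rule linearI)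
  note l = LIMSEQ_sint_floor[OF assms assms] and lin = linear_simple_sum[OF simple_floor_approx[OF assms]]
  show "sint g (x + y) = sint g x + sint g y" for x y
    using l[of "x + y"] tendsto_add[OF l[of x] l[of y]] LIMSEQ_unique by (force simp: linear_add[OF lin])
  show "sint g (r *\<^sub>R x) = r *\<^sub>R sint g x" for r x
    using l[of "r *\<^sub>R x"] tendsto_scaleR[OF tendsto_const l[of x], of r] LIMSEQ_unique
    by (force simp: linear_scale[OF lin])
qed

text \<open>Multiplicativity, in the form in which it passes from simple functions to uniform limits; together with
  the symmetry of the calculus it makes \<open>sint\<close> a homomorphism.\<close>

lemma inner_sint_sint:
  assumes "bounded_borel g" "bounded_borel h"
  shows "sint g x \<bullet> sint h y = sint (\<lambda>z. g z * h z) x \<bullet> y"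
proof -
  have "bounded (range g)" "bounded (range h)"
    using assms by (auto simp: bounded_borel_def bounded_iff)
  then have "uniform_limit UNIV (\<lambda>n z. floor_approx g n z * floor_approx h n z) (\<lambda>z. g z * h z) sequentially"
    by (intro uniform_lim_mult uniform_limit_floor_approx) auto
  then have "(\<lambda>n. simple_sum (\<lambda>z. floor_approx g n z * floor_approx h n z) x) \<longlonglongrightarrow> sint (\<lambda>z. g z * h z) x"
    by (intro LIMSEQ_sint bounded_borel_mult simple_arith simple_floor_approx assms)
  then have "(\<lambda>n. simple_sum (\<lambda>z. floor_approx g n z * floor_approx h n z) x \<bullet> y) \<longlonglongrightarrow> sint (\<lambda>z. g z * h z) x \<bullet> y"
    by (intro tendsto_intros)
  then have "(\<lambda>n. simple_sum (floor_approx g n) x \<bullet> simple_sum (floor_approx h n) y) \<longlonglongrightarrow> sint (\<lambda>z. g z * h z) x \<bullet> y"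
    by (simp add: inner_simple_sum_simple_sum simple_floor_approx assms)
  moreover have "(\<lambda>n. simple_sum (floor_approx g n) x \<bullet> simple_sum (floor_approx h n) y) \<longlonglongrightarrow> sint g x \<bullet> sint h y"
    by (intro tendsto_intros LIMSEQ_sint_floor assms)
  ultimately show ?thesis
    by (rule LIMSEQ_unique[symmetric])
qed

lemma inner_sint_commute:
  assumes "bounded_borel g"
  shows "sint g x \<bullet> y = x \<bullet> sint g y"
  using inner_sint_sint[OF assms bounded_borel_const[of 1], of x y]
    inner_sint_sint[OF bounded_borel_const[of 1] assms, of x y] by (simp add: sint_1)

lemma sint_sint:
  assumes "bounded_borel g" "bounded_borel h"
  shows "sint g (sint h x) = sint (\<lambda>z. g z * h z) x"
proof (rule vector_eq_rdot[THEN iffD1, rule_format])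
  fix y
  show "sint g (sint h x) \<bullet> y = sint (\<lambda>z. g z * h z) x \<bullet> y"
    using inner_sint_sint[OF assms(2,1), of x y] by (simp add: inner_sint_commute assms mult.commute)
qed

lemma sint_commute:
  assumes g: "bounded_borel g" and B: "bounded_linear B"
    and comm: "\<And>\<delta> x. \<delta> \<in> sets borel \<Longrightarrow> B (P \<delta> x) = P \<delta> (B x)"
  shows "B (sint g x) = sint g (B x)"
proof -
  interpret B: bounded_linear B by fact
  have "B (simple_sum s x) = simple_sum s (B x)" if "simple s" for s
    using that by (simp add: simple_sum_def B.sum B.scaleR comm borel_vimage_singleton simple_def)
  then have "(\<lambda>n. B (simple_sum (floor_approx g n) x)) \<longlonglongrightarrow> sint g (B x)"
    using LIMSEQ_sint_floor[OF g g, of "B x"] simple_floor_approx[OF g] by simp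
  moreover have "(\<lambda>n. B (simple_sum (floor_approx g n) x)) \<longlonglongrightarrow> B (sint g x)"
    by (rule B.tendsto[OF LIMSEQ_sint_floor[OF g g]])
  ultimately show ?thesis
    by (rule LIMSEQ_unique[symmetric])
qed

lemma inner_sint:
  assumes M: "finite_measure M" "sets M = sets borel" and N: "finite_measure N" "sets N = sets borel"
    and eq: "\<And>\<delta>. \<delta> \<in> sets borel \<Longrightarrow> P \<delta> x \<bullet> y = measure M \<delta> - measure N \<delta>"
    and g: "bounded_borel g"
  shows "sint g x \<bullet> y = integral\<^sup>L M g - integral\<^sup>L N g"
proof -
  have "(\<lambda>n. integral\<^sup>L M (floor_approx g n) - integral\<^sup>L N (floor_approx g n)) \<longlonglongrightarrow> integral\<^sup>L M g - integral\<^sup>L N g"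
    by (intro tendsto_diff LIMSEQ_integral_uniform M N bounded_borel_simple simple_floor_approx g
        uniform_limit_floor_approx)
  then have "(\<lambda>n. simple_sum (floor_approx g n) x \<bullet> y) \<longlonglongrightarrow> integral\<^sup>L M g - integral\<^sup>L N g"
    by (simp add: inner_simple_sum[OF M N eq simple_floor_approx[OF g]])
  moreover have "(\<lambda>n. simple_sum (floor_approx g n) x \<bullet> y) \<longlonglongrightarrow> sint g x \<bullet> y"
    by (intro tendsto_intros LIMSEQ_sint_floor g)
  ultimately show ?thesis
    by (rule LIMSEQ_unique[symmetric])
qed

lemma inner_sint_self:
  assumes "bounded_borel g"
  shows "sint g x \<bullet> x = integral\<^sup>L (qmeasure x) g"
proof -
  have "finite_measure (null_measure borel)"
    by (rule finite_measureI) simp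
  from inner_sint[OF finite_measure_qmeasure[of x] _ this _ _ assms, of x x] show ?thesis
    by (simp add: measure_qmeasure)
qed

lemma norm_sint: "bounded_borel g \<Longrightarrow> (norm (sint g x))\<^sup>2 = (\<integral>z. (g z)\<^sup>2 \<partial>qmeasure x)"
  unfolding power2_norm_eq_inner
  by (simp add: inner_sint_sint inner_sint_self bounded_borel_mult power2_eq_square)

lemma norm_sint_le:
  assumes g: "bounded_borel g" and C: "\<And>z. \<bar>g z\<bar> \<le> C"
  shows "norm (sint g x) \<le> C * norm x"
proof -
  interpret finite_measure "qmeasure x" by simp
  have "0 \<le> C" using C[of undefined] by linarith
  have "(norm (sint g x))\<^sup>2 \<le> (\<integral>z. C\<^sup>2 \<partial>qmeasure x)"
    unfolding norm_sint[OF g]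
  proof (rule integral_mono)
    show "integrable (qmeasure x) (\<lambda>z. (g z)\<^sup>2)"
      using integrable_bounded_borel[OF bounded_borel_mult[OF g g]] by (simp add: power2_eq_square)
    show "(g z)\<^sup>2 \<le> C\<^sup>2" for z
      using C[of z] by (simp add: abs_le_square_iff[symmetric])
  qed simp
  also have "\<dots> = (C * norm x)\<^sup>2"
    by (simp add: measure_qmeasure P_UNIV power_mult_distrib power2_norm_eq_inner)
  finally show ?thesis
    using \<open>0 \<le> C\<close> by (simp add: power2_le_iff_abs_le)
qed

lemma bounded_linear_sint:
  assumes "bounded_borel g"
  shows "bounded_linear (sint g)"
proof -
  obtain C where "\<And>z. norm (g z) \<le> C" using assms by (rule bounded_borelE) blast
  then show ?thesis
    using norm_sint_le[OF assms, of C] linear_sint[OF assms]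
    by (intro bounded_linear_intro[of _ C]) (auto simp: linear_add linear_scale mult.commute)
qed

text \<open>Dominated convergence in \<open>L\<^sup>2\<close> of the quadratic measure.\<close>

lemma LIMSEQ_sint_pointwise:
  assumes g: "\<And>n. bounded_borel (g n)" and h: "bounded_borel h"
    and C: "\<And>n z. \<bar>g n z\<bar> \<le> C" and lim: "\<And>z. (\<lambda>n. g n z) \<longlonglongrightarrow> h z"
  shows "(\<lambda>n. sint (g n) x) \<longlonglongrightarrow> sint h x"
proof -
  interpret finite_measure "qmeasure x" by simp
  obtain C' where C': "\<And>z. norm (h z) \<le> C'" using h by (rule bounded_borelE) blast
  have "(\<lambda>n. \<integral>z. (g n z - h z)\<^sup>2 \<partial>qmeasure x) \<longlonglongrightarrow> (\<integral>z. 0 \<partial>qmeasure x)"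
  proof (rule integral_dominated_convergence[where w = "\<lambda>z. (C + C')\<^sup>2"])
    show "AE z in qmeasure x. (\<lambda>n. (g n z - h z)\<^sup>2) \<longlonglongrightarrow> 0"
    proof (rule AE_I2)
      fix z
      have "(\<lambda>n. (g n z - h z)\<^sup>2) \<longlonglongrightarrow> (h z - h z)\<^sup>2"
        by (intro tendsto_intros lim)
      then show "(\<lambda>n. (g n z - h z)\<^sup>2) \<longlonglongrightarrow> 0" by simp
    qed
    have "\<bar>g n z - h z\<bar> \<le> \<bar>C + C'\<bar>" for n z
      using C[of n z] C'[of z] by simp
    then show "AE z in qmeasure x. norm ((g n z - h z)\<^sup>2) \<le> (C + C')\<^sup>2" for n
      by (simp add: abs_le_square_iff[symmetric])
  qed (use bounded_borelD[OF g] bounded_borelD[OF h] in auto)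
  then have "(\<lambda>n. (norm (sint (g n) x - sint h x))\<^sup>2) \<longlonglongrightarrow> 0"
    by (simp add: norm_sint bounded_borel_arith g h flip: sint_diff)
  then have "(\<lambda>n. sqrt ((norm (sint (g n) x - sint h x))\<^sup>2)) \<longlonglongrightarrow> sqrt 0"
    by (rule tendsto_real_sqrt)
  then show ?thesis
    by (simp add: tendsto_norm_zero_iff LIM_zero_iff)
qed

subsection \<open>The real-valued measures \<open>P \<delta> a \<bullet> b\<close>\<close>

lemma variation_P:
  obtains Y where "Y \<in> sets borel" "finite_measure (upper_variation (\<lambda>\<delta>. P \<delta> a \<bullet> b))"
    "finite_measure (lower_variation (\<lambda>\<delta>. P \<delta> a \<bullet> b))"
    "\<And>A. A \<in> sets borel \<Longrightarrow> measure (upper_variation (\<lambda>\<delta>. P \<delta> a \<bullet> b)) A = P (A \<inter> Y) a \<bullet> b"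
    "\<And>A. A \<in> sets borel \<Longrightarrow> P A a \<bullet> b = measure (upper_variation (\<lambda>\<delta>. P \<delta> a \<bullet> b)) A -
      measure (lower_variation (\<lambda>\<delta>. P \<delta> a \<bullet> b)) A"
proof -
  define Q where "Q x = scale_measure (ennreal (1/4)) (qmeasure x)" for x
  have Q: "finite_measure (Q x)" "sets (Q x) = sets borel" for x
    by (auto simp: Q_def emeasure_qmeasure space_scale_measure ennreal_mult[symmetric] inner_P_self intro!: finite_measureI)
  have polar: "P \<delta> a \<bullet> b = measure (Q (a + b)) \<delta> - measure (Q (a - b)) \<delta>" if \<delta>: "\<delta> \<in> sets borel" for \<delta>
  proof -
    have "P \<delta> (a + b) \<bullet> (a + b) - P \<delta> (a - b) \<bullet> (a - b) = 4 * (P \<delta> a \<bullet> b)"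
      using symmetric_P[OF \<delta>, of a b] linear_add[OF linear_P[OF \<delta>]] linear_diff[OF linear_P[OF \<delta>]]
      by (simp add: inner_add_left inner_add_right inner_diff_left inner_diff_right inner_commute)
    then show ?thesis
      using \<delta> by (simp add: Q_def measure_def emeasure_qmeasure inner_P_self flip: ennreal_mult)
  qed
  show thesis
    using variation_of_difference[where \<mu> = "\<lambda>\<delta>. P \<delta> a \<bullet> b", OF Q(1) Q(1) Q(2) Q(2) polar] that
    by metis
qed

lemma real_integral_bounded:
  assumes g: "bounded_borel g"
  shows "real_integrable (\<lambda>\<delta>. P \<delta> a \<bullet> b) g" "real_integral (\<lambda>\<delta>. P \<delta> a \<bullet> b) g = sint g a \<bullet> b"
proof -
  obtain Y where Y: "finite_measure (upper_variation (\<lambda>\<delta>. P \<delta> a \<bullet> b))"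
    "finite_measure (lower_variation (\<lambda>\<delta>. P \<delta> a \<bullet> b))"
    "\<And>A. A \<in> sets borel \<Longrightarrow> P A a \<bullet> b = measure (upper_variation (\<lambda>\<delta>. P \<delta> a \<bullet> b)) A -
      measure (lower_variation (\<lambda>\<delta>. P \<delta> a \<bullet> b)) A"
    by (rule variation_P[of a b]) blast
  show "real_integrable (\<lambda>\<delta>. P \<delta> a \<bullet> b) g"
    unfolding real_integrable_def using integrable_bounded_borel[OF g] Y by simp
  show "real_integral (\<lambda>\<delta>. P \<delta> a \<bullet> b) g = sint g a \<bullet> b"
    unfolding real_integral_def by (rule inner_sint[OF Y(1) _ Y(2) _ Y(3) g, symmetric]) simp_all
qed

text \<open>The total variation of \<open>P \<delta> a \<bullet> b\<close> need not be dominated by the quadratic measure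
  of \<open>a\<close>; but integrating \<open>h\<close> against the upper variation means applying the bounded
  calculus to \<open>P Y a\<close> for a Hahn set \<open>Y\<close>, so that the Cauchy--Schwarz inequality bounds
  the integral by \<open>\<parallel>h\<parallel> \<parallel>b\<parallel>\<close> with the \<open>L\<^sup>2\<close> norm of the quadratic measure.\<close>

lemma integrable_upper_variation:
  assumes g: "g \<in> borel_measurable borel" and fin: "(\<integral>\<^sup>+z. ennreal ((g z)\<^sup>2) \<partial>qmeasure a) < \<infinity>"
  shows "integrable (upper_variation (\<lambda>\<delta>. P \<delta> a \<bullet> b)) g"
proof -
  define U where "U = upper_variation (\<lambda>\<delta>. P \<delta> a \<bullet> b)"
  obtain Y where Y: "Y \<in> sets borel" "finite_measure U"
    "\<And>A. A \<in> sets borel \<Longrightarrow> measure U A = P (A \<inter> Y) a \<bullet> b"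
    unfolding U_def by (rule variation_P[of a b]) blast
  have sets_U [measurable_cong, simp]: "sets U = sets borel" by (simp add: U_def)
  define K where "K = sqrt (enn2real (\<integral>\<^sup>+z. ennreal ((g z)\<^sup>2) \<partial>qmeasure a))"
  define h where "h n z = min \<bar>g z\<bar> (real n)" for n z
  have h: "bounded_borel (h n)" for n
    by (rule bounded_borelI[of _ "real n"]) (use g in \<open>auto simp: h_def[abs_def]\<close>)
  have norm_h: "norm (sint (h n) a) \<le> K" for n
  proof -
    have i: "integrable (qmeasure a) (\<lambda>z. (h n z)\<^sup>2)"
      using integrable_bounded_borel[OF bounded_borel_mult[OF h h]] by (simp add: power2_eq_square)
    have "ennreal ((norm (sint (h n) a))\<^sup>2) = (\<integral>\<^sup>+z. ennreal ((h n z)\<^sup>2) \<partial>qmeasure a)"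
      unfolding norm_sint[OF h] by (rule nn_integral_eq_integral[OF i, symmetric]) simp
    also have "\<dots> \<le> (\<integral>\<^sup>+z. ennreal ((g z)\<^sup>2) \<partial>qmeasure a)"
      by (intro nn_integral_mono ennreal_leI) (auto simp: h_def abs_le_square_iff[symmetric])
    finally have "(norm (sint (h n) a))\<^sup>2 \<le> enn2real (\<integral>\<^sup>+z. ennreal ((g z)\<^sup>2) \<partial>qmeasure a)"
      using fin by (metis enn2real_ennreal enn2real_mono infinity_ennreal_def zero_le_power2)
    then show ?thesis
      unfolding K_def by (rule real_le_rsqrt)
  qed
  have bound: "(\<integral>\<^sup>+z. ennreal (h n z) \<partial>U) \<le> ennreal (K * norm b)" for n
  proof -
    have null: "finite_measure (null_measure borel)" by (rule finite_measureI) simp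
    have "sint (h n) (P Y a) \<bullet> b = integral\<^sup>L U (h n) - integral\<^sup>L (null_measure borel) (h n)"
      by (rule inner_sint[OF Y(2) _ null _ _ h]) (simp_all add: Y P_P)
    then have "integral\<^sup>L U (h n) = sint (h n) (P Y a) \<bullet> b" by simp
    also have "\<dots> \<le> norm (sint (h n) (P Y a)) * norm b"
      by (rule norm_cauchy_schwarz)
    also have "sint (h n) (P Y a) = sint (indicator Y) (sint (h n) a)"
      using Y(1) by (simp add: sint_sint h bounded_borel_indicator mult.commute flip: sint_indicator)
    also have "norm (sint (indicator Y) (sint (h n) a)) * norm b \<le> K * norm b"
      using norm_sint_le[OF bounded_borel_indicator[OF Y(1)], of 1 "sint (h n) a"] norm_h[of n]
      by (intro mult_right_mono) (auto simp: indicator_def)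
    finally have "integral\<^sup>L U (h n) \<le> K * norm b" .
    moreover have "(\<integral>\<^sup>+z. ennreal (h n z) \<partial>U) = ennreal (integral\<^sup>L U (h n))"
      by (rule nn_integral_eq_integral[OF integrable_bounded_borel[OF h Y(2)]]) (auto simp: h_def)
    ultimately show ?thesis by (simp add: ennreal_leI)
  qed
  have "(\<lambda>n. \<integral>\<^sup>+z. ennreal (h n z) \<partial>U) \<longlonglongrightarrow> (\<integral>\<^sup>+z. ennreal \<bar>g z\<bar> \<partial>U)"
  proof (rule nn_integral_LIMSEQ)
    show "incseq (\<lambda>n z. ennreal (h n z))"
      by (auto simp: incseq_def le_fun_def h_def intro!: ennreal_leI)
    show "(\<lambda>z. ennreal (h n z)) \<in> borel_measurable U" for n
      using g by (simp add: h_def)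
    show "(\<lambda>n. ennreal (h n z)) \<longlonglongrightarrow> ennreal \<bar>g z\<bar>" for z
    proof (rule tendsto_eventually)
      show "\<forall>\<^sub>F n in sequentially. ennreal (h n z) = ennreal \<bar>g z\<bar>"
        using eventually_ge_at_top[of "nat \<lceil>\<bar>g z\<bar>\<rceil>"] by eventually_elim (simp add: h_def min_def)
    qed
  qed
  then have "(\<integral>\<^sup>+z. ennreal \<bar>g z\<bar> \<partial>U) \<le> ennreal (K * norm b)"
    by (rule LIMSEQ_le_const2) (use bound in auto)
  then show ?thesis
    using g unfolding U_def[symmetric] by (intro integrableI_bounded) (auto intro: le_less_trans)
qed

lemma real_integrable_L2:
  assumes "g \<in> borel_measurable borel" "(\<integral>\<^sup>+z. ennreal ((g z)\<^sup>2) \<partial>qmeasure a) < \<infinity>"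
  shows "real_integrable (\<lambda>\<delta>. P \<delta> a \<bullet> b) g"
  unfolding real_integrable_def lower_variation_def
  using integrable_upper_variation[OF assms, of b] integrable_upper_variation[OF assms, of "- b"] by simp

lemma LIMSEQ_real_integral:
  assumes g: "g \<in> borel_measurable borel" and fin: "(\<integral>\<^sup>+z. ennreal ((g z)\<^sup>2) \<partial>qmeasure a) < \<infinity>"
    and h: "\<And>n. h n \<in> borel_measurable borel" "\<And>n z. \<bar>h n z\<bar> \<le> \<bar>g z\<bar>" "\<And>z. (\<lambda>n. h n z) \<longlonglongrightarrow> g z"
  shows "(\<lambda>n. real_integral (\<lambda>\<delta>. P \<delta> a \<bullet> b) (h n)) \<longlonglongrightarrow> real_integral (\<lambda>\<delta>. P \<delta> a \<bullet> b) g"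
  using real_integrable_L2[OF g fin, of b] unfolding real_integral_def real_integrable_def
  by (intro tendsto_diff integral_dominated_convergence[where w = "\<lambda>z. \<bar>g z\<bar>"]) (use g h in auto)

end

section \<open>The structure of the Hilbert space\<close>

lemma hreal_1 [simp]: "hreal 1 = (1 :: 'k::hypercomplex)"
  by (simp add: hreal_def)

lemma range_hreal_iff: "z \<in> range hreal \<longleftrightarrow> z = (z \<bullet> 1) *\<^sub>R (1 :: 'k::hypercomplex)"
  by (auto simp: hreal_def inner_1_1)

lemma hmult_self: "a * a = (2 * (a \<bullet> 1)) *\<^sub>R a - (norm a)\<^sup>2 *\<^sub>R (1 :: 'k::hypercomplex)"
  using hmult_hconj[of a] by (simp add: hconj_eq hmult_diff_right hmult_scaleR_right hmult_1_right algebra_simps)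

lemma norm_hgen: "p < DIM('k) \<Longrightarrow> norm (hgen p :: 'k::hypercomplex) = 1"
  by (simp add: norm_eq_sqrt_inner inner_hgen)

context K_hilbert_space
begin

lemma rmul_1 [simp]: "rmul V x 1 = x"
  using rmul_hreal[of x 1] by simp

lemma lmul_1 [simp]: "lmul V 1 x = x"
  using lmul_hreal[of 1 x] by simp

lemma lmul_lmul_self: "lmul V b (lmul V b x) = lmul V (b * b) x"
  using dim_hypercomplex[where 'a='k] lmul_H lmul_O by metis

lemma rmul_rmul_self: "rmul V (rmul V x b) b = rmul V x (b * b)"
  using dim_hypercomplex[where 'a='k] rmul_H rmul_O by metis

lemma ip_rmul_self: "ip V (rmul V x a) x = (norm x)\<^sup>2 *\<^sub>R hconj a"
proof (cases "DIM('k) = 4")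
  case True
  then show ?thesis
    using ip_H[OF True, of x a x 1] by (simp add: ip_self hreal_def hmult_1_right hmult_scaleR_right)
next
  case False
  then show ?thesis
    using ip_O[of x a] dim_hypercomplex[where 'a='k] by (simp add: ip_self hreal_def hmult_1_right hmult_scaleR_right)
qed

lemma linear_ip_left: "linear (\<lambda>x. ip V x y)" and linear_ip_right: "linear (ip V x)"
  by (auto intro!: linearI simp: ip_add_left ip_add_right ip_scaleR_left ip_scaleR_right)

lemma Re_ip: "ip V x y \<bullet> 1 = x \<bullet> y"
proof -
  have "ip V x y + ip V y x = ip V (x + y) (x + y) - ip V x x - ip V y y"
    by (simp add: ip_add_left ip_add_right)
  also have "\<dots> = (2 * (x \<bullet> y)) *\<^sub>R 1"
    by (simp add: ip_self hreal_def power2_norm_eq_inner inner_add_left inner_add_right inner_commute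
        flip: scaleR_diff_left)
  finally have "(ip V x y + hconj (ip V x y)) \<bullet> 1 = 2 * (x \<bullet> y)"
    by (simp only: ip_hconj[of y x]) (simp add: inner_1_1)
  then show ?thesis
    by (simp add: inner_add_left inner_hconj hconj_1)
qed

lemma ip_rmul_polar: "ip V (rmul V x a) y + ip V (rmul V y a) x = (2 * (x \<bullet> y)) *\<^sub>R hconj a"
proof -
  have "ip V (rmul V (x + y) a) (x + y) = (norm (x + y))\<^sup>2 *\<^sub>R hconj a"
    by (rule ip_rmul_self)
  then show ?thesis
    by (simp add: rmul_add ip_add_left ip_add_right ip_rmul_self power2_norm_eq_inner inner_add_left
        inner_add_right inner_commute scaleR_add_left algebra_simps)
qed

lemma inner_rmul_polar: "rmul V x a \<bullet> y + rmul V y a \<bullet> x = 2 * (a \<bullet> 1) * (x \<bullet> y)"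
  using arg_cong[OF ip_rmul_polar[of x a y], of "\<lambda>z. z \<bullet> 1"]
  by (simp add: inner_add_left Re_ip inner_hconj hconj_1)

text \<open>The axioms make the multiplications only additive in the vector. Homogeneity follows from the polarized
  real part of \<open>\<langle>x a; x\<rangle>\<close>, in which all other terms are homogeneous.\<close>

lemma rmul_scaleR_left: "rmul V (r *\<^sub>R x) a = r *\<^sub>R rmul V x a"
proof (rule vector_eq_rdot[THEN iffD1, rule_format])
  fix y
  have "rmul V (r *\<^sub>R x) a \<bullet> y = r * (rmul V x a \<bullet> y)"
    using inner_rmul_polar[of "r *\<^sub>R x" a y] arg_cong[OF inner_rmul_polar[of x a y], of "\<lambda>t. r * t"]
    by (simp add: algebra_simps)
  then show "rmul V (r *\<^sub>R x) a \<bullet> y = (r *\<^sub>R rmul V x a) \<bullet> y" by simp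
qed

lemma rmul_polar: "rmul V (rmul V x a) b + rmul V (rmul V x b) a = rmul V x (a * b + b * a)"
proof -
  have "rmul V (rmul V x (a + b)) (a + b) = rmul V x ((a + b) * (a + b))"
    by (rule rmul_rmul_self)
  then show ?thesis
    by (simp add: add_rmul rmul_add rmul_rmul_self hmult_add_left hmult_add_right algebra_simps)
qed

lemma double_eq: "x + x = y + y \<Longrightarrow> x = (y :: 'x)"
  by (metis scaleR_2 scaleR_left_imp_eq zero_neq_numeral)

lemma rmul_scaleR_right: "rmul V x (r *\<^sub>R a) = r *\<^sub>R rmul V x a"
proof -
  have "rmul V (rmul V x a) (hreal r) + rmul V (rmul V x (hreal r)) a = rmul V x (a * hreal r + hreal r * a)"
    by (rule rmul_polar)
  then have "rmul V x (r *\<^sub>R a) + rmul V x (r *\<^sub>R a) = r *\<^sub>R rmul V x a + r *\<^sub>R rmul V x a"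
    by (simp add: rmul_hreal rmul_scaleR_left) (simp add: hreal_def hmult_scaleR_left hmult_scaleR_right hmult_1_left
        hmult_1_right add_rmul)
  then show ?thesis by (rule double_eq)
qed

lemma linear_rmul: "linear (\<lambda>x. rmul V x a)" and linear_rmul_scalar: "linear (rmul V x)"
  by (auto intro!: linearI simp: rmul_add add_rmul rmul_scaleR_left rmul_scaleR_right)

lemma inner_rmul_adjoint: "rmul V x a \<bullet> y = x \<bullet> rmul V y (hconj a)"
  using inner_rmul_polar[of x a y]
  by (simp add: hconj_eq linear_diff[OF linear_rmul_scalar] rmul_scaleR_right inner_diff_right inner_commute)

lemma inner_rmul_same: "rmul V x a \<bullet> rmul V y a = (norm a)\<^sup>2 * (x \<bullet> y)"
proof -
  have "rmul V (rmul V y a) (hconj a) = (norm a)\<^sup>2 *\<^sub>R y"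
    by (simp add: hconj_eq linear_diff[OF linear_rmul_scalar] rmul_scaleR_right rmul_rmul_self hmult_self)
  then show ?thesis
    by (simp add: inner_rmul_adjoint)
qed

lemma norm_rmul: "norm (rmul V x a) = norm a * norm x"
  using inner_rmul_same[of x a x] by (simp add: norm_eq_sqrt_inner real_sqrt_mult)

lemma bounded_linear_rmul: "bounded_linear (\<lambda>x. rmul V x a)"
  by (rule bounded_linear_intro[of _ "norm a"])
    (auto simp: rmul_add rmul_scaleR_left norm_rmul mult.commute)

lemma decomposition_obtain:
  obtains u where "\<And>p. p < DIM('k) \<Longrightarrow> u p \<in> part V p" "x = (\<Sum>p<DIM('k). rmul V (u p) (hgen p))"
  using decomposition[of x] by blast

lemma ip_part_eq:
  assumes "p < DIM('k)" "q < DIM('k)" "u \<in> part V p" "v \<in> part V q"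
  shows "ip V u v = (u \<bullet> v) *\<^sub>R 1"
    "ip V (rmul V u (hgen p)) (rmul V v (hgen q)) = (u \<bullet> v) *\<^sub>R (hconj (hgen p) * hgen q)"
proof -
  show *: "ip V u v = (u \<bullet> v) *\<^sub>R 1"
    using ip_part_real[OF assms] by (simp add: range_hreal_iff Re_ip)
  show "ip V (rmul V u (hgen p)) (rmul V v (hgen q)) = (u \<bullet> v) *\<^sub>R (hconj (hgen p) * hgen q)"
    by (simp add: ip_part[OF assms] * hmult_scaleR_left hmult_1_left)
qed

lemma DIM_pos: "0 < DIM('k)"
  by simp

lemma ip_part_0:
  assumes "v \<in> part V 0" "\<And>p. p < DIM('k) \<Longrightarrow> u p \<in> part V p"
  shows "ip V v (\<Sum>p<DIM('k). rmul V (u p) (hgen p)) = (\<Sum>p<DIM('k). (v \<bullet> u p) *\<^sub>R hgen p)"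
proof -
  have "ip V v (rmul V (u p) (hgen p)) = (v \<bullet> u p) *\<^sub>R hgen p" if "p < DIM('k)" for p
    using ip_part_eq(2)[OF DIM_pos that assms(1) assms(2)[OF that]] by (simp add: hgen_0 hconj_1 hmult_1_left)
  then show ?thesis
    by (simp add: linear_sum[OF linear_ip_right])
qed

lemma inner_sum_hgen: "q < DIM('k) \<Longrightarrow> (\<Sum>p<DIM('k). c p *\<^sub>R hgen p) \<bullet> (hgen q :: 'k) = c q"
proof -
  assume q: "q < DIM('k)"
  have "(\<Sum>p<DIM('k). c p *\<^sub>R hgen p) \<bullet> (hgen q :: 'k) = (\<Sum>p<DIM('k). if p = q then c q else 0)"
    unfolding inner_sum_left by (intro sum.cong) (use q in \<open>auto simp: inner_hgen\<close>)
  then show ?thesis using q by simp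
qed

lemma norm_component_le:
  assumes "\<And>p. p < DIM('k) \<Longrightarrow> u p \<in> part V p" "q < DIM('k)"
  shows "norm (u q) \<le> norm (\<Sum>p<DIM('k). rmul V (u p) (hgen p))"
proof -
  have orth: "rmul V (u p) (hgen p) \<bullet> rmul V (u r) (hgen r) = (if r = p then (norm (u p))\<^sup>2 else 0)"
    if "p < DIM('k)" "r < DIM('k)" for p r
    using arg_cong[OF ip_part_eq(2)[OF that assms(1)[OF that(1)] assms(1)[OF that(2)]], of "\<lambda>z. z \<bullet> 1"] that
    by (simp add: Re_ip hmult_adjoint_left hmult_1_right inner_hgen power2_norm_eq_inner)
  have "(norm (\<Sum>p<DIM('k). rmul V (u p) (hgen p)))\<^sup>2 = (\<Sum>p<DIM('k). (norm (u p))\<^sup>2)"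
    unfolding power2_norm_eq_inner[of "sum _ _"] by (simp add: inner_sum_left inner_sum_right orth)
  moreover have "(norm (u q))\<^sup>2 \<le> (\<Sum>p<DIM('k). (norm (u p))\<^sup>2)"
    using assms(2) by (intro member_le_sum) auto
  ultimately have "(norm (u q))\<^sup>2 \<le> (norm (\<Sum>p<DIM('k). rmul V (u p) (hgen p)))\<^sup>2"
    by linarith
  then show ?thesis
    by (rule power2_le_imp_le) simp
qed

lemma eq_of_inner_norm:
  fixes x w :: 'x
  assumes "x \<bullet> w = (norm x)\<^sup>2" "norm w \<le> norm x"
  shows "w = x"
proof -
  have "(norm (w - x))\<^sup>2 = (norm w)\<^sup>2 - (norm x)\<^sup>2"
    using assms(1) unfolding power2_norm_eq_inner by (simp add: inner_diff_left inner_diff_right inner_commute)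
  also have "\<dots> \<le> 0"
    using assms(2) by (simp add: power_mono)
  finally show ?thesis by simp
qed

text \<open>The component of \<open>x i\<^sub>p\<close> along \<open>X\<^sub>p\<close> has the inner product \<open>\<parallel>x\<parallel>\<^sup>2\<close> with
  \<open>x\<close> and at most the norm of \<open>x\<close>: by the case of equality of the Cauchy--Schwarz
  inequality it is \<open>x\<close> itself.\<close>

lemma part_0_subset:
  assumes x: "x \<in> part V 0" and p: "p < DIM('k)"
  shows "x \<in> part V p"
proof -
  obtain w where w: "\<And>q. q < DIM('k) \<Longrightarrow> w q \<in> part V q"
    "rmul V x (hgen p) = (\<Sum>q<DIM('k). rmul V (w q) (hgen q))"
    using decomposition_obtain[of "rmul V x (hgen p)"] by blast
  have "ip V x (rmul V x (hgen p)) = (norm x)\<^sup>2 *\<^sub>R hgen p"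
    using ip_rmul_self[of x "hgen p"] ip_hconj[of x "rmul V x (hgen p)"] by (simp add: hconj_scaleR)
  then have "((norm x)\<^sup>2 *\<^sub>R hgen p) \<bullet> (hgen p :: 'k) = (\<Sum>q<DIM('k). (x \<bullet> w q) *\<^sub>R hgen q) \<bullet> (hgen p :: 'k)"
    using ip_part_0[OF x w(1)] w(2) by simp
  then have "x \<bullet> w p = (norm x)\<^sup>2"
    using p by (simp only: inner_sum_hgen) (simp add: inner_hgen)
  moreover have "norm (w p) \<le> norm x"
    using norm_component_le[OF w(1) p] w(2) norm_rmul[of x "hgen p"] norm_hgen[OF p] by simp
  ultimately have "w p = x"
    by (rule eq_of_inner_norm)
  then show ?thesis
    using w(1)[OF p] by simp
qed

end

locale spectral_hilbert_space = K_hilbert_space V + decomposition_of_unity V T E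
  for V :: "('k::hypercomplex, 'x::{real_inner, complete_space}) kspace"
    and T :: "'x \<rightharpoonup> 'x"
    and E :: "'k set \<Rightarrow> 'k \<Rightarrow> 'x \<Rightarrow> 'x"
begin

lemma part_0_subset_assoc: "part V 0 \<subseteq> assoc_part V"
  by (simp add: assoc_part_def)

lemma E_UNIV: "E UNIV S x = lmul V S x"
  using scalar_action[of UNIV S x] unity by simp

lemma bounded_linear_lmul: "bounded_linear (lmul V a)"
proof -
  have "lmul V a = E UNIV a" by (simp add: E_UNIV fun_eq_iff)
  then show ?thesis using bounded[of UNIV a] by simp
qed

text \<open>If \<open>w\<close> were orthogonal to the associative part, then \<open>0\<close> and \<open>w\<close> would have the
  same adjoint values under the identity, which is its own adjoint.\<close>

lemma ip_assoc_part_eq_0: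
  assumes "\<And>x. x \<in> assoc_part V \<Longrightarrow> ip V x w = 0"
  shows "w = 0"
proof -
  have id: "(\<lambda>x. Some (E UNIV 1 x)) = (\<lambda>x. Some x)"
    by (simp add: E_UNIV)
  have "adjoint_op V (\<lambda>x. Some x) y = Some y" for y
    using selfadjoint_E[of UNIV] unfolding selfadjoint_def id by (simp add: fun_eq_iff)
  then have THE_eq: "(THE v. adjoint_value V (\<lambda>x. Some x) y v) = y" for y
    unfolding adjoint_op_def by (metis option.distinct(1) option.inject)
  have "adjoint_value V (\<lambda>x. Some x) w = adjoint_value V (\<lambda>x. Some x) 0"
    using assms linear_0[OF linear_ip_right] by (auto simp: adjoint_value_def fun_eq_iff)
  then show ?thesis
    using THE_eq[of w] THE_eq[of 0] by simp
qed

text \<open>Over the quaternions the argument of \<open>part_0_subset\<close> applies to every \<open>X\<^sub>q\<close>, since scalars may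
  be moved out of the inner product. Over the octonions the component in \<open>X\<^sub>0\<close> is split off; the rest lies
  in \<open>X\<^sub>q\<close>, has real inner products with \<open>X\<^sub>0\<close>, and is orthogonal to \<open>X\<^sub>0\<close>.\<close>

lemma part_subset_part_0:
  assumes y: "y \<in> part V q" and q: "q < DIM('k)"
  shows "y \<in> part V 0"
proof -
  obtain u where u: "\<And>p. p < DIM('k) \<Longrightarrow> u p \<in> part V p"
    "y = (\<Sum>p<DIM('k). rmul V (u p) (hgen p))"
    using decomposition_obtain[of y] by blast
  have u0: "u 0 \<in> part V 0" using u(1) by simp
  have "y = u 0"
  proof (cases "DIM('k) = 4")
    case True
    have "ip V y (rmul V (u p) (hgen p)) = (y \<bullet> u p) *\<^sub>R hgen p" if "p < DIM('k)" for p
      using ip_H[OF True, of y 1 "u p" "hgen p"] ip_part_eq(1)[OF q that y u(1)[OF that]]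
      by (simp add: hconj_1 hmult_1_left hmult_scaleR_left)
    then have "ip V y y = (\<Sum>p<DIM('k). (y \<bullet> u p) *\<^sub>R hgen p)"
      by (subst u(2)) (simp add: linear_sum[OF linear_ip_right])
    then have "ip V y y \<bullet> hgen 0 = y \<bullet> u 0"
      by (simp add: inner_sum_hgen)
    then have "y \<bullet> u 0 = (norm y)\<^sup>2"
      by (simp add: hgen_0 Re_ip power2_norm_eq_inner)
    moreover have "norm (u 0) \<le> norm y"
      using norm_component_le[OF u(1) DIM_pos] u(2) by simp
    ultimately show ?thesis
      using eq_of_inner_norm[of y "u 0"] by simp
  next
    case False
    have z: "y - u 0 \<in> part V q"
      using subspace_part[OF q] y part_0_subset[OF u0 q] by (rule subspace_diff)
    have "y - u 0 = 0"
    proof (rule ip_assoc_part_eq_0)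
      fix x assume "x \<in> assoc_part V"
      then have x: "x \<in> part V 0" using False by (simp add: assoc_part_def)
      have "ip V x y \<bullet> hgen 0 = x \<bullet> u 0"
        using ip_part_0[OF x u(1)] u(2) by (simp add: inner_sum_hgen)
      then have "x \<bullet> (y - u 0) = 0"
        by (simp add: hgen_0 Re_ip inner_diff_right)
      then show "ip V x (y - u 0) = 0"
        using ip_part_eq(1)[OF DIM_pos q x z] by simp
    qed
    then show ?thesis by simp
  qed
  then show ?thesis using u0 by simp
qed

lemma part_0_decomposition:
  obtains u where "\<And>p. p < DIM('k) \<Longrightarrow> u p \<in> part V 0" "x = (\<Sum>p<DIM('k). rmul V (u p) (hgen p))"
  using decomposition_obtain[of x] part_subset_part_0 by metis

lemma linear_eq_on_part_0:
  assumes "linear F" "linear G" "\<And>w p. w \<in> part V 0 \<Longrightarrow> p < DIM('k) \<Longrightarrow> F (rmul V w (hgen p)) = G (rmul V w (hgen p))"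
  shows "F x = (G x :: 'b::real_vector)"
proof -
  obtain u where u: "\<And>p. p < DIM('k) \<Longrightarrow> u p \<in> part V 0" "x = (\<Sum>p<DIM('k). rmul V (u p) (hgen p))"
    using part_0_decomposition[of "x"] by blast
  then show ?thesis
    by (simp add: linear_sum[OF assms(1)] linear_sum[OF assms(2)] assms(3))
qed

lemma linear_scalar_eq:
  assumes "linear (F :: 'k \<Rightarrow> 'b::real_vector)" "linear G" "\<And>p. p < DIM('k) \<Longrightarrow> F (hgen p) = G (hgen p)"
  shows "F a = G a"
proof -
  have "F (\<Sum>p<DIM('k). (a \<bullet> hgen p) *\<^sub>R hgen p) = G (\<Sum>p<DIM('k). (a \<bullet> hgen p) *\<^sub>R hgen p)"
    by (simp add: linear_sum[OF assms(1)] linear_sum[OF assms(2)] linear_scale[OF assms(1)]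
        linear_scale[OF assms(2)] assms(3))
  then show ?thesis by (simp only: hgen_expansion)
qed

lemma linear_lmul: "linear (lmul V a)"
  using bounded_linear_lmul by (rule bounded_linear.linear)

lemma lmul_scaleR_left: "lmul V (r *\<^sub>R a) x = r *\<^sub>R lmul V a x"
proof -
  have "lmul V (a + hreal r) (lmul V (a + hreal r) x) =
    lmul V (a * a) x + (r *\<^sub>R lmul V a x + r *\<^sub>R lmul V a x) + (r * r) *\<^sub>R x"
    by (simp add: add_lmul lmul_add lmul_lmul_self[of a] lmul_hreal linear_scale[OF linear_lmul] scaleR_add_right)
  moreover have "(a + hreal r) * (a + hreal r) = a * a + (r *\<^sub>R a + r *\<^sub>R a) + hreal (r * r)"
    by (simp add: hreal_def hmult_add_left hmult_add_right hmult_scaleR_left hmult_scaleR_right hmult_1_left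
        hmult_1_right scaleR_add_right)
  ultimately have "lmul V (r *\<^sub>R a) x + lmul V (r *\<^sub>R a) x = r *\<^sub>R lmul V a x + r *\<^sub>R lmul V a x"
    using lmul_lmul_self[of "a + hreal r" x] by (simp add: add_lmul lmul_hreal)
  then show ?thesis by (rule double_eq)
qed

lemma linear_lmul_scalar: "linear (\<lambda>a. lmul V a x)"
  by (auto intro!: linearI simp: add_lmul lmul_scaleR_left)

lemma lmul_eq_rmul: "w \<in> part V 0 \<Longrightarrow> lmul V a w = rmul V w a"
  using part_commute[OF DIM_pos] by simp

lemma linear_hmult: "linear (\<lambda>a. a * (b::'k))" "linear ((*) (b::'k))"
  by (auto intro!: linearI simp: hmult_add_left hmult_add_right hmult_scaleR_left hmult_scaleR_right)

lemma ip_rmul_rmul: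
  assumes u: "u \<in> part V 0" and v: "v \<in> part V 0"
  shows "ip V (rmul V u a) (rmul V v b) = (u \<bullet> v) *\<^sub>R (hconj a * b)"
proof (rule linear_scalar_eq[where a = a])
  fix p assume p: "p < DIM('k)"
  show "ip V (rmul V u (hgen p)) (rmul V v b) = (u \<bullet> v) *\<^sub>R (hconj (hgen p) * b)"
  proof (rule linear_scalar_eq[where a = b])
    fix q assume q: "q < DIM('k)"
    show "ip V (rmul V u (hgen p)) (rmul V v (hgen q)) = (u \<bullet> v) *\<^sub>R (hconj (hgen p) * hgen q)"
      using ip_part_eq(2)[OF p q] part_0_subset u v p q by blast
  qed (auto intro!: linearI simp: add_rmul rmul_scaleR_right ip_add_right ip_scaleR_right
      hmult_add_right hmult_scaleR_right algebra_simps)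
qed (auto intro!: linearI simp: add_rmul rmul_scaleR_right ip_add_left ip_scaleR_left hconj_add hconj_scaleR
      hmult_add_left hmult_scaleR_left algebra_simps)

lemma inner_rmul_rmul:
  assumes "u \<in> part V 0" "v \<in> part V 0"
  shows "rmul V u a \<bullet> rmul V v b = (u \<bullet> v) * (a \<bullet> b)"
proof -
  have "rmul V u a \<bullet> rmul V v b = (u \<bullet> v) * (b \<bullet> a)"
    using arg_cong[OF ip_rmul_rmul[OF assms, of a b], of "\<lambda>z. z \<bullet> 1"]
    by (simp add: Re_ip hmult_adjoint_left hmult_1_right)
  then show ?thesis by (simp add: inner_commute)
qed

lemma ip_part_0_eq_0:
  assumes "\<And>v. v \<in> part V 0 \<Longrightarrow> ip V v w = 0"
  shows "w = 0"
proof -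
  obtain u where u: "\<And>p. p < DIM('k) \<Longrightarrow> u p \<in> part V 0" "w = (\<Sum>p<DIM('k). rmul V (u p) (hgen p))"
    using part_0_decomposition[of "w"] by blast
  have "u p = 0" if p: "p < DIM('k)" for p
  proof -
    have "ip V (u p) w \<bullet> hgen p = u p \<bullet> u p"
      using ip_part_0[OF u(1)[OF p], of u] u part_0_subset p by (simp add: inner_sum_hgen)
    then show ?thesis
      using assms[OF u(1)[OF p]] by simp
  qed
  then show ?thesis
    using u(2) linear_0[OF linear_rmul] by simp
qed

text \<open>Right multiplication on \<open>X\<^sub>0\<close> is as associative as it would be in the scalars
  themselves. Over the octonions this comes out of the axiom for \<open>\<langle>x a; x\<rangle>\<close> by
  polarization at \<open>x = u b\<close> and an element of \<open>X\<^sub>0\<close>.\<close>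

lemma rmul_rmul_part_0:
  assumes u: "u \<in> part V 0"
  shows "rmul V (rmul V u b) a = rmul V u (b * a)"
proof -
  have "rmul V (rmul V u b) a - rmul V u (b * a) = 0"
  proof (rule ip_part_0_eq_0)
    fix v assume v: "v \<in> part V 0"
    have "ip V (rmul V (rmul V u b) a) v + ip V (rmul V v a) (rmul V u b) = (2 * (rmul V u b \<bullet> v)) *\<^sub>R hconj a"
      by (rule ip_rmul_polar)
    moreover have "ip V (rmul V v a) (rmul V u b) = (u \<bullet> v) *\<^sub>R (hconj a * b)"
      using ip_rmul_rmul[OF v u] by (simp add: inner_commute)
    moreover have "rmul V u b \<bullet> v = (u \<bullet> v) * (b \<bullet> 1)"
      using inner_rmul_rmul[OF u v, of b 1] by simp
    ultimately have "ip V (rmul V (rmul V u b) a) v = (u \<bullet> v) *\<^sub>R ((2 * (b \<bullet> 1)) *\<^sub>R hconj a - hconj a * b)"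
      by (simp add: algebra_simps)
    also have "(2 * (b \<bullet> 1)) *\<^sub>R hconj a - hconj a * b = hconj a * hconj b"
      by (simp add: hconj_eq[of b] hmult_diff_right hmult_scaleR_right hmult_1_right)
    finally have "ip V (rmul V (rmul V u b) a) v = ip V (rmul V u (b * a)) v"
      using ip_rmul_rmul[OF u v, of "b * a" 1] by (simp add: hconj_hmult hmult_1_right)
    then show "ip V v (rmul V (rmul V u b) a - rmul V u (b * a)) = 0"
      using ip_hconj[of v] by (simp add: linear_diff[OF linear_ip_right])
  qed
  then show ?thesis by simp
qed

lemma pure_hgen: "p < DIM('k) \<Longrightarrow> pure_vector (hgen p :: 'k)"
  unfolding pure_vector_def by (metis scaleR_one)

lemma pure_1: "pure_vector (1 :: 'k)"
  using pure_hgen[of 0] by (simp add: hgen_0)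

text \<open>Over the octonions the axioms of the space do not force this: they also hold if left multiplication is
  replaced by right multiplication. It is the multiplicativity of \<open>E\<close> in pure scalars, read at the
  whole of \<open>\<^bold>K\<close>, where \<open>E\<close> is the identity.\<close>

lemma lmul_rmul_part_0:
  assumes u: "u \<in> part V 0"
  shows "lmul V a (rmul V u b) = rmul V u (a * b)"
proof (rule linear_scalar_eq[where a = a])
  fix p assume p: "p < DIM('k)"
  show "lmul V (hgen p) (rmul V u b) = rmul V u (hgen p * b)"
  proof (rule linear_scalar_eq[where a = b])
    fix q assume q: "q < DIM('k)"
    have "E (UNIV \<inter> UNIV) (hgen p * hgen q) u = E UNIV (hgen p) (E UNIV (hgen q) u)"
      using u part_0_subset_assoc pure_hgen p q by (intro mult_pure) auto
    then show "lmul V (hgen p) (rmul V u (hgen q)) = rmul V u (hgen p * hgen q)"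
      by (simp add: E_UNIV lmul_eq_rmul[OF u])
  qed (auto intro!: linear_compose[OF linear_rmul_scalar linear_lmul, unfolded comp_def]
      linear_compose[OF linear_hmult(2) linear_rmul_scalar, unfolded comp_def])
qed (auto intro!: linear_lmul_scalar linear_compose[OF linear_hmult(1) linear_rmul_scalar, unfolded comp_def])

lemma lmul_rmul_assoc:
  assumes x: "x \<in> assoc_part V"
  shows "lmul V a (rmul V x c) = rmul V (lmul V a x) c"
proof (cases "DIM('k) = 4")
  case True
  show ?thesis
  proof (rule linear_eq_on_part_0[where x = x])
    show "linear (\<lambda>x. lmul V a (rmul V x c))" "linear (\<lambda>x. rmul V (lmul V a x) c)"
      using linear_compose[OF linear_rmul linear_lmul] linear_compose[OF linear_lmul linear_rmul]
      by (auto simp: comp_def)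
    fix w p assume w: "w \<in> part V 0" and "p < DIM('k)"
    have "lmul V (a * (hgen p * c)) w = lmul V ((a * hgen p) * c) w"
      by (simp flip: lmul_H[OF True])
    then show "lmul V a (rmul V (rmul V w (hgen p)) c) = rmul V (lmul V a (rmul V w (hgen p))) c"
      by (simp add: rmul_rmul_part_0 lmul_rmul_part_0 w lmul_eq_rmul)
  qed
next
  case False
  then have "x \<in> part V 0" using x by (simp add: assoc_part_def)
  then show ?thesis
    by (simp add: lmul_rmul_part_0 lmul_eq_rmul rmul_rmul_part_0)
qed

lemma bilinear_eq_on_part_0:
  assumes "\<And>y. linear (\<lambda>x. F x y)" "\<And>y. linear (\<lambda>x. G x y)" "\<And>x. linear (F x)" "\<And>x. linear (G x)"
    and "\<And>u v p q. u \<in> part V 0 \<Longrightarrow> v \<in> part V 0 \<Longrightarrow> p < DIM('k) \<Longrightarrow> q < DIM('k) \<Longrightarrow>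
      F (rmul V u (hgen p)) (rmul V v (hgen q)) = G (rmul V u (hgen p)) (rmul V v (hgen q))"
  shows "F x y = (G x y :: 'b::real_vector)"
  by (rule linear_eq_on_part_0[of "\<lambda>x. F x y" "\<lambda>x. G x y", OF assms(1,2)])
    (rule linear_eq_on_part_0[OF assms(3,4)], rule assms(5))

lemma inner_lmul_adjoint: "lmul V a x \<bullet> y = x \<bullet> lmul V (hconj a) y"
  by (rule bilinear_eq_on_part_0[where x = x and y = y and F = "\<lambda>x y. lmul V a x \<bullet> y"])
    (auto intro!: linearI simp: lmul_add linear_scale[OF linear_lmul] inner_add_left inner_add_right
      lmul_rmul_part_0 inner_rmul_rmul hmult_adjoint_left algebra_simps)

lemma inner_lmul_same: "lmul V a x \<bullet> lmul V a y = (norm a)\<^sup>2 * (x \<bullet> y)"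
proof -
  have "lmul V (hconj a) (lmul V a y) = (norm a)\<^sup>2 *\<^sub>R y"
    by (simp add: hconj_eq linear_diff[OF linear_lmul_scalar] lmul_scaleR_left lmul_lmul_self hmult_self)
  then show ?thesis
    by (simp add: inner_lmul_adjoint)
qed

lemma inner_lmul_polar: "lmul V a x \<bullet> lmul V b y + lmul V b x \<bullet> lmul V a y = 2 * (a \<bullet> b) * (x \<bullet> y)"
  using inner_lmul_same[of "a + b" x y]
  by (simp add: add_lmul inner_add_left inner_add_right inner_lmul_same power2_norm_eq_inner inner_commute algebra_simps)

text \<open>The scalar-valued inner product is determined by its real part and right multiplication. This is the
  bridge between adjoints in the sense of \<open>adjoint_value\<close> and real adjoints.\<close>

lemma ip_inner: "ip V x y \<bullet> c = rmul V x c \<bullet> y"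
proof (rule bilinear_eq_on_part_0[where x = x and y = y and F = "\<lambda>x y. ip V x y \<bullet> c"])
  fix u v p q assume "u \<in> part V 0" "v \<in> part V 0"
  then show "ip V (rmul V u (hgen p)) (rmul V v (hgen q)) \<bullet> c = rmul V (rmul V u (hgen p)) c \<bullet> rmul V v (hgen q)"
    by (simp add: ip_rmul_rmul rmul_rmul_part_0 inner_rmul_rmul hmult_adjoint_left[of "hconj _"])
      (simp add: inner_commute)
qed (auto intro!: linearI simp: ip_add_left ip_add_right ip_scaleR_left ip_scaleR_right rmul_add
      rmul_scaleR_left inner_add_left inner_add_right algebra_simps)

lemma ip_eqI:
  assumes "\<And>c. rmul V x c \<bullet> y = rmul V x' c \<bullet> y'"
  shows "ip V x y = ip V x' y'"
  using assms by (intro hgen_eqI) (simp add: ip_inner)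

lemma ip_rmul_right_part_0:
  assumes v: "v \<in> part V 0"
  shows "ip V x (rmul V v b) = ip V x v * b"
proof (rule linear_eq_on_part_0[where x = x])
  fix u p assume "u \<in> part V 0"
  then show "ip V (rmul V u (hgen p)) (rmul V v b) = ip V (rmul V u (hgen p)) v * b"
    using ip_rmul_rmul[of u v "hgen p" 1] v by (simp add: ip_rmul_rmul hmult_scaleR_left hmult_1_right)
qed (auto intro!: linearI simp: ip_add_left ip_scaleR_left hmult_add_left hmult_scaleR_left)

lemma ip_lmul_right_part_0:
  assumes v: "v \<in> part V 0"
  shows "ip V v (lmul V a x) = a * ip V v x"
proof (rule linear_eq_on_part_0[where x = x])
  fix u p assume u: "u \<in> part V 0"
  then show "ip V v (lmul V a (rmul V u (hgen p))) = a * ip V v (rmul V u (hgen p))"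
    using ip_rmul_rmul[OF v u, of 1] by (simp add: lmul_rmul_part_0 hmult_scaleR_right hconj_1 hmult_1_left)
qed (auto intro!: linearI simp: lmul_add linear_scale[OF linear_lmul] ip_add_right ip_scaleR_right
      hmult_add_right hmult_scaleR_right)

subsection \<open>The spectral projections\<close>

lemma linear_E: "\<delta> \<in> sets borel \<Longrightarrow> linear (E \<delta> S)"
  using bounded bounded_linear.linear by blast

text \<open>The value of \<open>adjoint_op\<close> is a definite description; it is an adjoint value because adjoint values
  under an everywhere defined operator are unique.\<close>

lemma ip_E_adjoint:
  assumes \<delta>: "\<delta> \<in> sets borel" and x: "x \<in> assoc_part V"
  shows "ip V (E \<delta> 1 x) y = ip V x (E \<delta> 1 y)"
proof -
  let ?T = "\<lambda>x. Some (E \<delta> 1 x)"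
  have "adjoint_op V ?T y = Some (E \<delta> 1 y)"
    using selfadjoint_E[OF \<delta>] unfolding selfadjoint_def by (simp add: fun_eq_iff)
  then have ex: "\<exists>w. adjoint_value V ?T y w" and eq: "(THE w. adjoint_value V ?T y w) = E \<delta> 1 y"
    unfolding adjoint_op_def by (auto split: if_splits)
  have "w = w'" if "adjoint_value V ?T y w" "adjoint_value V ?T y w'" for w w'
    using that ip_assoc_part_eq_0[of "w - w'"]
    by (auto simp: adjoint_value_def linear_diff[OF linear_ip_right])
  then have "adjoint_value V ?T y (E \<delta> 1 y)"
    using ex eq theI'[of "adjoint_value V ?T y"] by metis
  then show ?thesis
    using x by (auto simp: adjoint_value_def)
qed

lemma E_lmul_part_0:
  assumes \<delta>: "\<delta> \<in> sets borel" and w: "w \<in> part V 0"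
  shows "E \<delta> 1 (lmul V a w) = lmul V a (E \<delta> 1 w)"
proof (rule linear_scalar_eq[where a = a])
  fix p assume p: "p < DIM('k)"
  have "E (UNIV \<inter> \<delta>) (hgen p * 1) w = E UNIV (hgen p) (E \<delta> 1 w)"
    using w part_0_subset_assoc pure_hgen[OF p] pure_1 \<delta> by (intro mult_pure) auto
  then show "E \<delta> 1 (lmul V (hgen p) w) = lmul V (hgen p) (E \<delta> 1 w)"
    using scalar_action[OF \<delta>, of "hgen p" w] by (simp add: hmult_1_right E_UNIV)
qed (auto intro!: linear_lmul_scalar linear_compose[OF linear_lmul_scalar linear_E[OF \<delta>], unfolded comp_def])

text \<open>For \<open>w\<close> and \<open>v\<close> in \<open>X\<^sub>0\<close> the scalar \<open>\<langle>E(\<delta>) w; v\<rangle>\<close> is central: a scalar multiplied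
  to \<open>v\<close> comes out on the right, but it comes out on the left if \<open>E(\<delta>)\<close> is first moved to
  the other side. Hence it is real, which means that \<open>E(\<delta>) w\<close> has no other component than
  the one in \<open>X\<^sub>0\<close>.\<close>

lemma E_part_0:
  assumes \<delta>: "\<delta> \<in> sets borel" and w: "w \<in> part V 0"
  shows "E \<delta> 1 w \<in> part V 0"
proof -
  have real: "ip V (E \<delta> 1 w) v \<bullet> hgen p = 0" if v: "v \<in> part V 0" and p: "0 < p" "p < DIM('k)" for v p
  proof (rule central_imp_real[OF _ p])
    fix q assume q: "q < DIM('k)"
    have "ip V (E \<delta> 1 w) v * hgen q = ip V (E \<delta> 1 w) (rmul V v (hgen q))"
      by (simp add: ip_rmul_right_part_0 v)
    also have "\<dots> = ip V w (E \<delta> 1 (lmul V (hgen q) v))"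
      using w part_0_subset_assoc by (simp add: ip_E_adjoint \<delta> lmul_eq_rmul v subset_iff)
    also have "\<dots> = hgen q * ip V w (E \<delta> 1 v)"
      by (simp add: E_lmul_part_0 \<delta> v ip_lmul_right_part_0 w)
    also have "\<dots> = hgen q * ip V (E \<delta> 1 w) v"
      using w part_0_subset_assoc by (simp add: ip_E_adjoint \<delta> subset_iff)
    finally show "ip V (E \<delta> 1 w) v * hgen q = hgen q * ip V (E \<delta> 1 w) v" .
  qed
  obtain u where u: "\<And>p. p < DIM('k) \<Longrightarrow> u p \<in> part V 0"
    "E \<delta> 1 w = (\<Sum>p<DIM('k). rmul V (u p) (hgen p))"
    using part_0_decomposition[of "E \<delta> 1 w"] by blast
  have "u p = 0" if p: "0 < p" "p < DIM('k)" for p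
  proof -
    have "ip V (u p) (E \<delta> 1 w) \<bullet> hgen p = u p \<bullet> u p"
      unfolding u(2) using ip_part_0[OF u(1)[OF p(2)], of u] u(1) part_0_subset p by (simp add: inner_sum_hgen)
    moreover have "ip V (u p) (E \<delta> 1 w) \<bullet> hgen p = 0"
      using real[OF u(1)[OF p(2)] p] p ip_hconj[of "u p" "E \<delta> 1 w"] by (simp add: hconj_inner_hgen)
    ultimately show ?thesis by simp
  qed
  then have "(\<Sum>p<DIM('k). rmul V (u p) (hgen p)) = (\<Sum>p<DIM('k). if p = 0 then u 0 else 0)"
    by (intro sum.cong refl) (auto simp: hgen_0 linear_0[OF linear_rmul])
  then show ?thesis
    using u by simp
qed

lemma E_rmul:
  assumes \<delta>: "\<delta> \<in> sets borel"
  shows "E \<delta> 1 (rmul V x a) = rmul V (E \<delta> 1 x) a"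
proof -
  have *: "E \<delta> 1 (rmul V w a) = rmul V (E \<delta> 1 w) a" if "w \<in> part V 0" for w a
    using E_lmul_part_0[OF \<delta> that, of a] E_part_0[OF \<delta> that] that by (simp add: lmul_eq_rmul)
  show ?thesis
  proof (rule linear_eq_on_part_0[where x = x])
    show "linear (\<lambda>x. E \<delta> 1 (rmul V x a))" "linear (\<lambda>x. rmul V (E \<delta> 1 x) a)"
      using linear_compose[OF linear_rmul linear_E[OF \<delta>]] linear_compose[OF linear_E[OF \<delta>] linear_rmul]
      by (auto simp: comp_def)
  qed (simp add: * rmul_rmul_part_0 E_part_0[OF \<delta>])
qed

lemma E_lmul:
  assumes \<delta>: "\<delta> \<in> sets borel"
  shows "E \<delta> 1 (lmul V a x) = lmul V a (E \<delta> 1 x)"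
proof (rule linear_eq_on_part_0[where x = x])
  show "linear (\<lambda>x. E \<delta> 1 (lmul V a x))" "linear (\<lambda>x. lmul V a (E \<delta> 1 x))"
    using linear_compose[OF linear_lmul linear_E[OF \<delta>]] linear_compose[OF linear_E[OF \<delta>] linear_lmul]
    by (auto simp: comp_def)
qed (simp add: E_rmul[OF \<delta>] lmul_rmul_part_0 E_part_0[OF \<delta>])

sublocale projection_valued_measure "\<lambda>\<delta>. E \<delta> 1"
proof (rule projection_valued_measure.intro)
  fix \<delta> \<gamma> :: "'k set" and x y :: 'x
  assume \<delta>: "\<delta> \<in> sets borel"
  show "linear (E \<delta> 1)"
    by (rule linear_E[OF \<delta>])
  show "E \<delta> 1 x \<bullet> y = x \<bullet> E \<delta> 1 y"
  proof (rule linear_eq_on_part_0[where x = x])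
    fix w p assume "w \<in> part V 0"
    then have "ip V (E \<delta> 1 w) (rmul V y (hconj (hgen p))) = ip V w (E \<delta> 1 (rmul V y (hconj (hgen p))))"
      using part_0_subset_assoc by (intro ip_E_adjoint \<delta>) auto
    from arg_cong[OF this, of "\<lambda>z. z \<bullet> 1"]
    show "E \<delta> 1 (rmul V w (hgen p)) \<bullet> y = rmul V w (hgen p) \<bullet> E \<delta> 1 y"
      by (simp add: E_rmul[OF \<delta>] inner_rmul_adjoint Re_ip)
  qed (auto intro!: linearI simp: linear_add[OF linear_E[OF \<delta>]] linear_scale[OF linear_E[OF \<delta>]] inner_add_left)
  show "E \<delta> 1 (E \<gamma> 1 x) = E (\<delta> \<inter> \<gamma>) 1 x" if \<gamma>: "\<gamma> \<in> sets borel"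
  proof (rule linear_eq_on_part_0[where x = x])
    fix w p assume w: "w \<in> part V 0"
    have "E (\<delta> \<inter> \<gamma>) (1 * 1) w = E \<delta> 1 (E \<gamma> 1 w)"
      using w part_0_subset_assoc pure_1 \<delta> \<gamma> by (intro mult_pure) auto
    then show "E \<delta> 1 (E \<gamma> 1 (rmul V w (hgen p))) = E (\<delta> \<inter> \<gamma>) 1 (rmul V w (hgen p))"
      using \<delta> \<gamma> by (simp add: E_rmul hmult_1_left)
  qed (use linear_compose[OF linear_E[OF \<gamma>] linear_E[OF \<delta>]] linear_E[of "\<delta> \<inter> \<gamma>"] \<delta> \<gamma> in \<open>auto simp: comp_def\<close>)
qed (use unity countably_additive in auto)

lemma sint_lmul: "bounded_borel g \<Longrightarrow> sint g (lmul V a x) = lmul V a (sint g x)"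
  using sint_commute[OF _ bounded_linear_lmul] E_lmul by metis

lemma sint_rmul: "bounded_borel g \<Longrightarrow> sint g (rmul V x a) = rmul V (sint g x) a"
  using sint_commute[OF _ bounded_linear_rmul] E_rmul by metis

end

section \<open>Integration of scalar-valued functions\<close>

lemma upper_variation_cong:
  assumes "\<And>A. A \<in> sets borel \<Longrightarrow> \<mu> A = \<nu> A"
  shows "upper_variation \<mu> = upper_variation \<nu>"
  unfolding upper_variation_def using assms
  by (intro arg_cong[where f = "measure_of UNIV (sets borel)"] ext SUP_cong) auto

lemma real_integral_cong:
  assumes "\<And>A. A \<in> sets borel \<Longrightarrow> \<mu> A = \<nu> A"
  shows "real_integrable \<mu> g = real_integrable \<nu> g" "real_integral \<mu> g = real_integral \<nu> g"
  using upper_variation_cong[of \<mu> \<nu>] upper_variation_cong[of "\<lambda>A. - \<mu> A" "\<lambda>A. - \<nu> A"] assms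
  by (simp_all add: real_integrable_def real_integral_def lower_variation_def)

lemma Borel_vimage_le:
  "f \<in> borel_measurable borel \<Longrightarrow> {z. norm (f z) \<le> real n} \<in> sets borel"
  for f :: "'a::topological_space \<Rightarrow> 'b::real_normed_vector"
  by measurable

lemma truncation_UNIV: "truncation UNIV f n z = indicator {z. norm (f z) \<le> real n} z *\<^sub>R f z"
  by (simp add: truncation_def indicator_def)

lemma norm_truncation_le: "norm (truncation UNIV f n z) \<le> norm (f z)" "norm (truncation UNIV f n z) \<le> real n"
  by (simp_all add: truncation_def)

lemma bounded_borel_truncation: "f \<in> borel_measurable borel \<Longrightarrow> bounded_borel (truncation UNIV f n)"
proof (rule bounded_borelI)
  assume "f \<in> borel_measurable borel"
  then show "truncation UNIV f n \<in> borel_measurable borel"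
    unfolding truncation_UNIV[abs_def] using Borel_vimage_le[of f n] by measurable
qed (rule norm_truncation_le)

lemma truncation_LIMSEQ: "(\<lambda>n. truncation UNIV f n z) \<longlonglongrightarrow> f z"
proof (rule tendsto_eventually)
  show "\<forall>\<^sub>F n in sequentially. truncation UNIV f n z = f z"
    using eventually_ge_at_top[of "nat \<lceil>norm (f z)\<rceil>"] by eventually_elim (simp add: truncation_def)
qed

context spectral_hilbert_space
begin

lemma quadratic_measure_eq: "quadratic_measure V E x = qmeasure x"
  by (simp add: quadratic_measure_def qmeasure_def Re_ip)

text \<open>Since \<open>E(\<delta>).S\<close> is \<open>E(\<delta>)\<close> after left multiplication by \<open>S\<close>, the integral of \<open>f\<close>
  is the sum of the real integrals of its coordinates, applied to the left multiples.\<close>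

definition kint :: "('k \<Rightarrow> 'k) \<Rightarrow> 'x \<Rightarrow> 'x" where
  "kint f x = (\<Sum>v<DIM('k). sint (\<lambda>z. f z \<bullet> hgen v) (lmul V (hgen v) x))"

lemma bounded_linear_kint:
  assumes "bounded_borel f"
  shows "bounded_linear (kint f)"
  unfolding kint_def using assms
  by (intro bounded_linear_sum bounded_linear_compose[OF bounded_linear_sint bounded_linear_lmul]
      bounded_borel_inner)

lemma linear_kint: "bounded_borel f \<Longrightarrow> linear (kint f)"
  using bounded_linear_kint bounded_linear.linear by blast

lemma kint_diff:
  assumes "bounded_borel f" "bounded_borel g"
  shows "kint (\<lambda>z. f z - g z) x = kint f x - kint g x"
  using assms by (simp add: kint_def inner_diff_left sint_diff bounded_borel_inner sum_subtractf)

lemma kint_scaleR: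
  assumes "bounded_borel g" "bounded_borel f"
  shows "kint (\<lambda>z. g z *\<^sub>R f z) x = kint f (sint g x)" "kint (\<lambda>z. g z *\<^sub>R f z) x = sint g (kint f x)"
proof -
  show "kint (\<lambda>z. g z *\<^sub>R f z) x = kint f (sint g x)"
    using assms by (simp add: kint_def sint_sint bounded_borel_inner mult.commute flip: sint_lmul)
  show "kint (\<lambda>z. g z *\<^sub>R f z) x = sint g (kint f x)"
    using assms by (simp add: kint_def sint_sint bounded_borel_inner linear_sum[OF linear_sint])
qed

lemma kint_indicator:
  assumes "B \<in> sets borel" "bounded_borel f"
  shows "kint (\<lambda>z. indicator B z *\<^sub>R f z) x = kint f (E B 1 x)"
    "kint (\<lambda>z. indicator B z *\<^sub>R f z) x = E B 1 (kint f x)"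
  using kint_scaleR[OF bounded_borel_indicator[OF assms(1)] assms(2)] assms(1) by (simp_all add: sint_indicator)

lemma kint_scaleR_const:
  assumes g: "bounded_borel g"
  shows "kint (\<lambda>z. g z *\<^sub>R c) x = sint g (lmul V c x)"
proof -
  have "kint (\<lambda>z. g z *\<^sub>R c) x = (\<Sum>v<DIM('k). (c \<bullet> hgen v) *\<^sub>R sint g (lmul V (hgen v) x))"
    by (simp add: kint_def mult.commute[of "g _"] sint_cmult[OF g])
  also have "\<dots> = sint g (lmul V (\<Sum>v<DIM('k). (c \<bullet> hgen v) *\<^sub>R hgen v) x)"
    by (simp add: linear_sum[OF linear_lmul_scalar] lmul_scaleR_left linear_sum[OF linear_sint[OF g]]
        linear_scale[OF linear_sint[OF g]])
  finally show ?thesis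
    by (simp only: hgen_expansion)
qed

text \<open>The mixed terms of the square cancel in pairs because distinct generators act by
  anticommuting isometries.\<close>

lemma norm_kint:
  assumes f: "bounded_borel f"
  shows "(norm (kint f x))\<^sup>2 = (\<integral>z. (norm (f z))\<^sup>2 \<partial>qmeasure x)"
proof -
  let ?f = "\<lambda>v z. f z \<bullet> (hgen v :: 'k)"
  have fb: "bounded_borel (?f v)" for v
    by (rule bounded_borel_inner[OF f])
  define c where "c v w = sint (\<lambda>z. ?f v z * ?f w z) (lmul V (hgen v) x) \<bullet> lmul V (hgen w) x" for v w
  have cc: "c v w + c w v = (if v = w then 2 * (sint (\<lambda>z. (?f v z)\<^sup>2) x \<bullet> x) else 0)"
    if "v < DIM('k)" "w < DIM('k)" for v w
  proof -
    have "c v w + c w v = 2 * ((hgen v :: 'k) \<bullet> hgen w) * (sint (\<lambda>z. ?f v z * ?f w z) x \<bullet> x)"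
      unfolding c_def sint_lmul[OF bounded_borel_mult[OF fb fb]] mult.commute[of "?f w _"]
      by (rule inner_lmul_polar)
    then show ?thesis
      using that by (simp add: inner_hgen power2_eq_square)
  qed
  have "(norm (kint f x))\<^sup>2 = (\<Sum>v<DIM('k). \<Sum>w<DIM('k). c v w)"
    unfolding power2_norm_eq_inner kint_def c_def
    by (simp add: inner_sum_left inner_sum_right inner_sint_sint fb)
      (subst sum.swap, simp)
  also have "\<dots> = (\<Sum>v<DIM('k). \<Sum>w<DIM('k). c v w + c w v) / 2"
    by (simp add: sum.distrib) (subst (2) sum.swap, simp)
  also have "\<dots> = (\<Sum>v<DIM('k). sint (\<lambda>z. (?f v z)\<^sup>2) x \<bullet> x)"
    by (simp add: cc sum_divide_distrib[symmetric] flip: sum_distrib_left)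
  also have "\<dots> = (\<Sum>v<DIM('k). \<integral>z. (?f v z)\<^sup>2 \<partial>qmeasure x)"
    by (simp add: inner_sint_self bounded_borel_mult fb power2_eq_square)
  also have "\<dots> = (\<integral>z. (\<Sum>v<DIM('k). (?f v z)\<^sup>2) \<partial>qmeasure x)"
    by (rule Bochner_Integration.integral_sum[symmetric])
      (simp add: power2_eq_square integrable_bounded_borel bounded_borel_mult fb)
  finally show ?thesis
    by (simp add: norm_hgen_expansion)
qed

lemma kint_adjoint:
  assumes f: "bounded_borel f"
  shows "kint f x \<bullet> y = x \<bullet> kint (\<lambda>z. hconj (f z)) y"
proof -
  let ?f = "\<lambda>v z. f z \<bullet> (hgen v :: 'k)"
  have fb: "bounded_borel (?f v)" for v
    by (rule bounded_borel_inner[OF f])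
  have "sint (?f v) (lmul V (hgen v) x) \<bullet> y = x \<bullet> sint (\<lambda>z. hconj (f z) \<bullet> hgen v) (lmul V (hgen v) y)"
    if v: "v < DIM('k)" for v
  proof (cases "v = 0")
    case True
    then show ?thesis
      using v by (simp add: inner_sint_commute[OF fb, of 0, simplified] hgen_0 hconj_inner_hgen[of 0, simplified]
          inner_hconj hconj_1 inner_sint_commute bounded_borel_inner f)
  next
    case False
    have "sint (?f v) (lmul V (hgen v) x) \<bullet> y = x \<bullet> lmul V (- hgen v) (sint (?f v) y)"
      using False v by (simp add: sint_lmul[OF fb] inner_lmul_adjoint hconj_hgen inner_sint_commute[OF fb])
    also have "lmul V (- hgen v) (sint (?f v) y) = - sint (?f v) (lmul V (hgen v) y)"
      using lmul_scaleR_left[of "-1" "hgen v"] by (simp add: sint_lmul[OF fb])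
    finally show ?thesis
      using False v by (simp add: hconj_inner_hgen sint_uminus[OF fb])
  qed
  then show ?thesis
    by (simp add: kint_def inner_sum_left inner_sum_right)
qed

lemma kint_rmul:
  assumes "bounded_borel f" "x \<in> assoc_part V"
  shows "kint f (rmul V x c) = rmul V (kint f x) c"
  using assms by (simp add: kint_def lmul_rmul_assoc linear_sum[OF linear_rmul] sint_rmul bounded_borel_inner)

lemma bounded_linear_ip_left: "bounded_linear (\<lambda>x. ip V x y)"
proof -
  have *: "(\<lambda>x. ip V x y) = (\<lambda>x. \<Sum>l<DIM('k). (rmul V x (hgen l) \<bullet> y) *\<^sub>R hgen l)"
    using hgen_expansion[of "ip V _ y"] by (simp add: ip_inner)
  show ?thesis
    unfolding *
    by (intro bounded_linear_sum bounded_linear_compose[OF bounded_linear_scaleR_left]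
        bounded_linear_compose[OF bounded_linear_inner_left] bounded_linear_rmul)
qed

lemma spectral_nc_measure_eq:
  assumes "\<delta> \<in> sets borel"
  shows "spectral_nc_measure V E x y v l \<delta> = E \<delta> 1 (lmul V (hgen v) x) \<bullet> rmul V y (hconj (hgen l))"
  using scalar_action[OF assms, of "hgen v" x] by (simp add: spectral_nc_measure_def ip_inner inner_rmul_adjoint)

lemma nc_component:
  "real_integrable (spectral_nc_measure V E x y v l) g =
    real_integrable (\<lambda>\<delta>. E \<delta> 1 (lmul V (hgen v) x) \<bullet> rmul V y (hconj (hgen l))) g"
  "real_integral (spectral_nc_measure V E x y v l) g =
    real_integral (\<lambda>\<delta>. E \<delta> 1 (lmul V (hgen v) x) \<bullet> rmul V y (hconj (hgen l))) g"
  by (rule real_integral_cong, rule spectral_nc_measure_eq, assumption)+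

lemma nc_integral_bounded:
  assumes f: "bounded_borel f"
  shows "nc_integrable (spectral_nc_measure V E x y) f"
    "nc_integral (spectral_nc_measure V E x y) f = ip V (kint f x) y"
proof -
  have fb: "bounded_borel (\<lambda>z. f z \<bullet> (hgen v :: 'k))" for v
    by (rule bounded_borel_inner[OF f])
  show "nc_integrable (spectral_nc_measure V E x y) f"
    unfolding nc_integrable_def nc_component by (simp add: real_integral_bounded fb)
  have "nc_integral (spectral_nc_measure V E x y) f = (\<Sum>v<DIM('k). \<Sum>l<DIM('k).
      (rmul V (sint (\<lambda>z. f z \<bullet> hgen v) (lmul V (hgen v) x)) (hgen l) \<bullet> y) *\<^sub>R hgen l)"
    unfolding nc_integral_def nc_component by (simp add: real_integral_bounded fb inner_rmul_adjoint)
  also have "\<dots> = (\<Sum>v<DIM('k). ip V (sint (\<lambda>z. f z \<bullet> hgen v) (lmul V (hgen v) x)) y)"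
    by (simp add: hgen_expansion flip: ip_inner)
  finally show "nc_integral (spectral_nc_measure V E x y) f = ip V (kint f x) y"
    by (simp add: kint_def linear_sum[OF linear_ip_left])
qed

lemma spectral_integral_eq:
  assumes f: "bounded_borel (\<lambda>z. indicator A z *\<^sub>R f z)"
  shows "spectral_integral V E A f x = kint (\<lambda>z. indicator A z *\<^sub>R f z) x"
  unfolding spectral_integral_def
proof (rule the_equality)
  show "has_spectral_integral V E A f x (kint (\<lambda>z. indicator A z *\<^sub>R f z) x)"
    by (simp add: has_spectral_integral_def nc_integral_bounded[OF f])
  fix w assume "has_spectral_integral V E A f x w"
  then have "ip V w y = ip V (kint (\<lambda>z. indicator A z *\<^sub>R f z) x) y" for y
    by (simp add: has_spectral_integral_def nc_integral_bounded[OF f])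
  then show "w = kint (\<lambda>z. indicator A z *\<^sub>R f z) x"
    by (metis Re_ip vector_eq_rdot)
qed

section \<open>The operator \<open>f(T)\<close> of an unbounded function\<close>

abbreviation calculus :: "('k \<Rightarrow> 'k) \<Rightarrow> 'x \<rightharpoonup> 'x" where
  "calculus f \<equiv> functional_calculus V E UNIV f"

lemma calculus_eq:
  assumes "f \<in> borel_measurable borel"
  shows "calculus f x = (if convergent (\<lambda>n. kint (truncation UNIV f n) x)
    then Some (lim (\<lambda>n. kint (truncation UNIV f n) x)) else None)"
  using spectral_integral_eq[of UNIV "truncation UNIV f _" x] bounded_borel_truncation[OF assms]
  by (simp add: functional_calculus_def)

lemma calculus_LIMSEQ_iff:
  assumes "f \<in> borel_measurable borel"
  shows "calculus f x = Some y \<longleftrightarrow> (\<lambda>n. kint (truncation UNIV f n) x) \<longlonglongrightarrow> y"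
  unfolding calculus_eq[OF assms] using convergent_LIMSEQ_iff limI convergentI by auto

lemma E_LIMSEQ:
  assumes "\<And>n. B n \<in> sets borel" "incseq B" "(\<Union>n. B n) = UNIV"
  shows "(\<lambda>n. E (B n) 1 y) \<longlonglongrightarrow> y"
proof -
  have "(\<lambda>n. sint (indicator (B n)) y) \<longlonglongrightarrow> sint (\<lambda>z. 1) y"
  proof (rule LIMSEQ_sint_pointwise[where C = 1])
    fix z
    have "(\<lambda>n. indicator (B n) z :: real) \<longlonglongrightarrow> indicator (\<Union>n. B n) z"
      using assms(2) by (rule LIMSEQ_indicator_incseq)
    then show "(\<lambda>n. indicator (B n) z :: real) \<longlonglongrightarrow> 1"
      by (simp add: assms(3))
  qed (use assms(1) in \<open>auto intro: bounded_borel_indicator bounded_borel_const simp: indicator_def\<close>)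
  then show ?thesis
    using assms(1) by (simp add: sint_indicator sint_1)
qed

lemma E_LIMSEQ_norm:
  assumes "f \<in> borel_measurable borel"
  shows "(\<lambda>n. E {z. norm (f z :: 'k) \<le> real n} 1 y) \<longlonglongrightarrow> y"
proof (rule E_LIMSEQ)
  show "incseq (\<lambda>n. {z. norm (f z) \<le> real n})"
    by (auto simp: incseq_def)
  show "(\<Union>n. {z. norm (f z) \<le> real n}) = UNIV"
    using real_arch_simple by auto
qed (rule Borel_vimage_le[OF assms])

lemma kint_truncation_E:
  assumes f: "f \<in> borel_measurable borel" and "n \<le> m"
  shows "kint (truncation UNIV f m) (E {z. norm (f z) \<le> real n} 1 x) = kint (truncation UNIV f n) x"
    "E {z. norm (f z) \<le> real n} 1 (kint (truncation UNIV f m) x) = kint (truncation UNIV f n) x"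
proof -
  have "truncation UNIV f n = (\<lambda>z. indicator {z. norm (f z) \<le> real n} z *\<^sub>R truncation UNIV f m z)"
    using \<open>n \<le> m\<close> by (auto simp: truncation_def indicator_def fun_eq_iff)
  then show "kint (truncation UNIV f m) (E {z. norm (f z) \<le> real n} 1 x) = kint (truncation UNIV f n) x"
    "E {z. norm (f z) \<le> real n} 1 (kint (truncation UNIV f m) x) = kint (truncation UNIV f n) x"
    using kint_indicator[OF Borel_vimage_le[OF f] bounded_borel_truncation[OF f]] by metis+
qed

text \<open>The graph of \<open>f(T)\<close> is cut out by equations between bounded operators, one for each
  level set. Closedness and the determination of the adjoint both rest on this.\<close>

lemma calculus_iff:
  assumes f: "f \<in> borel_measurable borel"
  shows "calculus f x = Some y \<longleftrightarrow>
    (\<forall>n. kint (truncation UNIV f n) x = E {z. norm (f z) \<le> real n} 1 y)"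
proof
  assume "calculus f x = Some y"
  then have lim: "(\<lambda>n. kint (truncation UNIV f n) x) \<longlonglongrightarrow> y"
    by (simp add: calculus_LIMSEQ_iff[OF f])
  show "\<forall>n. kint (truncation UNIV f n) x = E {z. norm (f z) \<le> real n} 1 y"
  proof
    fix n
    have "(\<lambda>m. E {z. norm (f z) \<le> real n} 1 (kint (truncation UNIV f m) x)) \<longlonglongrightarrow> E {z. norm (f z) \<le> real n} 1 y"
      by (rule bounded_linear.tendsto[OF bounded[OF Borel_vimage_le[OF f]] lim])
    moreover have "(\<lambda>m. E {z. norm (f z) \<le> real n} 1 (kint (truncation UNIV f m) x)) \<longlonglongrightarrow> kint (truncation UNIV f n) x"
      by (rule tendsto_eventually) (use kint_truncation_E(2)[OF f] in \<open>auto simp: eventually_sequentially\<close>)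
    ultimately show "kint (truncation UNIV f n) x = E {z. norm (f z) \<le> real n} 1 y"
      using LIMSEQ_unique by blast
  qed
next
  assume "\<forall>n. kint (truncation UNIV f n) x = E {z. norm (f z) \<le> real n} 1 y"
  then show "calculus f x = Some y"
    using E_LIMSEQ_norm[OF f, of y] by (simp add: calculus_LIMSEQ_iff[OF f])
qed

lemma calculus_E:
  assumes "f \<in> borel_measurable borel"
  shows "calculus f (E {z. norm (f z) \<le> real n} 1 x) = Some (kint (truncation UNIV f n) x)"
  unfolding calculus_LIMSEQ_iff[OF assms]
  by (rule tendsto_eventually) (use kint_truncation_E(1)[OF assms] in \<open>auto simp: eventually_sequentially\<close>)

lemma densely_defined_calculus:
  assumes "f \<in> borel_measurable borel"
  shows "densely_defined (calculus f)"
proof -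
  have "x \<in> closure (dom (calculus f))" for x
    unfolding closure_sequential using E_LIMSEQ_norm[OF assms, of x] calculus_E[OF assms]
    by (intro exI[of _ "\<lambda>n. E {z. norm (f z) \<le> real n} 1 x"]) auto
  then show ?thesis
    by (auto simp: densely_defined_def)
qed

lemma closed_calculus:
  assumes f: "f \<in> borel_measurable borel"
  shows "closed_operator (calculus f)"
proof -
  have "{(x, y). calculus f x = Some y} =
    {w. \<forall>n. kint (truncation UNIV f n) (fst w) = E {z. norm (f z) \<le> real n} 1 (snd w)}"
    by (auto simp: calculus_iff[OF f])
  also have "closed \<dots>"
    by (intro closed_Collect_all closed_Collect_eq
        bounded_linear.continuous_on[OF bounded_linear_kint[OF bounded_borel_truncation[OF f]]]
        bounded_linear.continuous_on[OF bounded[OF Borel_vimage_le[OF f]]] continuous_intros)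
  finally show ?thesis
    by (simp add: closed_operator_def)
qed

lemma integrable_norm_truncation:
  assumes "f \<in> borel_measurable borel"
  shows "integrable (qmeasure x) (\<lambda>z. (norm (truncation UNIV f n z))\<^sup>2)"
proof (rule integrable_bounded_borel)
  have [measurable]: "truncation UNIV f n \<in> borel_measurable borel"
    by (rule bounded_borelD[OF bounded_borel_truncation[OF assms]])
  have "norm ((norm (truncation UNIV f n z))\<^sup>2) \<le> (real n)\<^sup>2" for z
    by (simp add: power_mono norm_truncation_le)
  then show "bounded_borel (\<lambda>z. (norm (truncation UNIV f n z))\<^sup>2)"
    by (intro bounded_borelI) measurable
qed simp_all

lemma nn_integral_truncation_LIMSEQ:
  assumes f: "f \<in> borel_measurable borel"
  shows "(\<lambda>n. ennreal ((norm (kint (truncation UNIV f n) x))\<^sup>2)) \<longlonglongrightarrow> (\<integral>\<^sup>+z. ennreal ((norm (f z))\<^sup>2) \<partial>qmeasure x)"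
proof -
  note t = bounded_borel_truncation[OF f]
  have "(\<lambda>n. \<integral>\<^sup>+z. ennreal ((norm (truncation UNIV f n z))\<^sup>2) \<partial>qmeasure x) \<longlonglongrightarrow> (\<integral>\<^sup>+z. ennreal ((norm (f z))\<^sup>2) \<partial>qmeasure x)"
  proof (rule nn_integral_LIMSEQ)
    show "incseq (\<lambda>n z. ennreal ((norm (truncation UNIV f n z))\<^sup>2))"
      by (auto simp: incseq_def le_fun_def truncation_def intro!: ennreal_leI)
    show "(\<lambda>z. ennreal ((norm (truncation UNIV f n z))\<^sup>2)) \<in> borel_measurable (qmeasure x)" for n
      using bounded_borelD[OF t[of n]] by simp
    show "(\<lambda>n. ennreal ((norm (truncation UNIV f n z))\<^sup>2)) \<longlonglongrightarrow> ennreal ((norm (f z))\<^sup>2)" for z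
      by (intro tendsto_ennrealI tendsto_intros truncation_LIMSEQ)
  qed
  moreover have "(\<integral>\<^sup>+z. ennreal ((norm (truncation UNIV f n z))\<^sup>2) \<partial>qmeasure x) = ennreal ((norm (kint (truncation UNIV f n) x))\<^sup>2)" for n
    unfolding norm_kint[OF t]
    by (rule nn_integral_eq_integral[OF integrable_norm_truncation[OF f]]) simp
  ultimately show ?thesis by simp
qed

lemma norm_calculus:
  assumes f: "f \<in> borel_measurable borel" and y: "calculus f x = Some y"
  shows "ennreal ((norm y)\<^sup>2) = (\<integral>\<^sup>+z. ennreal ((norm (f z))\<^sup>2) \<partial>qmeasure x)"
proof (rule LIMSEQ_unique)
  show "(\<lambda>n. ennreal ((norm (kint (truncation UNIV f n) x))\<^sup>2)) \<longlonglongrightarrow> ennreal ((norm y)\<^sup>2)"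
    using y by (intro tendsto_ennrealI tendsto_intros) (simp add: calculus_LIMSEQ_iff[OF f])
qed (rule nn_integral_truncation_LIMSEQ[OF f])

text \<open>The squared norms of the truncated integrals increase, and the squared distance of two of them is the
  difference of their squared norms; so they converge if and only if their norms stay bounded.\<close>

lemma dom_calculus:
  assumes f: "f \<in> borel_measurable borel"
  shows "dom (calculus f) = {x. (\<integral>\<^sup>+z. ennreal ((norm (f z))\<^sup>2) \<partial>qmeasure x) < \<infinity>}"
proof (intro equalityI subsetI)
  fix x assume "x \<in> dom (calculus f)"
  then obtain y where "calculus f x = Some y" by blast
  from norm_calculus[OF f this] show "x \<in> {x. (\<integral>\<^sup>+z. ennreal ((norm (f z))\<^sup>2) \<partial>qmeasure x) < \<infinity>}"
    by (simp flip: \<open>ennreal _ = _\<close>)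
next
  fix x assume "x \<in> {x. (\<integral>\<^sup>+z. ennreal ((norm (f z))\<^sup>2) \<partial>qmeasure x) < \<infinity>}"
  then obtain K where K: "0 \<le> K" "(\<integral>\<^sup>+z. ennreal ((norm (f z))\<^sup>2) \<partial>qmeasure x) = ennreal K"
    by (cases "\<integral>\<^sup>+z. ennreal ((norm (f z))\<^sup>2) \<partial>qmeasure x") auto
  note t = bounded_borel_truncation[OF f]
  define r where "r n = (norm (kint (truncation UNIV f n) x))\<^sup>2" for n
  have "r \<longlonglongrightarrow> K"
    using nn_integral_truncation_LIMSEQ[OF f, of x] K unfolding r_def by (simp add: K(2))
  then have "Cauchy r"
    using convergentI convergent_Cauchy by blast
  have i: "integrable (qmeasure x) (\<lambda>z. (norm (truncation UNIV f n z))\<^sup>2)" for n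
    by (rule integrable_norm_truncation[OF f])
  have diff: "(norm (kint (truncation UNIV f n) x - kint (truncation UNIV f m) x))\<^sup>2 = r n - r m" if "m \<le> n" for m n
  proof -
    have "(norm (kint (truncation UNIV f n) x - kint (truncation UNIV f m) x))\<^sup>2 =
      (\<integral>z. (norm (truncation UNIV f n z - truncation UNIV f m z))\<^sup>2 \<partial>qmeasure x)"
      by (simp add: norm_kint bounded_borel_arith t flip: kint_diff)
    also have "\<dots> = (\<integral>z. (norm (truncation UNIV f n z))\<^sup>2 - (norm (truncation UNIV f m z))\<^sup>2 \<partial>qmeasure x)"
      using that by (intro Bochner_Integration.integral_cong) (auto simp: truncation_def)
    also have "\<dots> = r n - r m"
      by (simp add: i r_def norm_kint t)
    finally show ?thesis .
  qed
  have "Cauchy (\<lambda>n. kint (truncation UNIV f n) x)"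
  proof (rule metric_CauchyI)
    fix e :: real assume e: "0 < e"
    then have "0 < e\<^sup>2" by simp
    then obtain N where N: "\<And>m n. N \<le> m \<Longrightarrow> N \<le> n \<Longrightarrow> dist (r m) (r n) < e\<^sup>2"
      using metric_CauchyD[OF \<open>Cauchy r\<close>] by blast
    have "dist (kint (truncation UNIV f n) x) (kint (truncation UNIV f m) x) < e" if "N \<le> m" "m \<le> n" for m n
    proof -
      have "(norm (kint (truncation UNIV f n) x - kint (truncation UNIV f m) x))\<^sup>2 < e\<^sup>2"
        using diff[OF that(2)] N[of m n] that by (simp add: dist_real_def)
      then show ?thesis
        using e by (simp add: dist_norm power_less_imp_less_base)
    qed
    then show "\<exists>M. \<forall>m\<ge>M. \<forall>n\<ge>M. dist (kint (truncation UNIV f m) x) (kint (truncation UNIV f n) x) < e"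
      by (metis dist_commute nle_le)
  qed
  then show "x \<in> dom (calculus f)"
    by (simp add: calculus_eq[OF f] Cauchy_convergent_iff dom_def)
qed

lemma qmeasure_scale:
  assumes "\<And>\<delta>. \<delta> \<in> sets borel \<Longrightarrow> E \<delta> 1 y \<bullet> y = c * (E \<delta> 1 x \<bullet> x)" "0 \<le> c"
    "g \<in> borel_measurable borel"
  shows "(\<integral>\<^sup>+z. g z \<partial>qmeasure y) = ennreal c * (\<integral>\<^sup>+z. g z \<partial>qmeasure x)"
proof -
  have "qmeasure y = scale_measure (ennreal c) (qmeasure x)"
    by (rule measure_eqI) (simp_all add: emeasure_qmeasure assms(1) ennreal_mult'[OF assms(2)])
  then show ?thesis
    using assms(3) by (simp add: nn_integral_scale_measure)
qed

lemma nn_integral_qmeasure_lmul: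
  "g \<in> borel_measurable borel \<Longrightarrow>
    (\<integral>\<^sup>+z. g z \<partial>qmeasure (lmul V a x)) = ennreal ((norm a)\<^sup>2) * (\<integral>\<^sup>+z. g z \<partial>qmeasure x)"
  by (rule qmeasure_scale) (simp_all add: E_lmul inner_lmul_same)

lemma nn_integral_qmeasure_rmul:
  "g \<in> borel_measurable borel \<Longrightarrow>
    (\<integral>\<^sup>+z. g z \<partial>qmeasure (rmul V x a)) = ennreal ((norm a)\<^sup>2) * (\<integral>\<^sup>+z. g z \<partial>qmeasure x)"
  by (rule qmeasure_scale) (simp_all add: E_rmul inner_rmul_same)

lemma dom_calculus_lmul: "f \<in> borel_measurable borel \<Longrightarrow> x \<in> dom (calculus f) \<Longrightarrow> lmul V a x \<in> dom (calculus f)"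
  unfolding dom_calculus by (simp add: nn_integral_qmeasure_lmul ennreal_mult_less_top)

lemma dom_calculus_rmul: "f \<in> borel_measurable borel \<Longrightarrow> x \<in> dom (calculus f) \<Longrightarrow> rmul V x a \<in> dom (calculus f)"
  unfolding dom_calculus by (simp add: nn_integral_qmeasure_rmul ennreal_mult_less_top)

lemma calculus_add:
  assumes "f \<in> borel_measurable borel" "calculus f x = Some x'" "calculus f y = Some y'"
  shows "calculus f (x + y) = Some (x' + y')"
  using assms(2,3) unfolding calculus_iff[OF assms(1)]
  by (simp add: linear_add[OF linear_kint[OF bounded_borel_truncation[OF assms(1)]]]
      linear_add[OF linear_E[OF Borel_vimage_le[OF assms(1)]]])

lemma calculus_scaleR:
  assumes "f \<in> borel_measurable borel" "calculus f x = Some x'"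
  shows "calculus f (r *\<^sub>R x) = Some (r *\<^sub>R x')"
  using assms(2) unfolding calculus_iff[OF assms(1)]
  by (simp add: linear_scale[OF linear_kint[OF bounded_borel_truncation[OF assms(1)]]]
      linear_scale[OF linear_E[OF Borel_vimage_le[OF assms(1)]]])

lemma quasilinear_calculus:
  assumes f: "f \<in> borel_measurable borel"
  shows "quasilinear_operator V (calculus f)"
  unfolding quasilinear_operator_def K_subspace_def
proof (intro conjI ballI allI)
  show "0 \<in> dom (calculus f)"
    using calculus_iff[OF f, of 0 0] linear_0[OF linear_kint[OF bounded_borel_truncation[OF f]]]
      linear_0[OF linear_E[OF Borel_vimage_le[OF f]]] by auto
next
  fix x y assume "x \<in> dom (calculus f)" "y \<in> dom (calculus f)"
  then show "x + y \<in> dom (calculus f)" "the (calculus f (x + y)) = the (calculus f x) + the (calculus f y)"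
    using calculus_add[OF f] by fastforce+
next
  fix a :: 'k and x assume "x \<in> dom (calculus f)"
  then show "lmul V a x \<in> dom (calculus f)" "rmul V x a \<in> dom (calculus f)"
    using dom_calculus_lmul dom_calculus_rmul f by blast+
next
  fix r :: real and x assume "x \<in> dom (calculus f)"
  then show "the (calculus f (r *\<^sub>R x)) = r *\<^sub>R the (calculus f x)"
    using calculus_scaleR[OF f] by fastforce
qed

text \<open>Each coordinate of \<open>f\<close> is square integrable for the quadratic measure of the corresponding left
  multiple of \<open>x\<close>, which makes it integrable for the components of the scalar-valued measure and
  serves as a majorant of its truncations.\<close>

lemma nc_integral_calculus:
  assumes f: "f \<in> borel_measurable borel" and w: "calculus f x = Some w"
  shows "nc_integrable (spectral_nc_measure V E x y) f"
    "ip V w y = nc_integral (spectral_nc_measure V E x y) f"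
proof -
  note t = bounded_borel_truncation[OF f]
  let ?f = "\<lambda>v z. f z \<bullet> (hgen v :: 'k)"
  have fin: "(\<integral>\<^sup>+z. ennreal ((?f v z)\<^sup>2) \<partial>qmeasure (lmul V (hgen v) x)) < \<infinity>" if v: "v < DIM('k)" for v
  proof -
    have "(\<integral>\<^sup>+z. ennreal ((?f v z)\<^sup>2) \<partial>qmeasure (lmul V (hgen v) x)) \<le> (\<integral>\<^sup>+z. ennreal ((norm (f z))\<^sup>2) \<partial>qmeasure x)"
    proof -
      have "(?f v z)\<^sup>2 \<le> (norm (f z))\<^sup>2" for z
        using Cauchy_Schwarz_ineq2[of "f z" "hgen v"] norm_hgen[OF v] by (simp add: abs_le_square_iff[symmetric])
      then show ?thesis
        using f norm_hgen[OF v] by (subst nn_integral_qmeasure_lmul) (auto intro!: nn_integral_mono ennreal_leI)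
    qed
    also have "\<dots> < \<infinity>"
    proof -
      have "x \<in> dom (calculus f)" using w by (simp add: dom_def)
      then show ?thesis by (simp add: dom_calculus[OF f])
    qed
    finally show ?thesis .
  qed
  have meas: "?f v \<in> borel_measurable borel" for v
    using f by simp
  show "nc_integrable (spectral_nc_measure V E x y) f"
    unfolding nc_integrable_def nc_component using real_integrable_L2[OF meas fin] by blast
  have "(\<lambda>n. nc_integral (spectral_nc_measure V E x y) (truncation UNIV f n)) \<longlonglongrightarrow>
      nc_integral (spectral_nc_measure V E x y) f"
    unfolding nc_integral_def nc_component
  proof (intro tendsto_sum tendsto_scaleR tendsto_const LIMSEQ_real_integral meas fin)
    fix v n z
    show "(\<lambda>z. truncation UNIV f n z \<bullet> hgen v) \<in> borel_measurable borel"
      using bounded_borelD[OF t[of n]] by simp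
    show "\<bar>truncation UNIV f n z \<bullet> hgen v\<bar> \<le> \<bar>f z \<bullet> hgen v\<bar>"
      by (simp add: truncation_def)
    show "(\<lambda>n. truncation UNIV f n z \<bullet> hgen v) \<longlonglongrightarrow> f z \<bullet> hgen v"
      by (intro tendsto_intros truncation_LIMSEQ)
  qed auto
  moreover have "(\<lambda>n. ip V (kint (truncation UNIV f n) x) y) \<longlonglongrightarrow> ip V w y"
    using bounded_linear.tendsto[OF bounded_linear_ip_left] w by (simp add: calculus_LIMSEQ_iff[OF f])
  ultimately show "ip V w y = nc_integral (spectral_nc_measure V E x y) f"
    unfolding nc_integral_bounded[OF t] using LIMSEQ_unique by blast
qed

subsection \<open>The adjoint\<close>

lemma truncation_hconj: "truncation UNIV (\<lambda>z. hconj (f z)) n = (\<lambda>z. hconj (truncation UNIV f n z))"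
  by (auto simp: truncation_def fun_eq_iff hconj_zero)

lemma borel_measurable_hconj: "f \<in> borel_measurable borel \<Longrightarrow> (\<lambda>z. hconj (f z) :: 'k) \<in> borel_measurable borel"
  unfolding hconj_eq
  by (intro borel_measurable_diff borel_measurable_scaleR borel_measurable_times borel_measurable_inner
      borel_measurable_const)

lemma inner_calculus_adjoint:
  assumes f: "f \<in> borel_measurable borel"
    and x: "calculus f x = Some x'" and y: "calculus (\<lambda>z. hconj (f z)) y = Some y'"
  shows "x' \<bullet> y = x \<bullet> y'"
proof (rule LIMSEQ_unique)
  show "(\<lambda>n. kint (truncation UNIV f n) x \<bullet> y) \<longlonglongrightarrow> x' \<bullet> y"
    using x by (intro tendsto_intros) (simp add: calculus_LIMSEQ_iff[OF f])
  show "(\<lambda>n. kint (truncation UNIV f n) x \<bullet> y) \<longlonglongrightarrow> x \<bullet> y'"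
    using y unfolding kint_adjoint[OF bounded_borel_truncation[OF f]] truncation_hconj[symmetric]
    by (intro tendsto_intros) (simp add: calculus_LIMSEQ_iff[OF borel_measurable_hconj[OF f]])
qed

lemma calculus_rmul:
  assumes f: "f \<in> borel_measurable borel" and x: "calculus f x = Some x'" "x \<in> assoc_part V"
  shows "calculus f (rmul V x c) = Some (rmul V x' c)"
  using x unfolding calculus_iff[OF f]
  by (simp add: kint_rmul bounded_borel_truncation[OF f] E_rmul Borel_vimage_le[OF f])

text \<open>It suffices to test an adjoint value on \<open>X\<^sub>0\<close>: right multiples of the vectors
  \<open>E {|f| \<le> n} u\<close> with \<open>u\<close> in \<open>X\<^sub>0\<close> span a core of \<open>f(T)\<close>.\<close>

lemma adjoint_value_calculus_iff:
  assumes f: "f \<in> borel_measurable borel"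
  shows "adjoint_value V (calculus f) y w \<longleftrightarrow> calculus (\<lambda>z. hconj (f z)) y = Some w"
proof
  assume w: "calculus (\<lambda>z. hconj (f z)) y = Some w"
  show "adjoint_value V (calculus f) y w"
    unfolding adjoint_value_def
  proof
    fix x assume x: "x \<in> dom (calculus f) \<inter> assoc_part V"
    then obtain x' where x': "calculus f x = Some x'" by (auto simp: dom_def)
    have "rmul V x' c \<bullet> y = rmul V x c \<bullet> w" for c
      using x calculus_rmul[OF f x'] by (intro inner_calculus_adjoint[OF f _ w]) auto
    then show "ip V (the (calculus f x)) y = ip V x w"
      unfolding x' by (intro ip_eqI) simp
  qed
next
  assume w: "adjoint_value V (calculus f) y w"
  let ?B = "\<lambda>n. {z. norm (f z) \<le> real n}"
  note B = Borel_vimage_le[OF f] and t = bounded_borel_truncation[OF f]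
  show "calculus (\<lambda>z. hconj (f z)) y = Some w"
    unfolding calculus_iff[OF borel_measurable_hconj[OF f]] truncation_hconj norm_hconj
  proof (rule allI, rule vector_eq_ldot[THEN iffD1, rule_format])
    fix n x
    show "x \<bullet> kint (\<lambda>z. hconj (truncation UNIV f n z)) y = x \<bullet> E (?B n) 1 w"
    proof (rule linear_eq_on_part_0[where x = x])
      fix u p assume u: "u \<in> part V 0"
      then have u': "u \<in> assoc_part V" "E (?B n) 1 u \<in> assoc_part V"
        using part_0_subset_assoc E_part_0[OF B u] by auto
      have "E (?B n) 1 u \<in> dom (calculus f) \<inter> assoc_part V"
        using calculus_E[OF f, of n u] u'(2) by (simp add: dom_def)
      with w have "ip V (the (calculus f (E (?B n) 1 u))) y = ip V (E (?B n) 1 u) w"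
        unfolding adjoint_value_def by (rule bspec)
      then have ip: "ip V (kint (truncation UNIV f n) u) y = ip V (E (?B n) 1 u) w"
        by (simp add: calculus_E[OF f])
      have "rmul V u (hgen p) \<bullet> kint (\<lambda>z. hconj (truncation UNIV f n z)) y =
        rmul V (kint (truncation UNIV f n) u) (hgen p) \<bullet> y"
        by (simp only: kint_adjoint[OF t, symmetric] kint_rmul[OF t u'(1)])
      also have "\<dots> = rmul V (E (?B n) 1 u) (hgen p) \<bullet> w"
        using arg_cong[OF ip, of "\<lambda>z. z \<bullet> hgen p"] by (simp only: ip_inner)
      also have "\<dots> = rmul V u (hgen p) \<bullet> E (?B n) 1 w"
        by (simp only: E_rmul[OF B, symmetric] symmetric_P[OF B])
      finally show "rmul V u (hgen p) \<bullet> kint (\<lambda>z. hconj (truncation UNIV f n z)) y = rmul V u (hgen p) \<bullet> E (?B n) 1 w" .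
    qed (auto intro!: linearI simp: inner_add_left)
  qed
qed

lemma continuous_on_calculus_ip:
  assumes f: "f \<in> borel_measurable borel" and y: "y \<in> dom (calculus (\<lambda>z. hconj (f z)))"
  shows "continuous_on (dom (calculus f)) (\<lambda>x. ip V (the (calculus f x)) y)"
proof -
  let ?g = "\<lambda>c. the (calculus (\<lambda>z. hconj (f z)) (rmul V y (hconj c)))"
  have "ip V (the (calculus f x)) y = (\<Sum>l<DIM('k). (x \<bullet> ?g (hgen l)) *\<^sub>R hgen l)"
    if x: "x \<in> dom (calculus f)" for x
  proof -
    obtain x' where x': "calculus f x = Some x'" using x by (auto simp: dom_def)
    have "x' \<bullet> rmul V y (hconj c) = x \<bullet> ?g c" for c
    proof -
      have "rmul V y (hconj c) \<in> dom (calculus (\<lambda>z. hconj (f z)))"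
        using borel_measurable_hconj[OF f] y by (rule dom_calculus_rmul)
      then obtain w where "calculus (\<lambda>z. hconj (f z)) (rmul V y (hconj c)) = Some w" by (auto simp: dom_def)
      then show ?thesis
        using inner_calculus_adjoint[OF f x'] by simp
    qed
    then have "ip V x' y \<bullet> c = x \<bullet> ?g c" for c
      by (simp add: ip_inner inner_rmul_adjoint)
    then show ?thesis
      using hgen_expansion[of "ip V x' y"] x' by simp
  qed
  then show ?thesis
    by (subst continuous_on_cong[OF refl, where g = "\<lambda>x. \<Sum>l<DIM('k). (x \<bullet> ?g (hgen l)) *\<^sub>R hgen l"])
      (auto intro!: continuous_intros)
qed

lemma adjoint_calculus:
  assumes f: "f \<in> borel_measurable borel"
  shows "adjoint_op V (calculus f) = calculus (\<lambda>z. hconj (f z))"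
proof
  fix y
  show "adjoint_op V (calculus f) y = calculus (\<lambda>z. hconj (f z)) y"
  proof (cases "calculus (\<lambda>z. hconj (f z)) y")
    case None
    then show ?thesis
      by (simp add: adjoint_op_def adjoint_value_calculus_iff[OF f])
  next
    case (Some w)
    then have "y \<in> dom (calculus (\<lambda>z. hconj (f z)))" by blast
    then have "continuous_on (dom (calculus f)) (\<lambda>x. ip V (the (calculus f x)) y)"
      by (rule continuous_on_calculus_ip[OF f])
    moreover have "adjoint_value V (calculus f) y = (\<lambda>v. v = w)"
      using Some by (auto simp: fun_eq_iff adjoint_value_calculus_iff[OF f])
    ultimately show ?thesis
      using Some by (simp add: adjoint_op_def)
  qed
qed

end

section \<open>The selfadjoint operator and its resolvent\<close>

text \<open>The coordinate on the real line, extended by \<open>0\<close>. Integrals over real intervals see nothing of \<open>E\<close> off the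
  line, so this extension describes \<open>T\<close> before \<open>E\<close> is known to live on the line.\<close>

definition line_part :: "'k::hypercomplex \<Rightarrow> real" where
  "line_part z = indicator (range hreal) z * (z \<bullet> 1)"

definition line_fun :: "'k::hypercomplex \<Rightarrow> 'k" where
  "line_fun z = line_part z *\<^sub>R 1"

lemma borel_range_hreal [simp, measurable]: "range hreal \<in> sets (borel :: 'k::hypercomplex measure)"
proof -
  have "range hreal = {z :: 'k. z = (z \<bullet> 1) *\<^sub>R 1}"
    using range_hreal_iff by blast
  moreover have "closed {z :: 'k. z = (z \<bullet> 1) *\<^sub>R 1}"
    by (intro closed_Collect_eq continuous_intros)
  ultimately show ?thesis by simp
qed

lemma line_fun_eq: "line_fun z = indicator (range hreal) z *\<^sub>R (z :: 'k::hypercomplex)"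
  using range_hreal_iff[of z] by (auto simp: line_fun_def line_part_def indicator_def)

lemma norm_1_hypercomplex [simp]: "norm (1 :: 'k::hypercomplex) = 1"
  by (simp add: norm_eq_sqrt_inner inner_1_1)

lemma norm_line_fun: "norm (line_fun z :: 'k::hypercomplex) = \<bar>line_part z\<bar>"
  by (simp add: line_fun_def)

lemma borel_line_part [measurable]: "(line_part :: 'k::hypercomplex \<Rightarrow> real) \<in> borel_measurable borel"
  unfolding line_part_def by measurable

lemma borel_line_fun [measurable]: "(line_fun :: 'k::hypercomplex \<Rightarrow> 'k) \<in> borel_measurable borel"
  unfolding line_fun_def by measurable

lemma hconj_line_fun: "hconj (line_fun z) = line_fun z"
  by (simp add: line_fun_def hconj_scaleR hconj_1)

lemma norm_diff_line_fun:
  "(norm (q - line_fun z))\<^sup>2 = (norm q)\<^sup>2 - 2 * (q \<bullet> 1) * line_part z + (line_part z)\<^sup>2" for q :: "'k::hypercomplex"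
  unfolding power2_norm_eq_inner
  by (simp add: line_fun_def inner_diff_left inner_diff_right inner_1_1 inner_commute power2_eq_square algebra_simps)

lemma hreal_inject: "hreal r = (hreal s :: 'k::hypercomplex) \<longleftrightarrow> r = s"
  unfolding hreal_def using arg_cong[of "r *\<^sub>R (1::'k)" "s *\<^sub>R 1" "\<lambda>z. z \<bullet> 1"] by (auto simp: inner_1_1)

lemma interval_indicator:
  "indicator (hreal ` {- real n..real n}) z *\<^sub>R z = truncation UNIV line_fun n (z :: 'k::hypercomplex)"
proof (cases "z \<in> range hreal")
  case True
  then obtain r where z: "z = hreal r" by blast
  then have "z \<in> hreal ` {- real n..real n} \<longleftrightarrow> \<bar>r\<bar> \<le> real n"
    by (auto simp: hreal_inject image_iff)
  then show ?thesis
    using True by (simp add: truncation_def line_fun_eq indicator_def) (simp add: z hreal_def)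
next
  case False
  then show ?thesis
    by (auto simp: truncation_def line_fun_eq indicator_def)
qed

locale selfadjoint_spectral = spectral_hilbert_space V T E
  for V :: "('k::hypercomplex, 'x::{real_inner, complete_space}) kspace"
    and T :: "'x \<rightharpoonup> 'x"
    and E :: "'k set \<Rightarrow> 'k \<Rightarrow> 'x \<Rightarrow> 'x" +
  assumes selfadjoint_T: "selfadjoint V T"
begin

lemma T_le_calculus:
  assumes "T x = Some y"
  shows "calculus line_fun x = Some y"
proof -
  have "(\<lambda>n. spectral_integral V E (hreal ` {- real n..real n}) (\<lambda>z. z) x) \<longlonglongrightarrow> y"
    using limit_T[of x] assms by auto
  moreover have "spectral_integral V E (hreal ` {- real n..real n}) (\<lambda>z. z) x = kint (truncation UNIV line_fun n) x" for n
    using bounded_borel_truncation[OF borel_line_fun, of n] by (subst spectral_integral_eq) (simp_all add: interval_indicator)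
  ultimately show ?thesis
    by (simp add: calculus_LIMSEQ_iff)
qed

text \<open>\<open>T\<close> is contained in the selfadjoint operator \<open>\<integral> E(dz).z\<close>; as the adjoint reverses inclusions,
  a selfadjoint operator has no proper selfadjoint extension.\<close>

lemma T_eq_calculus: "T = calculus line_fun"
proof
  fix y
  show "T y = calculus line_fun y"
  proof (cases "T y")
    case (Some y')
    then show ?thesis using T_le_calculus by simp
  next
    case None
    have "calculus line_fun y = None"
    proof (rule ccontr)
      assume "calculus line_fun y \<noteq> None"
      then obtain w where w: "calculus line_fun y = Some w" by blast
      have sub: "dom T \<subseteq> dom (calculus line_fun)"
        and eq: "\<And>x. x \<in> dom T \<Longrightarrow> the (T x) = the (calculus line_fun x)"
        using T_le_calculus by (fastforce simp: dom_def)+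
      have y: "y \<in> dom (calculus (\<lambda>z. hconj (line_fun z)))"
        using w by (simp add: hconj_line_fun dom_def)
      have "adjoint_value V (calculus line_fun) y w"
        by (simp add: adjoint_value_calculus_iff hconj_line_fun w)
      then have "adjoint_value V T y w"
        unfolding adjoint_value_def using sub by (simp add: eq subset_iff)
      moreover have "continuous_on (dom T) (\<lambda>x. ip V (the (T x)) y)"
        using continuous_on_subset[OF continuous_on_calculus_ip[OF borel_line_fun y] sub]
        by (rule continuous_on_eq) (simp add: eq)
      ultimately have "adjoint_op V T y \<noteq> None"
        unfolding adjoint_op_def by auto
      then show False
        using None selfadjoint_T by (simp add: selfadjoint_def)
    qed
    then show ?thesis using None by simp
  qed
qed

abbreviation level :: "nat \<Rightarrow> 'k set" where
  "level n \<equiv> {z. norm (line_fun z) \<le> real n}"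

definition cut_part :: "nat \<Rightarrow> 'k \<Rightarrow> real" where
  "cut_part n z = indicator (level n) z * line_part z"

lemma level_borel [simp]: "level n \<in> sets borel"
  by (rule Borel_vimage_le[OF borel_line_fun])

lemma bounded_borel_cut_part: "bounded_borel (cut_part n)"
proof (rule bounded_borelI)
  have [measurable]: "level n \<in> sets borel" by (rule level_borel)
  show "cut_part n \<in> borel_measurable borel"
    unfolding cut_part_def by measurable
  show "norm (cut_part n z) \<le> real n" for z
    by (auto simp: cut_part_def indicator_def norm_line_fun)
qed

lemma T_iff: "T x = Some y \<longleftrightarrow> (\<forall>n. sint (cut_part n) x = E (level n) 1 y)"
proof -
  have "truncation UNIV line_fun n = (\<lambda>z. cut_part n z *\<^sub>R 1 :: 'k)" for n
    by (auto simp: truncation_UNIV line_fun_def cut_part_def fun_eq_iff)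
  then show ?thesis
    unfolding T_eq_calculus calculus_iff[OF borel_line_fun] by (simp add: kint_scaleR_const bounded_borel_cut_part)
qed

subsection \<open>The resolvent\<close>

text \<open>For real \<open>\<lambda>\<close> the inverse of \<open>q - \<lambda>\<close> is \<open>\<alpha> q\<^sup>\<sim> - \<alpha> \<lambda>\<close> with
  \<open>\<alpha> = |q - \<lambda>|\<^sup>-\<^sup>2\<close>; the two real functions are kept apart so that the
  bounded real calculus applies to them, restricted to a set on which \<open>\<alpha>\<close> is bounded.\<close>

definition res_a :: "'k \<Rightarrow> 'k set \<Rightarrow> 'k \<Rightarrow> real" where
  "res_a q B z = indicator B z / (norm (q - line_fun z))\<^sup>2"

definition res_b :: "'k \<Rightarrow> 'k set \<Rightarrow> 'k \<Rightarrow> real" where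
  "res_b q B z = res_a q B z * line_part z"

definition res_op :: "'k \<Rightarrow> 'k set \<Rightarrow> 'x \<Rightarrow> 'x" where
  "res_op q B x = sint (res_a q B) (lmul V (hconj q) x) - sint (res_b q B) x"

definition res_set :: "'k \<Rightarrow> 'k set \<Rightarrow> bool" where
  "res_set q B \<longleftrightarrow> B \<in> sets borel \<and> (\<exists>c>0. \<forall>z\<in>B. c \<le> norm (q - line_fun z))"

text \<open>The square of \<open>\<lambda>\<close> is at most \<open>2 |q - \<lambda>|\<^sup>2 + 2 |q|\<^sup>2\<close>, so that even \<open>\<alpha> \<lambda>\<^sup>2\<close> is bounded where
  \<open>|q - \<lambda>|\<close> is bounded away from \<open>0\<close>.\<close>

lemma bounded_borel_res:
  assumes B: "res_set q B"
  shows "bounded_borel (res_a q B)" "bounded_borel (res_b q B)" "bounded_borel (\<lambda>z. res_b q B z * line_part z)"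
proof -
  obtain c where c: "c > 0" "\<And>z. z \<in> B \<Longrightarrow> c \<le> norm (q - line_fun z)" and [measurable]: "B \<in> sets borel"
    using B by (auto simp: res_set_def)
  have meas [measurable]: "res_a q B \<in> borel_measurable borel" "res_b q B \<in> borel_measurable borel"
    unfolding res_a_def[abs_def] res_b_def[abs_def] by measurable
  have nonneg: "0 \<le> res_a q B z" for z
    by (simp add: res_a_def)
  have a: "res_a q B z \<le> 1 / c\<^sup>2" for z
  proof (cases "z \<in> B")
    case True
    then show ?thesis
      using c by (auto simp: res_a_def intro!: frac_le power_mono)
  qed (simp add: res_a_def)
  show "bounded_borel (res_a q B)"
    using a nonneg by (intro bounded_borelI[of _ "1 / c\<^sup>2"] meas) auto
  have sq: "res_a q B z * (line_part z)\<^sup>2 \<le> 2 + 2 * (norm q)\<^sup>2 / c\<^sup>2" for z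
  proof (cases "z \<in> B")
    case True
    let ?d = "norm (q - line_fun z)"
    have d: "0 < ?d\<^sup>2"
      by (rule zero_less_power) (rule less_le_trans[OF c(1) c(2)[OF True]])
    have "\<bar>line_part z\<bar> \<le> norm q + ?d"
      using norm_triangle_sub[of "line_fun z" q] by (simp add: norm_line_fun norm_minus_commute)
    then have "(line_part z)\<^sup>2 \<le> (norm q + ?d)\<^sup>2"
      by (simp add: abs_le_square_iff[symmetric])
    also have "\<dots> \<le> 2 * ?d\<^sup>2 + 2 * (norm q)\<^sup>2"
      using zero_le_power2[of "norm q - ?d"] by (simp add: power2_eq_square algebra_simps)
    finally have "res_a q B z * (line_part z)\<^sup>2 \<le> res_a q B z * (2 * ?d\<^sup>2 + 2 * (norm q)\<^sup>2)"
      using nonneg by (rule mult_left_mono)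
    also have "\<dots> = 2 + 2 * (norm q)\<^sup>2 * res_a q B z"
      using True d by (simp add: res_a_def field_simps)
    also have "\<dots> \<le> 2 + 2 * (norm q)\<^sup>2 * (1 / c\<^sup>2)"
      using a by (intro add_left_mono mult_left_mono) auto
    finally show ?thesis by simp
  qed (simp add: res_a_def)
  have "\<bar>res_b q B z * line_part z\<bar> \<le> 2 + 2 * (norm q)\<^sup>2 / c\<^sup>2" for z
    using sq[of z] nonneg[of z] by (simp add: res_b_def power2_eq_square abs_mult mult.assoc)
  then show "bounded_borel (\<lambda>z. res_b q B z * line_part z)"
    by (intro bounded_borelI[where C = "2 + 2 * (norm q)\<^sup>2 / c\<^sup>2"]) auto
  have "\<bar>res_b q B z\<bar> \<le> 1 / c\<^sup>2 + (2 + 2 * (norm q)\<^sup>2 / c\<^sup>2)" for z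
  proof -
    have "\<bar>line_part z\<bar> \<le> 1 + (line_part z)\<^sup>2"
      using zero_le_power2[of "\<bar>line_part z\<bar> - 1"] abs_ge_zero[of "line_part z"]
      by (simp add: power2_eq_square algebra_simps)
    then have "\<bar>res_b q B z\<bar> \<le> res_a q B z * (1 + (line_part z)\<^sup>2)"
      using nonneg[of z] by (simp add: res_b_def abs_mult mult_left_mono)
    then show ?thesis
      using a[of z] sq[of z] by (simp add: algebra_simps)
  qed
  then show "bounded_borel (res_b q B)"
    by (intro bounded_borelI[where C = "1 / c\<^sup>2 + (2 + 2 * (norm q)\<^sup>2 / c\<^sup>2)"] meas) auto
qed

lemma res_identity:
  assumes "res_set q B"
  shows "(norm q)\<^sup>2 * res_a q B z - 2 * (q \<bullet> 1) * res_b q B z + res_b q B z * line_part z = indicator B z"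
proof (cases "z \<in> B")
  case True
  then have "norm (q - line_fun z) \<noteq> 0"
    using assms by (force simp: res_set_def)
  then have "(norm (q - line_fun z))\<^sup>2 * res_a q B z = 1"
    using True by (simp add: res_a_def)
  then have "((norm q)\<^sup>2 - 2 * (q \<bullet> 1) * line_part z + (line_part z)\<^sup>2) * res_a q B z = 1"
    unfolding norm_diff_line_fun .
  then show ?thesis
    using True by (simp add: res_b_def power2_eq_square algebra_simps)
qed (simp add: res_a_def res_b_def)

lemma linear_res_op:
  assumes "res_set q B"
  shows "bounded_linear (res_op q B)"
  unfolding res_op_def[abs_def] using bounded_borel_res[OF assms]
  by (intro bounded_linear_sub bounded_linear_compose[OF bounded_linear_sint bounded_linear_lmul] bounded_linear_sint)

lemma lmul_hconj_lmul: "lmul V (hconj q) (lmul V q x) = (norm q)\<^sup>2 *\<^sub>R x" "lmul V q (lmul V (hconj q) x) = (norm q)\<^sup>2 *\<^sub>R x"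
  by (simp_all add: hconj_eq linear_diff[OF linear_lmul_scalar] linear_diff[OF linear_lmul] lmul_scaleR_left
      linear_scale[OF linear_lmul] lmul_lmul_self hmult_self)

lemma lmul_hconj_add: "lmul V (hconj q) x + lmul V q x = (2 * (q \<bullet> 1)) *\<^sub>R x"
  by (simp add: hconj_eq linear_diff[OF linear_lmul_scalar] lmul_scaleR_left)

lemma lmul_hconj_eq: "lmul V (hconj q) x = (2 * (q \<bullet> 1)) *\<^sub>R x - lmul V q x"
  using lmul_hconj_add[of q x] by (simp add: algebra_simps)

text \<open>The left inverse, localized to the part of the spectrum in \<open>B\<close>. It is enough to compare both
  sides on the sets where \<open>\<lambda>\<close> is bounded.\<close>

lemma res_op_left_inverse:
  assumes B: "res_set q B" and y: "y \<in> dom T"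
  shows "res_op q B (lmul V q y - the (T y)) = E B 1 y"
proof -
  define x where "x = lmul V q y - the (T y)"
  have T: "sint (cut_part n) y = E (level n) 1 (the (T y))" for n
    using y T_iff[of y "the (T y)"] by (simp add: dom_def)
  note bb = bounded_borel_res[OF B] and cut = bounded_borel_cut_part
    and ind = bounded_borel_indicator[OF level_borel]
  have B': "B \<in> sets borel" using B by (simp add: res_set_def)
  have main: "E (level n) 1 (res_op q B x) = E (level n) 1 (E B 1 y)" for n
  proof -
    let ?a = "res_a q B" and ?b = "res_b q B" and ?i = "indicator (level n) :: 'k \<Rightarrow> real" and ?c = "cut_part n"
    have Ex: "sint ?i x = lmul V q (sint ?i y) - sint ?c y"
      by (simp add: x_def linear_diff[OF linear_E] sint_indicator T E_lmul)
    have ai: "(\<lambda>z. ?a z * ?c z) = (\<lambda>z. ?i z * ?b z)"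
      by (auto simp: fun_eq_iff cut_part_def res_b_def)
    have "sint ?i (res_op q B x) = sint ?a (lmul V (hconj q) (sint ?i x)) - sint ?b (sint ?i x)"
      by (simp add: res_op_def linear_diff[OF linear_sint[OF ind]] sint_sint bb ind mult.commute flip: sint_lmul[OF ind])
    also have "\<dots> = (norm q)\<^sup>2 *\<^sub>R sint ?a (sint ?i y) - sint ?a (sint ?c (lmul V (hconj q) y))
        - sint ?b (sint ?i (lmul V q y)) + sint ?b (sint ?c y)"
      by (simp add: Ex linear_diff[OF linear_lmul] linear_diff[OF linear_sint] bb lmul_hconj_lmul
          linear_scale[OF linear_sint] sint_lmul[OF ind] sint_lmul[OF cut])
    also have "\<dots> = (norm q)\<^sup>2 *\<^sub>R sint ?a (sint ?i y)
        - (sint ?a (sint ?c (lmul V (hconj q) y)) + sint ?b (sint ?i (lmul V q y))) + sint ?b (sint ?c y)"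
      by simp
    also have "sint ?a (sint ?c (lmul V (hconj q) y)) + sint ?b (sint ?i (lmul V q y)) =
      (2 * (q \<bullet> 1)) *\<^sub>R sint (\<lambda>z. ?i z * ?b z) y"
    proof -
      have ib: "linear (sint (\<lambda>z. ?i z * ?b z))"
        by (intro linear_sint bounded_borel_mult ind bb)
      have "sint ?a (sint ?c (lmul V (hconj q) y)) = sint (\<lambda>z. ?i z * ?b z) (lmul V (hconj q) y)"
        by (simp only: sint_sint bb cut ai)
      moreover have "sint ?b (sint ?i (lmul V q y)) = sint (\<lambda>z. ?i z * ?b z) (lmul V q y)"
        by (simp only: sint_sint bb ind mult.commute[of "?b _" "?i _"])
      ultimately show ?thesis
        by (simp only: lmul_hconj_add linear_scale[OF ib] flip: linear_add[OF ib])
    qed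
    also have "sint ?a (sint ?i y) = sint (\<lambda>z. ?a z * ?i z) y"
      by (simp only: sint_sint bb ind)
    also have "sint ?b (sint ?c y) = sint (\<lambda>z. ?b z * ?c z) y"
      by (simp only: sint_sint bb cut)
    also have "(norm q)\<^sup>2 *\<^sub>R sint (\<lambda>z. ?a z * ?i z) y - (2 * (q \<bullet> 1)) *\<^sub>R sint (\<lambda>z. ?i z * ?b z) y
        + sint (\<lambda>z. ?b z * ?c z) y =
      sint (\<lambda>z. (norm q)\<^sup>2 * (?a z * ?i z) - (2 * (q \<bullet> 1)) * (?i z * ?b z) + ?b z * ?c z) y"
      by (simp only: sint_add sint_diff sint_cmult bounded_borel_arith bounded_borel_mult bounded_borel_const bb ind cut)
    also have "(\<lambda>z. (norm q)\<^sup>2 * (?a z * ?i z) - (2 * (q \<bullet> 1)) * (?i z * ?b z) + ?b z * ?c z) =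
      (\<lambda>z. ?i z * indicator B z)"
      by (simp add: fun_eq_iff cut_part_def algebra_simps flip: res_identity[OF B])
    also have "sint (\<lambda>z. ?i z * indicator B z) y = sint ?i (E B 1 y)"
      by (simp add: sint_sint ind bounded_borel_indicator B' flip: sint_indicator[OF B'])
    finally show ?thesis
      by (simp add: sint_indicator)
  qed
  have lim: "(\<lambda>n. E (level n) 1 w) \<longlonglongrightarrow> w" for w
    by (rule E_LIMSEQ_norm[OF borel_line_fun])
  have "(\<lambda>n. E (level n) 1 (E B 1 y)) \<longlonglongrightarrow> res_op q B x"
    using lim[of "res_op q B x"] by (simp only: main)
  then show ?thesis
    unfolding x_def[symmetric] using lim LIMSEQ_unique by blast
qed

lemma res_op_right_inverse:
  assumes B: "res_set q UNIV"
  shows "T (res_op q UNIV x) = Some (lmul V q (res_op q UNIV x) - x)"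
proof -
  let ?a = "res_a q UNIV" and ?b = "res_b q UNIV" and ?d = "\<lambda>z. res_b q UNIV z * line_part z"
  note bb = bounded_borel_res[OF B]
  have "T (res_op q UNIV x) = Some (sint ?b (lmul V (hconj q) x) - sint ?d x)"
    unfolding T_iff
  proof
    fix n
    have "(\<lambda>z. cut_part n z * ?a z) = (\<lambda>z. indicator (level n) z * ?b z)"
      "(\<lambda>z. cut_part n z * ?b z) = (\<lambda>z. indicator (level n) z * ?d z)"
      by (auto simp: fun_eq_iff cut_part_def res_b_def)
    then show "sint (cut_part n) (res_op q UNIV x) = E (level n) 1 (sint ?b (lmul V (hconj q) x) - sint ?d x)"
      by (simp add: res_op_def linear_diff[OF linear_sint] bounded_borel_cut_part sint_sint bb
          bounded_borel_indicator flip: sint_indicator)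
  qed
  also have "sint ?b (lmul V (hconj q) x) - sint ?d x = lmul V q (res_op q UNIV x) - x"
  proof -
    have "x = sint (\<lambda>z. (norm q)\<^sup>2 * ?a z - 2 * (q \<bullet> 1) * ?b z + ?d z) x"
      by (simp add: res_identity[OF B] sint_1)
    also have "\<dots> = (norm q)\<^sup>2 *\<^sub>R sint ?a x - (2 * (q \<bullet> 1)) *\<^sub>R sint ?b x + sint ?d x"
      by (simp only: sint_add sint_diff sint_cmult bounded_borel_arith bounded_borel_mult bounded_borel_const bb)
    finally have "x = (norm q)\<^sup>2 *\<^sub>R sint ?a x - (2 * (q \<bullet> 1)) *\<^sub>R sint ?b x + sint ?d x" .
    moreover have "lmul V q (res_op q UNIV x) = (norm q)\<^sup>2 *\<^sub>R sint ?a x - sint ?b (lmul V q x)"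
      by (simp add: res_op_def linear_diff[OF linear_lmul] bb linear_scale[OF linear_sint] lmul_hconj_lmul
          flip: sint_lmul)
    moreover have "sint ?b (lmul V (hconj q) x) = (2 * (q \<bullet> 1)) *\<^sub>R sint ?b x - sint ?b (lmul V q x)"
      by (simp add: lmul_hconj_eq linear_diff[OF linear_sint] linear_scale[OF linear_sint] bb)
    moreover have "s - d = l - x" if "x = a - b + d" "l = a - c" "s = b - c" for a b c d l s x :: 'x
      using that by simp
    ultimately show ?thesis by blast
  qed
  finally show ?thesis .
qed

text \<open>The distance of a non-real \<open>q\<close> from the line is positive, so no cut-off is needed.\<close>

lemma nonreal_resolvent_set:
  assumes q: "q \<notin> range hreal"
  shows "q \<in> resolvent_set V T"
proof -
  have B: "res_set q UNIV"
    unfolding res_set_def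
  proof (intro conjI exI ballI)
    let ?c = "norm (q - (q \<bullet> 1) *\<^sub>R 1)"
    show "0 < ?c"
      using q by (simp add: range_hreal_iff)
    fix z
    have "?c\<^sup>2 = (norm q)\<^sup>2 - (q \<bullet> 1)\<^sup>2"
      unfolding power2_norm_eq_inner
      by (simp add: inner_diff_left inner_diff_right inner_1_1 inner_commute power2_eq_square algebra_simps)
    also have "\<dots> \<le> (norm (q - line_fun z))\<^sup>2"
      unfolding norm_diff_line_fun using zero_le_power2[of "q \<bullet> 1 - line_part z"]
      by (simp add: power2_eq_square algebra_simps)
    finally show "?c \<le> norm (q - line_fun z)"
      by (rule power2_le_imp_le) simp
  qed simp
  have "is_resolvent V T q (res_op q UNIV)"
    unfolding is_resolvent_def
    using linear_res_op[OF B] res_op_right_inverse[OF B] res_op_left_inverse[OF B] by (auto simp: unity)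
  then show ?thesis
    by (auto simp: resolvent_set_def)
qed

lemma E_nonreal:
  assumes "\<delta> \<in> sets borel" "\<delta> \<inter> range hreal = {}"
  shows "E \<delta> 1 x = 0"
  using resolvent_null[OF assms(1)] nonreal_resolvent_set assms(2) by blast

lemma E_real:
  assumes "\<delta> \<in> sets borel"
  shows "E (\<delta> \<inter> range hreal) 1 x = E \<delta> 1 x"
proof -
  have "E ((\<delta> \<inter> range hreal) \<union> (\<delta> - range hreal)) 1 x = E (\<delta> \<inter> range hreal) 1 x + E (\<delta> - range hreal) 1 x"
    using assms by (intro P_Un) auto
  moreover have "E (\<delta> - range hreal) 1 x = 0"
    using assms by (intro E_nonreal) auto
  moreover have "(\<delta> \<inter> range hreal) \<union> (\<delta> - range hreal) = \<delta>" by blast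
  ultimately show ?thesis by simp
qed

lemma calculus_line:
  assumes f: "f \<in> borel_measurable borel"
  shows "calculus f = calculus (\<lambda>z. indicator (range hreal) z *\<^sub>R f z)"
proof
  fix x
  have g: "(\<lambda>z. indicator (range hreal) z *\<^sub>R f z) \<in> borel_measurable borel"
    using f by measurable
  have "kint (truncation UNIV (\<lambda>z. indicator (range hreal) z *\<^sub>R f z) n) x = kint (truncation UNIV f n) x" for n
  proof -
    have "truncation UNIV (\<lambda>z. indicator (range hreal) z *\<^sub>R f z) n =
      (\<lambda>z. indicator (range hreal) z *\<^sub>R truncation UNIV f n z)"
      by (auto simp: truncation_def indicator_def fun_eq_iff)
    then show ?thesis
      using kint_indicator(1)[OF borel_range_hreal bounded_borel_truncation[OF f]] E_real[of UNIV x] unity by simp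
  qed
  then show "calculus f x = calculus (\<lambda>z. indicator (range hreal) z *\<^sub>R f z) x"
    by (simp add: calculus_eq f g)
qed

lemma resolvent_eqI:
  assumes R: "is_resolvent V T q R"
  shows "resolvent V q T = R"
  unfolding resolvent_def
proof (rule the_equality)
  show "is_resolvent V T q R" by (rule R)
  fix R' assume "is_resolvent V T q R'"
  then show "R' = R"
    using R by (auto simp: is_resolvent_def fun_eq_iff) metis
qed

text \<open>With \<open>y = R(q; T) x\<close> the vector \<open>x\<close> is \<open>(q - T) y\<close>. Cutting off the inverse of
  \<open>q - z\<close> where it exceeds \<open>n\<close> gives the projection of \<open>y\<close> to a level set, because
  \<open>E\<close> vanishes at \<open>q\<close> itself and off the real line.\<close>

lemma calculus_resolvent:
  assumes q: "q \<in> resolvent_set V T"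
  shows "calculus (\<lambda>z. indicator (range hreal) z *\<^sub>R hinverse (q - z)) x = Some (resolvent V q T x)"
proof -
  obtain R where R: "is_resolvent V T q R"
    using q by (auto simp: resolvent_set_def)
  define y where "y = R x"
  have y: "y \<in> dom T" "lmul V q y - the (T y) = x"
    using R by (auto simp: is_resolvent_def y_def)
  let ?f = "\<lambda>z. indicator (range hreal) z *\<^sub>R hinverse (q - z)"
  have f: "?f \<in> borel_measurable borel"
    unfolding hinverse_def hconj_eq by measurable
  have "kint (truncation UNIV ?f n) x = E {z. norm (?f z) \<le> real n} 1 y" for n
  proof -
    define B where "B = {z. norm (?f z) \<le> real n} \<inter> range hreal - {q}"
    have nf: "{z. norm (?f z) \<le> real n} \<in> sets borel"
      by (rule Borel_vimage_le[OF f])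
    have norm_f: "norm (?f z) = 1 / norm (q - z)" if "z \<in> B" for z
      using that by (auto simp: B_def hinverse_def divide_simps power2_eq_square)
    have line: "line_fun z = z" if "z \<in> B" for z
      using that by (simp add: B_def line_fun_eq)
    have B: "res_set q B"
      unfolding res_set_def
    proof (intro conjI exI ballI)
      show "B \<in> sets borel" unfolding B_def using nf by auto
      show "0 < 1 / (real n + 1)" by simp
      fix z assume z: "z \<in> B"
      then have "1 / norm (q - z) \<le> real n + 1" "0 < norm (q - z)"
        using norm_f[OF z] by (auto simp: B_def)
      then show "1 / (real n + 1) \<le> norm (q - line_fun z)"
        unfolding line[OF z] by (simp add: field_simps)
    qed
    have t: "truncation UNIV ?f n = (\<lambda>z. res_a q B z *\<^sub>R hconj q - res_b q B z *\<^sub>R 1)"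
    proof
      fix z
      show "truncation UNIV ?f n z = res_a q B z *\<^sub>R hconj q - res_b q B z *\<^sub>R 1"
      proof (cases "z \<in> B")
        case True
        have "hconj (q - z) = hconj q - line_fun z"
          using hconj_line_fun[of z] line[OF True] linear_diff[OF linear_hconj] by metis
        then have "hconj (q - z) = hconj q - line_part z *\<^sub>R 1"
          by (simp add: line_fun_def)
        moreover have "truncation UNIV ?f n z = hconj (q - z) /\<^sub>R (norm (q - z))\<^sup>2"
        proof -
          have "indicator (range hreal) z = (1::real)" "norm (?f z) \<le> real n"
            using True by (auto simp: B_def)
          then show ?thesis by (simp add: truncation_def hinverse_def)
        qed
        moreover have "res_a q B z = inverse ((norm (q - z))\<^sup>2)"
          using True by (simp add: res_a_def line[OF True] divide_inverse)
        ultimately show ?thesis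
          by (simp add: res_b_def scaleR_diff_right)
      next
        case False
        then consider "z \<notin> range hreal" | "z = q" | "\<not> norm (?f z) \<le> real n"
          unfolding B_def by blast
        then have "truncation UNIV ?f n z = 0"
          by cases (simp_all add: truncation_def hinverse_def hconj_zero)
        then show ?thesis using False by (simp add: res_a_def res_b_def)
      qed
    qed
    have "kint (truncation UNIV ?f n) x = res_op q B x"
      unfolding t res_op_def using bounded_borel_res[OF B]
      by (subst kint_diff) (simp_all add: kint_scaleR_const bounded_borel_scaleR bounded_borel_const)
    also have "\<dots> = E B 1 y"
      using res_op_left_inverse[OF B y(1)] y(2) by simp
    also have "\<dots> = E ({z. norm (?f z) \<le> real n} \<inter> range hreal) 1 y"
    proof -
      let ?A = "{z. norm (?f z) \<le> real n} \<inter> range hreal"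
      have "E ((?A - {q}) \<union> (?A \<inter> {q})) 1 y = E (?A - {q}) 1 y + E (?A \<inter> {q}) 1 y"
        using nf by (intro P_Un) auto
      moreover have "E (?A \<inter> {q}) 1 y = 0"
        using nf q by (intro resolvent_null) auto
      moreover have "(?A - {q}) \<union> (?A \<inter> {q}) = ?A" by blast
      ultimately show ?thesis by (simp add: B_def)
    qed
    also have "\<dots> = E {z. norm (?f z) \<le> real n} 1 y"
      by (rule E_real[OF nf])
    finally show ?thesis .
  qed
  then show ?thesis
    unfolding calculus_iff[OF f] resolvent_eqI[OF R] y_def by blast
qed

end

lemma functional_calculus_UNIV:
  "functional_calculus V E D f = functional_calculus V E UNIV (\<lambda>z. indicator D z *\<^sub>R f z)"
proof -
  have "truncation D f = truncation UNIV (\<lambda>z. indicator D z *\<^sub>R f z)"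
    by (auto simp: truncation_def indicator_def fun_eq_iff)
  then show ?thesis
    unfolding functional_calculus_def by (simp only:)
qed

theorem mainTheorem5:
  fixes V :: "('k::hypercomplex, 'x::{real_inner, complete_space}) kspace"
    and T :: "'x \<rightharpoonup> 'x"
    and E :: "'k set \<Rightarrow> 'k \<Rightarrow> 'x \<Rightarrow> 'x"
    and D :: "'k set"
    and f :: "'k \<Rightarrow> 'k"
  assumes "K_hilbert_space V"
    and "quasilinear_operator V T" and "densely_defined T" and "selfadjoint V T"
    and "decomposition_of_unity V T E"
    and "D \<in> sets borel" and "\<forall>x. E (- D) 1 x = 0"
    and "f \<in> borel_measurable (restrict_space borel D)"
  shows "let fT = functional_calculus V E D f in
    quasilinear_operator V fT \<and> densely_defined fT \<and> closed_operator fT \<and>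
    dom fT = {x. (\<integral>\<^sup>+z \<in> range hreal \<inter> D. ennreal ((norm (f z))\<^sup>2) \<partial>quadratic_measure V E x) < \<infinity>} \<and>
    (\<forall>x\<in>dom fT. \<forall>y.
      nc_integrable (spectral_nc_measure V E x y) (\<lambda>z. indicator (range hreal \<inter> D) z *\<^sub>R f z) \<and>
      ip V (the (fT x)) y =
        nc_integral (spectral_nc_measure V E x y) (\<lambda>z. indicator (range hreal \<inter> D) z *\<^sub>R f z)) \<and>
    (\<forall>x\<in>dom fT. ennreal ((norm (the (fT x)))\<^sup>2) =
      (\<integral>\<^sup>+z \<in> range hreal \<inter> D. ennreal ((norm (f z))\<^sup>2) \<partial>quadratic_measure V E x)) \<and>
    adjoint_op V fT = functional_calculus V E D (\<lambda>z. hconj (f z)) \<and>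
    (\<forall>q\<in>resolvent_set V T. \<forall>x.
      has_spectral_integral V E (range hreal) (\<lambda>z. hinverse (q - z)) x (resolvent V q T x))"
proof -
  interpret selfadjoint_spectral V T E
    by (intro selfadjoint_spectral.intro spectral_hilbert_space.intro selfadjoint_spectral_axioms.intro assms)
  \<comment> \<open>The null set off \<open>D\<close> and then the null set off the real line are filled with \<open>0\<close>.\<close>
  define g where "g = (\<lambda>z. indicator D z *\<^sub>R f z)"
  define h where "h = (\<lambda>z. indicator (range hreal \<inter> D) z *\<^sub>R f z)"
  have g: "g \<in> borel_measurable borel"
    using assms(6,8) by (simp add: g_def borel_measurable_restrict_space_iff)
  have h_eq: "h = (\<lambda>z. indicator (range hreal) z *\<^sub>R g z)"
    by (auto simp: h_def g_def fun_eq_iff indicator_def)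
  have h: "h \<in> borel_measurable borel"
    unfolding h_eq using g by measurable
  have fT: "functional_calculus V E D f = calculus h"
    unfolding functional_calculus_UNIV[of V E D] g_def[symmetric] h_eq by (rule calculus_line[OF g])
  have fT': "functional_calculus V E D (\<lambda>z. hconj (f z)) = calculus (\<lambda>z. hconj (h z))"
  proof -
    have "functional_calculus V E D (\<lambda>z. hconj (f z)) = calculus (\<lambda>z. hconj (g z))"
      unfolding functional_calculus_UNIV[of V E D] g_def by (simp add: hconj_scaleR)
    also have "\<dots> = calculus (\<lambda>z. hconj (h z))"
      unfolding h_eq hconj_scaleR by (rule calculus_line[OF borel_measurable_hconj[OF g]])
    finally show ?thesis .
  qed
  have nn: "(\<integral>\<^sup>+z \<in> range hreal \<inter> D. ennreal ((norm (f z))\<^sup>2) \<partial>quadratic_measure V E x) =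
      (\<integral>\<^sup>+z. ennreal ((norm (h z))\<^sup>2) \<partial>qmeasure x)" for x
    unfolding quadratic_measure_eq by (intro nn_integral_cong) (auto simp: h_def indicator_def)
  have res: "has_spectral_integral V E (range hreal) (\<lambda>z. hinverse (q - z)) x (resolvent V q T x)"
    if q: "q \<in> resolvent_set V T" for q x
  proof -
    have "(\<lambda>z. indicator (range hreal) z *\<^sub>R hinverse (q - z)) \<in> borel_measurable borel"
      unfolding hinverse_def hconj_eq by measurable
    from nc_integral_calculus[OF this calculus_resolvent[OF q]] show ?thesis
      by (simp add: has_spectral_integral_def)
  qed
  have some: "calculus h x = Some (the (calculus h x))" if "x \<in> dom (calculus h)" for x
    using that by (auto simp: dom_def)
  show ?thesis
    unfolding Let_def fT fT' nn h_def[symmetric]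
    using quasilinear_calculus[OF h] densely_defined_calculus[OF h] closed_calculus[OF h] dom_calculus[OF h]
      nc_integral_calculus[OF h some] norm_calculus[OF h some] adjoint_calculus[OF h] res
    by blast
qed

end
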